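(* Let $a:\mathbb R^m\to\mathbb R^m$ be infinitely differentiable with all derivatives (of order $\ge1$) bounded, and let $U$ be a Lévy process in $\mathbb R^m$ without Gaussian component, with Lévy measure $\Pi$ satisfying $\int_{\|u\|>1}\|u\|^p\,\Pi(du)<+\infty$ for every $p<+\infty$. Let $X(x,\cdot)$ be the solution of $X(x,t)=x+\int_0^ta(X(x,s))\,ds+U_t-U_0$, and let $x\in\mathbb R^m$, $t>0$ be such that the law of $X(x,t)$ has a density $p_{x,t}$ with respect to Lebesgue measure. If $\int_{\|u\|\le1}\|u\|\,\Pi(du)<+\infty$, then: (a) for $r>1$, if $t\boldsymbol\vartheta<m(1-\frac1r)$ then $p_{x,t}\notin L_{r,loc}(\mathbb R^m)$; (b) if $t\boldsymbol\vartheta<m$ then $p_{x,t}$ does not belong to $C(\mathbb R^m)$. If $\int_{\|u\|\le1}\|u\|\,\Pi(du)=+\infty$, then: (a1) for $r>1$, if $t\boldsymbol\vartheta<m(1-\frac1r)$ then $p_{x,t}\notin L_r(\mathbb R^m)$; (b1) if $t\boldsymbol\vartheta<m$ then $p_{x,t}\notin CB^0(\mathbb R^m)=L_\infty(\mathbb R^m)$.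
   Context: $U_t=U_0+\int_0^t\int_{\|u\|>1}u\,\nu(ds,du)+\int_0^t\int_{\|u\|\le1}u\,\tilde\nu(ds,du)$ with $\nu$ a Poisson point measure of intensity $dt\,\Pi(du)$ and $\tilde\nu$ its compensated version. Lower order index: with $S_m=\{v\in\mathbb R^m:\|v\|=1\}$, $$\vartheta(\varepsilon)=\Bigl[\varepsilon^2\ln\tfrac1\varepsilon\Bigr]^{-1}\sup_{v\in S_m}\int_{\mathbb R^m}(|(u,v)|\wedge\varepsilon)^2\,\Pi(du),\qquad \boldsymbol\vartheta=\liminf_{\varepsilon\to0+}\vartheta(\varepsilon)\in[0,+\infty].$$ Membership of the density in a class means having a version in the class. *)

theory Defs
  imports "HOL-Probability.Probability"
begin

section \<open>Levy processes without Gaussian component\<close>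

definition levy_measure :: "'a::euclidean_space measure \<Rightarrow> bool" where
  "levy_measure Lm \<longleftrightarrow>
     sets Lm = sets borel \<and> emeasure Lm {0} = 0 \<and>
     (\<integral>\<^sup>+ u. ennreal (min 1 ((norm u)\<^sup>2)) \<partial>Lm) < \<infinity>"

text \<open>The intensity \<open>dt Lm(du)\<close>, carried by nonnegative times.\<close>

definition levy_intensity :: "'a::euclidean_space measure \<Rightarrow> (real \<times> 'a) measure" where
  "levy_intensity Lm = density lborel (indicator {0..}) \<Otimes>\<^sub>M Lm"

text \<open>A random family of measures \<open>N \<omega>\<close> with values in \<open>{0, 1, 2, \<dots>, \<infinity>}\<close>, Poisson distributed
  on sets of finite intensity and independent on disjoint sets. The values on sets of infinite
  intensity are determined almost surely by countable additivity.\<close>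

definition poisson_point_measure ::
    "'w measure \<Rightarrow> ('w \<Rightarrow> 'b measure) \<Rightarrow> 'b measure \<Rightarrow> bool" where
  "poisson_point_measure M N \<mu> \<longleftrightarrow>
     (\<forall>\<omega>\<in>space M. sets (N \<omega>) = sets \<mu> \<and>
        (\<forall>A\<in>sets \<mu>. \<exists>k::enat. emeasure (N \<omega>) A = ennreal_of_enat k)) \<and>
     (\<forall>A\<in>sets \<mu>. (\<lambda>\<omega>. emeasure (N \<omega>) A) \<in> borel_measurable M) \<and>
     (\<forall>A\<in>sets \<mu>. emeasure \<mu> A < \<infinity> \<longrightarrow>
        (\<forall>k::nat. measure M {\<omega>\<in>space M. emeasure (N \<omega>) A = of_nat k} =
           measure \<mu> A ^ k / fact k * exp (- measure \<mu> A))) \<and>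
     (\<forall>(A :: nat \<Rightarrow> 'b set) n. (\<forall>i<n. A i \<in> sets \<mu>) \<and> disjoint_family_on A {..<n} \<longrightarrow>
        prob_space.indep_vars M (\<lambda>_. borel) (\<lambda>i \<omega>. emeasure (N \<omega>) (A i)) {..<n})"

definition large_jumps :: "('w \<Rightarrow> (real \<times> 'a::euclidean_space) measure) \<Rightarrow> real \<Rightarrow> 'w \<Rightarrow> 'a" where
  "large_jumps N t \<omega> = (LINT z : {0<..t} \<times> {u. 1 < norm u} | N \<omega>. snd z)"

definition compensated_jumps_above ::
    "'a::euclidean_space measure \<Rightarrow> ('w \<Rightarrow> (real \<times> 'a) measure) \<Rightarrow> real \<Rightarrow> real \<Rightarrow> 'w \<Rightarrow> 'a" where
  "compensated_jumps_above Lm N \<delta> t \<omega> =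
     (LINT z : {0<..t} \<times> {u. \<delta> < norm u \<and> norm u \<le> 1} | N \<omega>. snd z) -
     (LINT z : {0<..t} \<times> {u. \<delta> < norm u \<and> norm u \<le> 1} | levy_intensity Lm. snd z)"

text \<open>The integral of \<open>u\<close> against the compensated measure over \<open>{0<..t} \<times> {u. norm u \<le> 1}\<close>, which
  in general does not exist pathwise, is the mean-square limit of its truncations. This determines
  \<open>J\<close> up to almost sure equality.\<close>

definition is_compensated_small_jumps ::
    "'w measure \<Rightarrow> 'a::euclidean_space measure \<Rightarrow> ('w \<Rightarrow> (real \<times> 'a) measure) \<Rightarrow> real \<Rightarrow> ('w \<Rightarrow> 'a) \<Rightarrow> bool"
  where
  "is_compensated_small_jumps M Lm N t J \<longleftrightarrow>
     J \<in> borel_measurable M \<and>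
     ((\<lambda>\<delta>. \<integral>\<^sup>+ \<omega>. ennreal ((norm (compensated_jumps_above Lm N \<delta> t \<omega> - J \<omega>))\<^sup>2) \<partial>M) \<longlongrightarrow> 0)
       (at_right 0)"

definition cadlag :: "(real \<Rightarrow> 'a::topological_space) \<Rightarrow> bool" where
  "cadlag f \<longleftrightarrow>
     (\<forall>t\<ge>0. (f \<longlongrightarrow> f t) (at_right t)) \<and> (\<forall>t>0. \<exists>l. (f \<longlongrightarrow> l) (at_left t))"

text \<open>The Levy--Ito form of the process, with Levy measure \<open>Lm\<close> and arbitrary starting point
  \<open>U 0\<close>. Independence and stationarity of the increments are consequences of it.\<close>

definition levy_process ::
    "'w measure \<Rightarrow> 'a::euclidean_space measure \<Rightarrow> (real \<Rightarrow> 'w \<Rightarrow> 'a) \<Rightarrow> bool" where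
  "levy_process M Lm U \<longleftrightarrow>
     levy_measure Lm \<and>
     (\<forall>t\<ge>0. U t \<in> borel_measurable M) \<and>
     (AE \<omega> in M. cadlag (\<lambda>t. U t \<omega>)) \<and>
     (\<exists>N. poisson_point_measure M N (levy_intensity Lm) \<and>
        (\<forall>t\<ge>0. \<exists>J. is_compensated_small_jumps M Lm N t J \<and>
           (AE \<omega> in M. U t \<omega> = U 0 \<omega> + large_jumps N t \<omega> + J \<omega>)))"


section \<open>The equation\<close>

fun iterated_deriv :: "'a list \<Rightarrow> ('a::real_normed_vector \<Rightarrow> 'b::real_normed_vector) \<Rightarrow> 'a \<Rightarrow> 'b" where
  "iterated_deriv [] f = f"
| "iterated_deriv (v # vs) f = (\<lambda>x. frechet_derivative (iterated_deriv vs f) (at x) v)"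

text \<open>Partial derivatives of order \<open>n\<close> correspond to lists of basis vectors of length \<open>n\<close>. The
  empty list is excluded from the bound: the function itself may grow linearly.\<close>

definition smooth_bounded_derivs ::
    "('a::euclidean_space \<Rightarrow> 'b::real_normed_vector) \<Rightarrow> bool" where
  "smooth_bounded_derivs f \<longleftrightarrow>
     (\<forall>vs. set vs \<subseteq> Basis \<longrightarrow> (\<forall>x. iterated_deriv vs f differentiable (at x))) \<and>
     (\<forall>vs. set vs \<subseteq> Basis \<and> vs \<noteq> [] \<longrightarrow> bounded (range (iterated_deriv vs f)))"

definition solves_equation ::
    "'w measure \<Rightarrow> ('a::euclidean_space \<Rightarrow> 'a) \<Rightarrow> (real \<Rightarrow> 'w \<Rightarrow> 'a) \<Rightarrow> 'a \<Rightarrow> (real \<Rightarrow> 'w \<Rightarrow> 'a) \<Rightarrow> bool" where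
  "solves_equation M a U x X \<longleftrightarrow>
     (\<forall>t\<ge>0. X t \<in> borel_measurable M) \<and>
     (AE \<omega> in M. \<forall>t\<ge>0.
        set_integrable lborel {0..t} (\<lambda>s. a (X s \<omega>)) \<and>
        X t \<omega> = x + (LBINT s:{0..t}. a (X s \<omega>)) + U t \<omega> - U 0 \<omega>)"


section \<open>The lower order index\<close>

definition order_fun :: "'a::euclidean_space measure \<Rightarrow> real \<Rightarrow> ennreal" where
  "order_fun Lm \<epsilon> =
     ennreal (inverse (\<epsilon>\<^sup>2 * ln (1 / \<epsilon>))) *
     (SUP v\<in>sphere 0 1. \<integral>\<^sup>+ u. ennreal ((min \<bar>u \<bullet> v\<bar> \<epsilon>)\<^sup>2) \<partial>Lm)"

definition lower_order_index :: "'a::euclidean_space measure \<Rightarrow> ennreal" where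
  "lower_order_index Lm = Liminf (at_right 0) (order_fun Lm)"


section \<open>Function classes\<close>

definition has_version_in :: "('a::euclidean_space \<Rightarrow> real) \<Rightarrow> ('a \<Rightarrow> real) set \<Rightarrow> bool" where
  "has_version_in p F \<longleftrightarrow> (\<exists>g\<in>F. AE y in lborel. p y = g y)"

definition Lr_class :: "real \<Rightarrow> ('a::euclidean_space \<Rightarrow> real) set" where
  "Lr_class r = {g \<in> borel_measurable borel. integrable lborel (\<lambda>y. \<bar>g y\<bar> powr r)}"

definition Lr_loc_class :: "real \<Rightarrow> ('a::euclidean_space \<Rightarrow> real) set" where
  "Lr_loc_class r =
     {g \<in> borel_measurable borel.
        \<forall>K. compact K \<longrightarrow> set_integrable lborel K (\<lambda>y. \<bar>g y\<bar> powr r)}"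

definition C_class :: "('a::euclidean_space \<Rightarrow> real) set" where
  "C_class = {g. continuous_on UNIV g}"

text \<open>By convention \<open>CB\<^sup>0\<close> is \<open>L\<^sub>\<infinity>\<close>: essentially bounded functions, continuity not required.\<close>

definition CB0_class :: "('a::euclidean_space \<Rightarrow> real) set" where
  "CB0_class = {g \<in> borel_measurable borel. \<exists>C. AE y in lborel. \<bar>g y\<bar> \<le> C}"

end

theory Submission
  imports Defs "HOL-Real_Asymp.Real_Asymp"
begin

text \<open>
  The law of \<open>X t\<close> puts too much mass on small balls. Let \<open>A\<close> be the event that no jump exceeds
  \<open>\<rho> = \<epsilon> / c\<close> before time \<open>t\<close>. Averaging the directional truncated moments in the order index over
  directions gives, along a sequence of \<open>\<epsilon>\<close> tending to 0, that the Levy measure of \<open>{norm u > \<rho>}\<close> is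
  at most \<open>\<theta> ln (1/\<epsilon>)\<close> with \<open>\<theta>\<close> as close to the index as desired, so \<open>A\<close> has probability at least
  \<open>\<epsilon> powr (t \<theta>)\<close>, and that on \<open>A\<close> the driving noise deviates from a deterministic path by
  \<open>O(\<epsilon> sqrt (ln (1/\<epsilon>)))\<close> in mean square. Since the noise is additive and the drift Lipschitz, any two
  solution paths on a large part of \<open>A\<close> are then at distance \<open>r = O(\<epsilon> sqrt (ln (1/\<epsilon>)))\<close> at time \<open>t\<close>.
  Hence some ball of radius \<open>r\<close> has probability at least \<open>\<epsilon> powr (t \<theta>) / 2\<close>, which exceeds every multiple
  of \<open>r powr \<kappa>\<close> when \<open>t \<theta> < \<kappa>\<close>; a density in the given class bounds ball probabilities by such a
  multiple. If the small jumps are summable, the compensators stay bounded and so do the centres of the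
  balls, which gives the local statements.
\<close>

section \<open>Stability of equations with additive noise\<close>

text \<open>The coefficient of \<open>ln (1/\<epsilon>)\<close> in the tail bound becomes the
  exponent of the probability of \<open>A\<close>, so a constant factor lost there would shift the
  threshold. Constants lost in \<open>c\<close> or in the radius are harmless, and the strict
  inequality \<open>t \<theta> < \<kappa>\<close> absorbs the logarithm in the radius. Working
  coordinate by coordinate would cost a factor depending on the dimension; averaging over directions
  costs only \<open>1 - \<eta>\<close>, arbitrarily close to 1. Conditioning on \<open>A\<close> is
  free because a Poisson measure is independent on disjoint sets: second moments on \<open>A\<close>
  are, up to a constant, those of the small jumps times the probability of \<open>A\<close>, so
  Markov's inequality discards only half of \<open>A\<close>. The obstacle is the compensator of the
  missing jumps, which may diverge as \<epsilon> tends to 0. It is deterministic, so it cancels when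
  two outcomes in \<open>A\<close> are compared, and the centre of the ball is the value of the
  solution at one such outcome. Because the noise is additive, the comparison needs its deviation
  only at time \<open>t\<close> and on average over time; moments at fixed times and Fubini provide
  both, without a maximal inequality.\<close>

lemma gronwall_integral:
  fixes g :: "real \<Rightarrow> real"
  assumes "0 \<le> T" "0 \<le> L" and cont: "continuous_on {0..T} g"
    and le: "\<And>s. s \<in> {0..T} \<Longrightarrow> g s \<le> B + L * integral {0..s} g"
  shows "g T \<le> B * exp (L * T)"
proof -
  \<comment> \<open>Integrating factor: the derivative of \<open>\<phi>\<close> is a nonnegative
    multiple of \<open>g s - (B + L * integral {0..s} g)\<close>, so \<open>\<phi>\<close> cannot
    increase.\<close>
  define \<phi> where "\<phi> s = (B + L * integral {0..s} g) * exp (- (L * s))" for s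
  have int: "g integrable_on {0..T}"
    using cont by (rule integrable_continuous_interval)
  have "\<phi> T \<le> \<phi> 0"
  proof (rule DERIV_nonpos_imp_decreasing_open[OF \<open>0 \<le> T\<close>])
    fix s assume s: "0 < s" "s < T"
    have "((\<lambda>x. integral {0..x} g) has_real_derivative g s) (at s within {0..T})"
      using integral_has_real_derivative[OF cont] s by auto
    then have "((\<lambda>x. integral {0..x} g) has_real_derivative g s) (at s)"
      using s by (simp add: at_within_Icc_at)
    then have "(\<phi> has_real_derivative
        L * g s * exp (- (L * s)) + (B + L * integral {0..s} g) * (exp (- (L * s)) * - L)) (at s)"
      unfolding \<phi>_def by (auto intro!: derivative_eq_intros)
    moreover have "L * g s * exp (- (L * s)) + (B + L * integral {0..s} g) * (exp (- (L * s)) * - L)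
        = L * exp (- (L * s)) * (g s - (B + L * integral {0..s} g))"
      by (simp add: algebra_simps)
    moreover have "\<dots> \<le> 0"
      using le[of s] s \<open>0 \<le> L\<close> by (intro mult_nonneg_nonpos) auto
    ultimately show "\<exists>y. (\<phi> has_real_derivative y) (at s) \<and> y \<le> 0" by metis
  next
    show "continuous_on {0..T} \<phi>"
      unfolding \<phi>_def by (intro continuous_intros indefinite_integral_continuous_1 int)
  qed
  then have "B + L * integral {0..T} g \<le> B * exp (L * T)"
    by (simp add: \<phi>_def exp_minus divide_simps mult.commute)
  then show ?thesis using le[of T] \<open>0 \<le> T\<close> by simp
qed

text \<open>\<open>X1 - X2\<close> may jump, but \<open>W\<close>, which is this difference minus
  the noise difference \<open>D\<close>, is an integral and hence continuous, so Gronwall applies to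
  its norm. The noise then enters only through its value at \<open>t\<close> and its time integral,
  quantities that moments at fixed times can control.\<close>

lemma additive_noise_stability:
  fixes X1 X2 V1 V2 :: "real \<Rightarrow> 'a::euclidean_space"
  assumes "0 \<le> t" "0 \<le> L" and lip: "\<And>x y. norm (a x - a y) \<le> L * norm (x - y)"
    and int1: "set_integrable lborel {0..t} (\<lambda>r. a (X1 r))"
    and int2: "set_integrable lborel {0..t} (\<lambda>r. a (X2 r))"
    and X1: "\<And>s. s \<in> {0..t} \<Longrightarrow> X1 s = x + (LBINT r:{0..s}. a (X1 r)) + V1 s"
    and X2: "\<And>s. s \<in> {0..t} \<Longrightarrow> X2 s = x + (LBINT r:{0..s}. a (X2 r)) + V2 s"
    and intD: "set_integrable lborel {0..t} (\<lambda>s. V1 s - V2 s)"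
  shows "norm (X1 t - X2 t) \<le>
    norm (V1 t - V2 t) + L * exp (L * t) * (LBINT s:{0..t}. norm (V1 s - V2 s))"
proof -
  define h where "h r = a (X1 r) - a (X2 r)" for r
  define D where "D s = V1 s - V2 s" for s
  define W where "W s = (LBINT r:{0..s}. h r)" for s
  have sub: "{0..s} \<subseteq> {0..t}" if "s \<in> {0..t}" for s using that by auto
  have inth: "set_integrable lborel {0..t} h"
    unfolding h_def using int1 int2 by (rule set_integral_diff)
  have inth': "set_integrable lborel {0..s} h" if "s \<in> {0..t}" for s
    using inth by (rule set_integrable_subset) (use sub[OF that] in auto)
  have diff: "X1 s - X2 s = W s + D s" if s: "s \<in> {0..t}" for s
  proof -
    have "W s = (LBINT r:{0..s}. a (X1 r)) - (LBINT r:{0..s}. a (X2 r))"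
      unfolding W_def h_def
      by (rule set_integral_diff; rule set_integrable_subset[of _ "{0..t}"])
         (use int1 int2 sub[OF s] in auto)
    then show ?thesis using X1[OF s] X2[OF s] by (simp add: D_def)
  qed
  have hle: "norm (h r) \<le> L * (norm (W r) + norm (D r))" if "r \<in> {0..t}" for r
    using lip[of "X1 r" "X2 r"] norm_triangle_ineq[of "W r" "D r"] \<open>0 \<le> L\<close> diff[OF that]
    unfolding h_def by (smt (verit) mult_left_mono)
  have Wint: "W s = integral {0..s} h" if "s \<in> {0..t}" for s
    unfolding W_def using inth'[OF that] by (rule set_borel_integral_eq_integral)
  have contW: "continuous_on {0..t} W"
  proof -
    have "continuous_on {0..t} (\<lambda>s. integral {0..s} h)"
      by (intro indefinite_integral_continuous_1 set_borel_integral_eq_integral(1) inth)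
    then show ?thesis by (rule continuous_on_eq) (use Wint in auto)
  qed
  then have contg: "continuous_on {0..t} (\<lambda>s. norm (W s))" by (intro continuous_intros)
  have intg: "set_integrable lborel {0..s} (\<lambda>s. norm (W s))" if "s \<in> {0..t}" for s
    unfolding set_integrable_def
    by (rule borel_integrable_compact) (use continuous_on_subset[OF contg sub[OF that]] in auto)
  have intnD: "set_integrable lborel {0..t} (\<lambda>s. norm (D s))"
    unfolding D_def using intD by (rule set_integrable_norm)
  \<comment> \<open>Integrating over all of \<open>{0..t}\<close> instead of \<open>{0..s}\<close>
    makes \<open>B\<close> constant in \<open>s\<close>, as Gronwall requires.\<close>
  define B where "B = L * (LBINT s:{0..t}. norm (D s))"
  have "norm (W s) \<le> B + L * integral {0..s} (\<lambda>s. norm (W s))" if s: "s \<in> {0..t}" for s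
  proof -
    have intnD': "set_integrable lborel {0..s} (\<lambda>s. norm (D s))"
      using intnD by (rule set_integrable_subset) (use sub[OF s] in auto)
    have "norm (W s) \<le> (LBINT r:{0..s}. norm (h r))"
      unfolding W_def using inth'[OF s] by (rule set_integral_norm_bound)
    also have "\<dots> \<le> (LBINT r:{0..s}. L * (norm (W r) + norm (D r)))"
    proof (rule set_integral_mono)
      show "set_integrable lborel {0..s} (\<lambda>r. norm (h r))"
        using inth'[OF s] by (rule set_integrable_norm)
      show "set_integrable lborel {0..s} (\<lambda>r. L * (norm (W r) + norm (D r)))"
        using intg[OF s] intnD' by (intro set_integrable_mult_right set_integral_add)
      show "norm (h r) \<le> L * (norm (W r) + norm (D r))" if "r \<in> {0..s}" for r
        using hle[of r] sub[OF s] that by auto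
    qed
    also have "\<dots> = L * (LBINT r:{0..s}. norm (W r)) + L * (LBINT r:{0..s}. norm (D r))"
      using intg[OF s] intnD' by (simp add: algebra_simps)
    also have "(LBINT r:{0..s}. norm (D r)) \<le> (LBINT r:{0..t}. norm (D r))"
      unfolding set_lebesgue_integral_def
      using intnD intnD' sub[OF s] unfolding set_integrable_def
      by (intro integral_mono) (auto simp: indicator_def)
    also have "(LBINT r:{0..s}. norm (W r)) = integral {0..s} (\<lambda>s. norm (W s))"
      using intg[OF s] by (rule set_borel_integral_eq_integral)
    finally show ?thesis using \<open>0 \<le> L\<close> by (simp add: B_def mult_left_mono)
  qed
  then have "norm (W t) \<le> B * exp (L * t)"
    using gronwall_integral[OF \<open>0 \<le> t\<close> \<open>0 \<le> L\<close> contg, of B] by blast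
  moreover have "norm (X1 t - X2 t) \<le> norm (W t) + norm (D t)"
    using diff[of t] \<open>0 \<le> t\<close> norm_triangle_ineq[of "W t" "D t"] by simp
  ultimately show ?thesis by (simp add: B_def D_def mult_ac)
qed

lemma smooth_bounded_derivs_lipschitz:
  fixes a :: "'a::euclidean_space \<Rightarrow> 'b::real_normed_vector"
  assumes "smooth_bounded_derivs a"
  obtains L where "0 \<le> L" "\<And>x y. norm (a x - a y) \<le> L * norm (x - y)"
proof -
  have diff: "a differentiable (at x)" for x
    using assms unfolding smooth_bounded_derivs_def by (metis iterated_deriv.simps(1) empty_iff list.set(1) subsetI)
  have "\<exists>B. \<forall>x. norm (frechet_derivative a (at x) b) \<le> B" if "b \<in> Basis" for b
  proof -
    have "bounded (range (iterated_deriv [b] a))"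
      using assms that unfolding smooth_bounded_derivs_def by (metis empty_set list.distinct(1) list.simps(15) empty_subsetI insert_subset)
    then show ?thesis unfolding bounded_iff by auto
  qed
  then obtain B where B: "\<And>b x. b \<in> Basis \<Longrightarrow> norm (frechet_derivative a (at x) b) \<le> B b"
    by metis
  \<comment> \<open>When an increment is expanded in the basis, each coordinate is at most its norm,
    so the bounds on the partial derivatives add up to a bound on the operator norm.\<close>
  define L where "L = (\<Sum>b\<in>Basis. B b)"
  have B0: "0 \<le> B b" if "b \<in> Basis" for b
    using B[OF that, of 0] norm_ge_zero order_trans by blast
  have "onorm (frechet_derivative a (at x)) \<le> L" for x
  proof (rule onorm_le)
    fix h
    interpret linear "frechet_derivative a (at x)"
      using diff by (simp add: linear_frechet_derivative)
    have "frechet_derivative a (at x) h = (\<Sum>b\<in>Basis. (h \<bullet> b) *\<^sub>R frechet_derivative a (at x) b)"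
      by (subst (1) euclidean_representation[of h, symmetric]) (simp add: sum scale)
    also have "norm \<dots> \<le> (\<Sum>b\<in>Basis. norm h * B b)"
      by (intro sum_norm_le) (auto intro!: mult_mono B simp: Basis_le_norm)
    finally show "norm (frechet_derivative a (at x) h) \<le> L * norm h"
      by (simp add: L_def sum_distrib_left mult.commute)
  qed
  then have "norm (a x - a y) \<le> L * norm (x - y)" for x y
    using differentiable_bound[of UNIV a "\<lambda>x. frechet_derivative a (at x)" L x y] diff
    by (simp add: frechet_derivative_works)
  moreover have "0 \<le> L" unfolding L_def using B0 by (intro sum_nonneg)
  ultimately show ?thesis using that by blast
qed

section \<open>Second moments of Poisson integrals\<close>

text \<open>The recursion \<open>step\<close> turns each moment into a shifted copy of lower ones;
  the term at \<open>k = 0\<close> vanishes in the weighted series, so nothing is lost in the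
  shift.\<close>

lemma poisson_moment_sums:
  fixes l :: real
  shows "(\<lambda>k. l ^ k / fact k * exp (- l)) sums 1"
    and "(\<lambda>k. real k * (l ^ k / fact k * exp (- l))) sums l"
    and "(\<lambda>k. (real k)\<^sup>2 * (l ^ k / fact k * exp (- l))) sums (l\<^sup>2 + l)"
proof -
  define p where "p k = l ^ k / fact k * exp (- l)" for k
  have "(\<lambda>k. l ^ k / fact k) sums exp l"
    using exp_converges[of l] by (simp add: divide_inverse_commute)
  then have 0: "p sums 1"
    unfolding p_def using sums_mult2[of "\<lambda>k. l ^ k / fact k" "exp l" "exp (- l)"]
    by (simp add: exp_minus_inverse)
  have step: "real (Suc k) * p (Suc k) = l * p k" for k
    by (simp add: p_def divide_simps)
  have "(\<lambda>k. real (Suc k) * p (Suc k)) sums (l * 1)"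
    unfolding step by (rule sums_mult[OF 0])
  then have 1: "(\<lambda>k. real k * p k) sums l"
    using sums_Suc_iff[of "\<lambda>k. real k * p k"] by simp
  have "(real (Suc k))\<^sup>2 * p (Suc k) = l * (real k * p k) + l * p k" for k
  proof -
    have "(real (Suc k))\<^sup>2 * p (Suc k) = real (Suc k) * (l * p k)"
      unfolding power2_eq_square mult.assoc step ..
    then show ?thesis by (simp add: algebra_simps)
  qed
  then have "(\<lambda>k. (real (Suc k))\<^sup>2 * p (Suc k)) = (\<lambda>k. l * (real k * p k) + l * p k)" by simp
  also have "\<dots> sums (l * l + l * 1)"
    by (intro sums_add sums_mult 0 1)
  finally have "(\<lambda>k. (real k)\<^sup>2 * p k) sums (l\<^sup>2 + l)"
    using sums_Suc_iff[of "\<lambda>k. (real k)\<^sup>2 * p k"] by (simp add: power2_eq_square)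
  with 0 1 show "(\<lambda>k. l ^ k / fact k * exp (- l)) sums 1"
    and "(\<lambda>k. real k * (l ^ k / fact k * exp (- l))) sums l"
    and "(\<lambda>k. (real k)\<^sup>2 * (l ^ k / fact k * exp (- l))) sums (l\<^sup>2 + l)"
    unfolding p_def by blast+
qed

text \<open>The hypothesis gives the atoms at finite values only. Since the Poisson weights already
  sum to one, the value infinity has probability zero, and every expectation becomes a series over
  the atoms.\<close>

lemma (in prob_space) poisson_variable_moments:
  fixes Y :: "'a \<Rightarrow> ennreal"
  assumes Y[measurable]: "Y \<in> borel_measurable M" and "0 \<le> l"
    and law: "\<And>k::nat. prob {\<omega>\<in>space M. Y \<omega> = of_nat k} = l ^ k / fact k * exp (- l)"
  shows "AE \<omega> in M. Y \<omega> < \<infinity>"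
    and "integrable M (\<lambda>\<omega>. enn2real (Y \<omega>) - l)" "expectation (\<lambda>\<omega>. enn2real (Y \<omega>) - l) = 0"
    and "integrable M (\<lambda>\<omega>. (enn2real (Y \<omega>) - l)\<^sup>2)" "expectation (\<lambda>\<omega>. (enn2real (Y \<omega>) - l)\<^sup>2) = l"
proof -
  define S where "S k = {\<omega>\<in>space M. Y \<omega> = of_nat k}" for k
  define p where "p k = l ^ k / fact k * exp (- l)" for k
  have [measurable]: "S k \<in> sets M" for k unfolding S_def by measurable
  have pS: "emeasure M (S k) = ennreal (p k)" for k
    using law[of k] by (simp add: S_def p_def emeasure_eq_measure)
  have p0: "0 \<le> p k" for k using \<open>0 \<le> l\<close> by (simp add: p_def)
  have disj: "disjoint_family S" by (auto simp: disjoint_family_on_def S_def)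
  have "emeasure M (\<Union>k. S k) = (\<Sum>k. emeasure M (S k))"
    by (rule suminf_emeasure[symmetric]) (use disj in auto)
  also have "\<dots> = ennreal (\<Sum>k. p k)"
    unfolding pS using p0 poisson_moment_sums(1)[of l] by (intro suminf_ennreal2) (auto simp: p_def sums_iff)
  also have "(\<Sum>k. p k) = 1" using poisson_moment_sums(1)[of l] by (simp add: p_def sums_iff)
  finally have "prob (\<Union>k. S k) = 1" by (simp add: measure_def)
  then have ae: "AE \<omega> in M. \<omega> \<in> (\<Union>k. S k)" by (subst (asm) prob_eq_1) auto
  then show "AE \<omega> in M. Y \<omega> < \<infinity>" by eventually_elim (auto simp: S_def less_top[symmetric] ennreal_of_nat_eq_real_of_nat)
  have expect: "integrable M (\<lambda>\<omega>. h (enn2real (Y \<omega>))) \<and> expectation (\<lambda>\<omega>. h (enn2real (Y \<omega>))) = r"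
    if h0: "\<And>x. 0 \<le> h x" and hm: "h \<in> borel_measurable borel" and sums: "(\<lambda>k. h (real k) * p k) sums r"
    for h :: "real \<Rightarrow> real" and r
  proof -
    note hm[measurable]
    have "(\<integral>\<^sup>+ \<omega>. ennreal (h (enn2real (Y \<omega>))) \<partial>M) =
        (\<integral>\<^sup>+ \<omega>. (\<Sum>k. ennreal (h (real k)) * indicator (S k) \<omega>) \<partial>M)"
    proof (rule nn_integral_cong_AE, use ae in eventually_elim)
      fix \<omega> assume "\<omega> \<in> (\<Union>k. S k)"
      then obtain k where k: "\<omega> \<in> S k" by auto
      have eq: "ennreal (h (real j)) * indicator (S j) \<omega> =
          (if j = k then ennreal (h (enn2real (Y \<omega>))) else 0)" for j
        using k by (auto simp: S_def indicator_def enn2real_eq_posreal_iff ennreal_of_nat_eq_real_of_nat)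
      show "ennreal (h (enn2real (Y \<omega>))) = (\<Sum>k. ennreal (h (real k)) * indicator (S k) \<omega>)"
        unfolding eq by (subst suminf_finite[of "{k}"]) auto
    qed
    also have "\<dots> = (\<Sum>k. \<integral>\<^sup>+ \<omega>. ennreal (h (real k)) * indicator (S k) \<omega> \<partial>M)"
      by (rule nn_integral_suminf) simp
    also have "\<dots> = (\<Sum>k. ennreal (h (real k) * p k))"
      by (simp add: nn_integral_cmult_indicator pS ennreal_mult h0 p0)
    also have "\<dots> = ennreal r"
      using sums h0 p0 by (subst suminf_ennreal2) (auto simp: sums_iff)
    finally have eq: "(\<integral>\<^sup>+ \<omega>. ennreal (h (enn2real (Y \<omega>))) \<partial>M) = ennreal r" .
    have "0 \<le> r" using sums h0 p0 by (auto simp: sums_iff intro!: suminf_nonneg)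
    then show ?thesis
      using eq by (subst (asm) nn_integral_eq_integrable) (auto simp: h0)
  qed
  \<comment> \<open>\<open>expect\<close> asks for a function that is nonnegative on all reals,
    which the identity is not; on values of \<open>enn2real\<close> the maximum with 0 changes
    nothing.\<close>
  have 1: "integrable M (\<lambda>\<omega>. enn2real (Y \<omega>))" "expectation (\<lambda>\<omega>. enn2real (Y \<omega>)) = l"
    using expect[of "\<lambda>x. max 0 x" l] poisson_moment_sums(2)[of l] by (simp_all add: p_def max_def)
  have 2: "integrable M (\<lambda>\<omega>. (enn2real (Y \<omega>))\<^sup>2)" "expectation (\<lambda>\<omega>. (enn2real (Y \<omega>))\<^sup>2) = l\<^sup>2 + l"
    using expect[of "\<lambda>x. x\<^sup>2" "l\<^sup>2 + l"] poisson_moment_sums(3)[of l] by (simp_all add: p_def)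
  show "integrable M (\<lambda>\<omega>. enn2real (Y \<omega>) - l)" "expectation (\<lambda>\<omega>. enn2real (Y \<omega>) - l) = 0"
    using 1 by (simp_all add: prob_space)
  have eq: "(enn2real (Y \<omega>) - l)\<^sup>2 = (enn2real (Y \<omega>))\<^sup>2 - 2 * l * enn2real (Y \<omega>) + l\<^sup>2" for \<omega>
    by (simp add: power2_eq_square algebra_simps)
  show "integrable M (\<lambda>\<omega>. (enn2real (Y \<omega>) - l)\<^sup>2)" "expectation (\<lambda>\<omega>. (enn2real (Y \<omega>) - l)\<^sup>2) = l"
    unfolding eq using 1 2 by (simp_all add: prob_space power2_eq_square)
qed

lemma ppm_sets:
  assumes "poisson_point_measure M N \<mu>" "\<omega> \<in> space M"
  shows "sets (N \<omega>) = sets \<mu>" "space (N \<omega>) = space \<mu>"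
  using assms by (auto simp: poisson_point_measure_def dest: sets_eq_imp_space_eq)

lemma ppm_measurable:
  assumes "poisson_point_measure M N \<mu>" "A \<in> sets \<mu>"
  shows "(\<lambda>\<omega>. emeasure (N \<omega>) A) \<in> borel_measurable M"
  using assms by (auto simp: poisson_point_measure_def)

lemma ppm_law:
  assumes "poisson_point_measure M N \<mu>" "A \<in> sets \<mu>" "emeasure \<mu> A < \<infinity>"
  shows "measure M {\<omega>\<in>space M. emeasure (N \<omega>) A = of_nat k} =
           measure \<mu> A ^ k / fact k * exp (- measure \<mu> A)"
  using assms by (auto simp: poisson_point_measure_def)

lemma ppm_indep:
  fixes n :: nat
  assumes "poisson_point_measure M N \<mu>" "\<And>i. i < n \<Longrightarrow> A i \<in> sets \<mu>" "disjoint_family_on A {..<n}"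
  shows "prob_space.indep_vars M (\<lambda>_. borel) (\<lambda>i \<omega>. emeasure (N \<omega>) (A i)) {..<n}"
  using assms unfolding poisson_point_measure_def by simp

lemma (in prob_space) ppm_void_probability:
  assumes "poisson_point_measure M N \<mu>" "A \<in> sets \<mu>" "emeasure \<mu> A < \<infinity>"
  shows "prob {\<omega>\<in>space M. emeasure (N \<omega>) A = 0} = exp (- measure \<mu> A)"
  using ppm_law[OF assms, of 0] by simp

lemma (in prob_space) ppm_AE_finite:
  assumes "poisson_point_measure M N \<mu>" "A \<in> sets \<mu>" "emeasure \<mu> A < \<infinity>"
  shows "AE \<omega> in M. emeasure (N \<omega>) A < \<infinity>"
  by (rule poisson_variable_moments(1)[OF ppm_measurable[OF assms(1,2)] measure_nonneg ppm_law[OF assms]])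

text \<open>Index 0 is reserved for the set required to be void. Its count is independent of the
  others, so the indicator of \<open>E\<close> factors out as \<open>prob E\<close>, and the mixed
  terms vanish because the remaining counts are independent and centred. What is left is the
  diagonal, where the variance of a Poisson count equals its mean.\<close>

lemma (in prob_space) ppm_centered_sum_second_moment:
  fixes c :: "nat \<Rightarrow> 'c::real_inner"
  assumes ppm: "poisson_point_measure M N \<mu>"
    and A: "\<And>i. i \<le> n \<Longrightarrow> A i \<in> sets \<mu>" "\<And>i. i \<le> n \<Longrightarrow> emeasure \<mu> (A i) < \<infinity>"
    and disj: "disjoint_family_on A {..n}"
  defines "E \<equiv> {\<omega>\<in>space M. emeasure (N \<omega>) (A 0) = 0}"
    and "Y \<equiv> \<lambda>i \<omega>. enn2real (emeasure (N \<omega>) (A i)) - measure \<mu> (A i)"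
  shows "integrable M (\<lambda>\<omega>. indicator E \<omega> * (norm (\<Sum>i\<in>{1..n}. Y i \<omega> *\<^sub>R c i))\<^sup>2)"
    and "expectation (\<lambda>\<omega>. indicator E \<omega> * (norm (\<Sum>i\<in>{1..n}. Y i \<omega> *\<^sub>R c i))\<^sup>2) =
      prob E * (\<Sum>i\<in>{1..n}. measure \<mu> (A i) * (norm (c i))\<^sup>2)"
proof -
  define I :: "'a \<Rightarrow> real" where "I \<omega> = indicator {0} (emeasure (N \<omega>) (A 0))" for \<omega>
  have I: "I \<omega> = indicator E \<omega>" if "\<omega> \<in> space M" for \<omega>
    using that by (auto simp: I_def E_def indicator_def)
  have [measurable]: "(\<lambda>\<omega>. emeasure (N \<omega>) (A i)) \<in> borel_measurable M" if "i \<le> n" for i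
    using ppm_measurable[OF ppm A(1)[OF that]] .
  have [measurable]: "E \<in> sets M" unfolding E_def by measurable
  have Im[measurable]: "I \<in> borel_measurable M"
    unfolding I_def by measurable
  have Iint: "integrable M I"
    by (rule integrable_const_bound[of _ 1]) (auto simp: I_def indicator_def)
  have EI: "expectation I = prob E"
  proof -
    have "expectation I = expectation (indicator E)" by (rule Bochner_Integration.integral_cong) (auto simp: I)
    then show ?thesis by simp
  qed
  have mom: "integrable M (Y i)" "expectation (Y i) = 0"
      "integrable M (\<lambda>\<omega>. (Y i \<omega>)\<^sup>2)" "expectation (\<lambda>\<omega>. (Y i \<omega>)\<^sup>2) = measure \<mu> (A i)" if "i \<le> n" for i
    unfolding Y_def
    by (rule poisson_variable_moments[OF ppm_measurable[OF ppm A(1)[OF that]] measure_nonneg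
      ppm_law[OF ppm A(1)[OF that] A(2)[OF that]]])+
  have indep: "indep_vars (\<lambda>_. borel) (\<lambda>i \<omega>. emeasure (N \<omega>) (A i)) {..<Suc n}"
    by (rule ppm_indep[OF ppm]) (use A(1) disj in \<open>auto simp: lessThan_Suc_atMost\<close>)
  have cross: "integrable M (\<lambda>\<omega>. I \<omega> * (Y i \<omega> * Y j \<omega>)) \<and>
     expectation (\<lambda>\<omega>. I \<omega> * (Y i \<omega> * Y j \<omega>)) = (if i = j then prob E * measure \<mu> (A i) else 0)"
    if ij: "i \<in> {1..n}" "j \<in> {1..n}" for i j
  proof (cases "i = j")
    case True
    \<comment> \<open>Both cases write the factors as functions \<open>G l\<close> of the counts, so
      that the product rule for independent variables applies. On the diagonal the square has to be
      a single factor, since \<open>Y i\<close> is not independent of itself.\<close>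
    define G where "G l x = (if l = 0 then indicator {0} x else (enn2real x - measure \<mu> (A l))\<^sup>2)"
      for l :: nat and x :: ennreal
    have ind: "indep_vars (\<lambda>_. borel) (\<lambda>l \<omega>. G l (emeasure (N \<omega>) (A l))) {0, i}"
      by (rule indep_vars_compose2[OF indep_vars_subset[OF indep]]) (use ij in \<open>auto simp: G_def[abs_def]\<close>)
    have G: "G 0 (emeasure (N \<omega>) (A 0)) = I \<omega>" "G i (emeasure (N \<omega>) (A i)) = (Y i \<omega>)\<^sup>2" for \<omega>
      using ij by (simp_all add: G_def I_def Y_def)
    have int: "integrable M (\<lambda>\<omega>. G l (emeasure (N \<omega>) (A l)))" if "l \<in> {0, i}" for l
      using that Iint mom(3)[of i] ij by (auto simp: G)
    have "expectation (\<lambda>\<omega>. (Y i \<omega>)\<^sup>2) = measure \<mu> (A i)"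
      using mom(4)[of i] ij by simp
    moreover have "(\<Prod>l\<in>{0, i}. G l (emeasure (N \<omega>) (A l))) = I \<omega> * (Y i \<omega> * Y j \<omega>)" for \<omega>
      using ij unfolding True[symmetric] by (simp add: G power2_eq_square del: One_nat_def)
    moreover have "integrable M (\<lambda>\<omega>. \<Prod>l\<in>{0, i}. G l (emeasure (N \<omega>) (A l)))"
      by (rule indep_vars_integrable[OF _ ind int]) auto
    moreover have "expectation (\<lambda>\<omega>. \<Prod>l\<in>{0, i}. G l (emeasure (N \<omega>) (A l))) =
        (\<Prod>l\<in>{0, i}. expectation (\<lambda>\<omega>. G l (emeasure (N \<omega>) (A l))))"
      by (rule indep_vars_lebesgue_integral[OF _ ind int]) auto
    ultimately show ?thesis
      using ij unfolding True[symmetric] by (simp add: G EI)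
  next
    case False
    define G where "G l x = (if l = 0 then indicator {0} x else enn2real x - measure \<mu> (A l))"
      for l :: nat and x :: ennreal
    have ind: "indep_vars (\<lambda>_. borel) (\<lambda>l \<omega>. G l (emeasure (N \<omega>) (A l))) {0, i, j}"
      by (rule indep_vars_compose2[OF indep_vars_subset[OF indep]]) (use ij in \<open>auto simp: G_def[abs_def]\<close>)
    have G: "G 0 (emeasure (N \<omega>) (A 0)) = I \<omega>" "G i (emeasure (N \<omega>) (A i)) = Y i \<omega>"
      "G j (emeasure (N \<omega>) (A j)) = Y j \<omega>" for \<omega>
      using ij by (simp_all add: G_def I_def Y_def)
    have int: "integrable M (\<lambda>\<omega>. G l (emeasure (N \<omega>) (A l)))" if "l \<in> {0, i, j}" for l
      using that Iint mom(1)[of i] mom(1)[of j] ij by (auto simp: G)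
    have "expectation (Y i) = 0"
      using mom(2)[of i] ij by simp
    moreover have "(\<Prod>l\<in>{0, i, j}. G l (emeasure (N \<omega>) (A l))) = I \<omega> * (Y i \<omega> * Y j \<omega>)" for \<omega>
      using ij False by (simp add: G del: One_nat_def)
    moreover have "integrable M (\<lambda>\<omega>. \<Prod>l\<in>{0, i, j}. G l (emeasure (N \<omega>) (A l)))"
      by (rule indep_vars_integrable[OF _ ind int]) auto
    moreover have "expectation (\<lambda>\<omega>. \<Prod>l\<in>{0, i, j}. G l (emeasure (N \<omega>) (A l))) =
        (\<Prod>l\<in>{0, i, j}. expectation (\<lambda>\<omega>. G l (emeasure (N \<omega>) (A l))))"
      by (rule indep_vars_lebesgue_integral[OF _ ind int]) auto
    ultimately show ?thesis
      using ij False by (simp add: G)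
  qed
  define H where "H \<omega> = (\<Sum>i\<in>{1..n}. \<Sum>j\<in>{1..n}. (c i \<bullet> c j) * (I \<omega> * (Y i \<omega> * Y j \<omega>)))" for \<omega>
  have H: "indicator E \<omega> * (norm (\<Sum>i\<in>{1..n}. Y i \<omega> *\<^sub>R c i))\<^sup>2 = H \<omega>" if "\<omega> \<in> space M" for \<omega>
  proof -
    have "(norm (\<Sum>i\<in>{1..n}. Y i \<omega> *\<^sub>R c i))\<^sup>2 =
        (\<Sum>i\<in>{1..n}. \<Sum>j\<in>{1..n}. (Y i \<omega> *\<^sub>R c i) \<bullet> (Y j \<omega> *\<^sub>R c j))"
      unfolding power2_norm_eq_inner inner_sum_left unfolding inner_sum_right ..
    then show ?thesis
      unfolding H_def I[OF that] by (simp add: sum_distrib_left mult_ac)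
  qed
  have Hint: "integrable M H"
    unfolding H_def using cross by (intro Bochner_Integration.integrable_sum integrable_mult_right) auto
  define e where "e i j = (c i \<bullet> c j) * (if i = j then prob E * measure \<mu> (A i) else 0)" for i j
  have "expectation (\<lambda>\<omega>. \<Sum>j\<in>{1..n}. (c i \<bullet> c j) * (I \<omega> * (Y i \<omega> * Y j \<omega>))) = (\<Sum>j\<in>{1..n}. e i j)"
    if "i \<in> {1..n}" for i
  proof -
    have "expectation (\<lambda>\<omega>. \<Sum>j\<in>{1..n}. (c i \<bullet> c j) * (I \<omega> * (Y i \<omega> * Y j \<omega>))) =
        (\<Sum>j\<in>{1..n}. expectation (\<lambda>\<omega>. (c i \<bullet> c j) * (I \<omega> * (Y i \<omega> * Y j \<omega>))))"
      using cross[OF that] by (intro Bochner_Integration.integral_sum integrable_mult_right) auto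
    also have "\<dots> = (\<Sum>j\<in>{1..n}. e i j)"
      using cross[OF that] by (intro sum.cong refl) (auto simp: e_def)
    finally show ?thesis .
  qed
  moreover have "expectation H =
      (\<Sum>i\<in>{1..n}. expectation (\<lambda>\<omega>. \<Sum>j\<in>{1..n}. (c i \<bullet> c j) * (I \<omega> * (Y i \<omega> * Y j \<omega>))))"
    unfolding H_def using cross
    by (intro Bochner_Integration.integral_sum Bochner_Integration.integrable_sum integrable_mult_right) auto
  ultimately have "expectation H = (\<Sum>i\<in>{1..n}. \<Sum>j\<in>{1..n}. e i j)" by simp
  also have "\<dots> = prob E * (\<Sum>i\<in>{1..n}. measure \<mu> (A i) * (norm (c i))\<^sup>2)"
    unfolding sum_distrib_left
  proof (intro sum.cong refl)
    fix i assume i: "i \<in> {1..n}"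
    have "e i j = (if i = j then prob E * (measure \<mu> (A i) * (norm (c i))\<^sup>2) else 0)" for j
      by (simp add: e_def power2_norm_eq_inner)
    then show "(\<Sum>j\<in>{1..n}. e i j) = prob E * (measure \<mu> (A i) * (norm (c i))\<^sup>2)"
      using i by simp
  qed
  finally have EH: "expectation H = prob E * (\<Sum>i\<in>{1..n}. measure \<mu> (A i) * (norm (c i))\<^sup>2)" .
  show "integrable M (\<lambda>\<omega>. indicator E \<omega> * (norm (\<Sum>i\<in>{1..n}. Y i \<omega> *\<^sub>R c i))\<^sup>2)"
    using Hint by (rule Bochner_Integration.integrable_cong[THEN iffD1, rotated 2]) (simp_all only: H)
  show "expectation (\<lambda>\<omega>. indicator E \<omega> * (norm (\<Sum>i\<in>{1..n}. Y i \<omega> *\<^sub>R c i))\<^sup>2) =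
      prob E * (\<Sum>i\<in>{1..n}. measure \<mu> (A i) * (norm (c i))\<^sup>2)"
    unfolding EH[symmetric] by (rule Bochner_Integration.integral_cong) (simp_all only: H)
qed

section \<open>Integrals of bounded functions against a Poisson measure\<close>

lemma set_integral_simple_function:
  fixes f :: "'b \<Rightarrow> 'c::{banach, second_countable_topology}"
  assumes f: "simple_function K f" and B: "B \<in> sets K" "emeasure K B < \<infinity>"
  shows "set_integrable K B f"
    and "(LINT z:B|K. f z) = (\<Sum>y\<in>f ` space K. measure K (B \<inter> (f -` {y} \<inter> space K)) *\<^sub>R y)"
proof -
  have fin: "finite (f ` space K)" using f by (simp add: simple_function_def)
  have m: "B \<inter> (f -` {y} \<inter> space K) \<in> sets K" for y
    using simple_functionD(2)[OF f, of "{y}"] B(1) by auto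
  have mfin: "emeasure K (B \<inter> (f -` {y} \<inter> space K)) < \<infinity>" for y
    using emeasure_mono[OF _ B(1), of "B \<inter> (f -` {y} \<inter> space K)"] B(2) by auto
  have eq: "indicator B z *\<^sub>R f z =
      (\<Sum>y\<in>f ` space K. indicator (B \<inter> (f -` {y} \<inter> space K)) z *\<^sub>R y)" if "z \<in> space K" for z
  proof -
    have "(\<Sum>y\<in>f ` space K. indicator (B \<inter> (f -` {y} \<inter> space K)) z *\<^sub>R y) =
        (\<Sum>y\<in>f ` space K. if y = f z then indicator B z *\<^sub>R f z else 0)"
      using that by (intro sum.cong) (auto simp: indicator_def)
    then show ?thesis using fin that by simp
  qed
  have int: "integrable K (\<lambda>z. indicator (B \<inter> (f -` {y} \<inter> space K)) z *\<^sub>R y)" for y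
    using m mfin by (intro integrable_scaleR_left integrable_real_indicator) auto
  have "integrable K (\<lambda>z. \<Sum>y\<in>f ` space K. indicator (B \<inter> (f -` {y} \<inter> space K)) z *\<^sub>R y)"
    using int by (intro Bochner_Integration.integrable_sum)
  then show "set_integrable K B f"
    unfolding set_integrable_def by (subst Bochner_Integration.integrable_cong[OF refl eq])
  have "(LINT z:B|K. f z) = (LINT z|K. (\<Sum>y\<in>f ` space K. indicator (B \<inter> (f -` {y} \<inter> space K)) z *\<^sub>R y))"
    unfolding set_lebesgue_integral_def by (rule Bochner_Integration.integral_cong[OF refl eq])
  also have "\<dots> = (\<Sum>y\<in>f ` space K. LINT z|K. indicator (B \<inter> (f -` {y} \<inter> space K)) z *\<^sub>R y)"
    using int by (rule Bochner_Integration.integral_sum)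
  also have "\<dots> = (\<Sum>y\<in>f ` space K. measure K (B \<inter> (f -` {y} \<inter> space K)) *\<^sub>R y)"
    using m mfin by (intro sum.cong refl) (simp add: integral_scaleR_left Int_absorb2 sets.sets_into_space)
  finally show "(LINT z:B|K. f z) = (\<Sum>y\<in>f ` space K. measure K (B \<inter> (f -` {y} \<inter> space K)) *\<^sub>R y)" .
qed

text \<open>On \<open>F\<close>, where \<open>B\<close> carries finite random mass, the integral of
  a simple function is a finite combination of counts on the level sets of \<open>f\<close> inside
  \<open>B\<close>. This yields both measurability in the outcome and, through the centred sums, the
  second moment. \<open>F\<close> has full probability, and its indicator replaces the integral by 0
  elsewhere.\<close>

lemma (in prob_space) ppm_simple_second_moment:
  fixes f :: "'b \<Rightarrow> 'c::euclidean_space"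
  assumes ppm: "poisson_point_measure M N \<mu>" and f: "simple_function \<mu> f"
    and A: "A \<in> sets \<mu>" "emeasure \<mu> A < \<infinity>" and B: "B \<in> sets \<mu>" "emeasure \<mu> B < \<infinity>"
    and disj: "A \<inter> B = {}"
  defines "E \<equiv> {\<omega>\<in>space M. emeasure (N \<omega>) A = 0}"
    and "F \<equiv> {\<omega>\<in>space M. emeasure (N \<omega>) B < \<infinity>}"
  shows "(\<lambda>\<omega>. indicator F \<omega> *\<^sub>R (LINT z:B|N \<omega>. f z)) \<in> borel_measurable M"
    and "(\<integral>\<^sup>+\<omega>\<in>E. ennreal ((norm (indicator F \<omega> *\<^sub>R (LINT z:B|N \<omega>. f z) - (LINT z:B|\<mu>. f z)))\<^sup>2) \<partial>M)
      \<le> emeasure M E * (\<integral>\<^sup>+z\<in>B. ennreal ((norm (f z))\<^sup>2) \<partial>\<mu>)"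
proof -
  define R where "R = f ` space \<mu>"
  have "finite R" using f by (simp add: simple_function_def R_def)
  \<comment> \<open>Numbering the values from 1 leaves index 0 for the void set
    \<open>A\<close>.\<close>
  then obtain h where h: "bij_betw h {1..card R} R"
    using ex_bij_betw_nat_finite_1 by blast
  define C where "C y = B \<inter> (f -` {y} \<inter> space \<mu>)" for y
  have C: "C y \<in> sets \<mu>" for y
    using simple_functionD(2)[OF f, of "{y}"] B(1) by (auto simp: C_def)
  have Cfin: "emeasure \<mu> (C y) < \<infinity>" for y
    using emeasure_mono[OF _ B(1), of "C y"] B(2) by (auto simp: C_def)
  have [measurable]: "(\<lambda>\<omega>. emeasure (N \<omega>) B) \<in> borel_measurable M"
    "(\<lambda>\<omega>. emeasure (N \<omega>) A) \<in> borel_measurable M" "\<And>y. (\<lambda>\<omega>. emeasure (N \<omega>) (C y)) \<in> borel_measurable M"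
    using ppm_measurable[OF ppm] A B C by auto
  have [measurable]: "F \<in> sets M" "E \<in> sets M" unfolding F_def E_def by measurable
  have repr: "(LINT z:B|N \<omega>. f z) = (\<Sum>y\<in>R. enn2real (emeasure (N \<omega>) (C y)) *\<^sub>R y)"
    if "\<omega> \<in> F" for \<omega>
  proof -
    have \<omega>: "\<omega> \<in> space M" using that by (simp add: F_def)
    have "simple_function (N \<omega>) f"
      using f by (simp add: simple_function_def ppm_sets[OF ppm \<omega>])
    from set_integral_simple_function(2)[OF this, of B] that B(1) show ?thesis
      by (simp add: F_def ppm_sets[OF ppm \<omega>] R_def C_def measure_def)
  qed
  have "(\<lambda>\<omega>. indicator F \<omega> *\<^sub>R (\<Sum>y\<in>R. enn2real (emeasure (N \<omega>) (C y)) *\<^sub>R y)) \<in> borel_measurable M"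
    by measurable
  moreover have "indicator F \<omega> *\<^sub>R (LINT z:B|N \<omega>. f z) =
      indicator F \<omega> *\<^sub>R (\<Sum>y\<in>R. enn2real (emeasure (N \<omega>) (C y)) *\<^sub>R y)" for \<omega>
    using repr[of \<omega>] by (cases "\<omega> \<in> F") auto
  ultimately show "(\<lambda>\<omega>. indicator F \<omega> *\<^sub>R (LINT z:B|N \<omega>. f z)) \<in> borel_measurable M"
    by (simp only:)
  define D where "D i = (if i = 0 then A else C (h i))" for i
  define Y where "Y i \<omega> = enn2real (emeasure (N \<omega>) (D i)) - measure \<mu> (D i)" for i \<omega>
  have D: "D i \<in> sets \<mu>" "emeasure \<mu> (D i) < \<infinity>" for i
    using A C Cfin by (auto simp: D_def)
  have Ddisj: "disjoint_family_on D {..card R}"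
  proof (unfold disjoint_family_on_def, intro ballI impI)
    fix i j assume ij: "i \<in> {..card R}" "j \<in> {..card R}" "i \<noteq> j"
    show "D i \<inter> D j = {}"
    proof (cases "i = 0 \<or> j = 0")
      case True
      then have "(i = 0 \<and> j \<noteq> 0) \<or> (j = 0 \<and> i \<noteq> 0)" using ij by auto
      moreover have "A \<inter> C y = {}" "C y \<inter> A = {}" for y using disj unfolding C_def by blast+
      ultimately show ?thesis unfolding D_def by presburger
    next
      case False
      then have "h i \<noteq> h j"
        using bij_betw_imp_inj_on[OF h] ij False by (auto dest: inj_onD)
      then have "C (h i) \<inter> C (h j) = {}" unfolding C_def by auto
      then show ?thesis using False by (simp add: D_def)
    qed
  qed
  have E: "{\<omega>\<in>space M. emeasure (N \<omega>) (D 0) = 0} = E" by (simp add: D_def E_def)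
  have moment: "integrable M (\<lambda>\<omega>. indicator E \<omega> * (norm (\<Sum>i\<in>{1..card R}. Y i \<omega> *\<^sub>R h i))\<^sup>2)"
    "expectation (\<lambda>\<omega>. indicator E \<omega> * (norm (\<Sum>i\<in>{1..card R}. Y i \<omega> *\<^sub>R h i))\<^sup>2) =
      prob E * (\<Sum>i\<in>{1..card R}. measure \<mu> (D i) * (norm (h i))\<^sup>2)"
    unfolding E[symmetric] Y_def
    by (rule ppm_centered_sum_second_moment[where A = D and \<mu> = \<mu>]; (rule ppm D Ddisj))+
  have sumR: "(\<Sum>i\<in>{1..card R}. g (D i) *\<^sub>R h i) = (\<Sum>y\<in>R. g (C y) *\<^sub>R y)" for g :: "'b set \<Rightarrow> real"
    using sum.reindex_bij_betw[OF h, of "\<lambda>y. g (C y) *\<^sub>R y"] by (simp add: D_def)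
  have sumR': "(\<Sum>i\<in>{1..card R}. g (D i) * (norm (h i))\<^sup>2) = (\<Sum>y\<in>R. g (C y) * (norm y)\<^sup>2)" for g :: "'b set \<Rightarrow> real"
    using sum.reindex_bij_betw[OF h, of "\<lambda>y. g (C y) * (norm y)\<^sup>2"] by (simp add: D_def)
  have int\<mu>: "(LINT z:B|\<mu>. f z) = (\<Sum>y\<in>R. measure \<mu> (C y) *\<^sub>R y)"
    using set_integral_simple_function(2)[OF f B] by (simp add: R_def C_def)
  have Ysum: "(\<Sum>i\<in>{1..card R}. Y i \<omega> *\<^sub>R h i) = (LINT z:B|N \<omega>. f z) - (LINT z:B|\<mu>. f z)"
    if "\<omega> \<in> F" for \<omega>
    using sumR[of "\<lambda>S. enn2real (emeasure (N \<omega>) S) - measure \<mu> S"] repr[OF that] int\<mu>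
    by (simp add: Y_def scaleR_diff_left sum_subtractf)
  have "(\<integral>\<^sup>+z\<in>B. ennreal ((norm (f z))\<^sup>2) \<partial>\<mu>) = ennreal (LINT z:B|\<mu>. (norm (f z))\<^sup>2)"
  proof -
    have "simple_function \<mu> (\<lambda>z. (norm (f z))\<^sup>2)"
      using f by (rule simple_function_compose1)
    from set_integral_simple_function(1)[OF this B]
    have "set_integrable \<mu> B (\<lambda>z. (norm (f z))\<^sup>2)" .
    then show ?thesis
      unfolding set_integrable_def set_lebesgue_integral_def
      by (subst nn_integral_eq_integral[symmetric]) (auto intro!: nn_integral_cong simp: indicator_def)
  qed
  also have "(LINT z:B|\<mu>. (norm (f z))\<^sup>2) = (\<Sum>y\<in>R. measure \<mu> (C y) * (norm y)\<^sup>2)"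
  proof -
    have "(LINT z:B|\<mu>. (norm (f z))\<^sup>2) = (LINT z|\<mu>. (\<Sum>y\<in>R. indicator (C y) z * (norm y)\<^sup>2))"
      unfolding set_lebesgue_integral_def
    proof (rule Bochner_Integration.integral_cong[OF refl])
      fix z assume z: "z \<in> space \<mu>"
      have "(\<Sum>y\<in>R. indicator (C y) z * (norm y)\<^sup>2) = (\<Sum>y\<in>R. if y = f z then indicator B z * (norm (f z))\<^sup>2 else 0)"
        using z by (intro sum.cong) (auto simp: indicator_def C_def)
      then show "indicator B z *\<^sub>R (norm (f z))\<^sup>2 = (\<Sum>y\<in>R. indicator (C y) z * (norm y)\<^sup>2)"
        using \<open>finite R\<close> z by (simp add: R_def)
    qed
    also have "\<dots> = (\<Sum>y\<in>R. LINT z|\<mu>. indicator (C y) z * (norm y)\<^sup>2)"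
      using C Cfin by (intro Bochner_Integration.integral_sum integrable_mult_left integrable_real_indicator) auto
    also have "\<dots> = (\<Sum>y\<in>R. measure \<mu> (C y) * (norm y)\<^sup>2)"
      using C Cfin by (intro sum.cong refl) (simp add: Int_absorb2 sets.sets_into_space)
    finally show ?thesis .
  qed
  finally have rhs: "emeasure M E * (\<integral>\<^sup>+z\<in>B. ennreal ((norm (f z))\<^sup>2) \<partial>\<mu>) =
      ennreal (prob E * (\<Sum>y\<in>R. measure \<mu> (C y) * (norm y)\<^sup>2))"
    by (simp add: emeasure_eq_measure ennreal_mult' )
  have aeF: "AE \<omega> in M. \<omega> \<in> F"
    using ppm_AE_finite[OF ppm B] by (auto simp: F_def)
  have "(\<integral>\<^sup>+\<omega>\<in>E. ennreal ((norm (indicator F \<omega> *\<^sub>R (LINT z:B|N \<omega>. f z) - (LINT z:B|\<mu>. f z)))\<^sup>2) \<partial>M) =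
      (\<integral>\<^sup>+\<omega>. ennreal (indicator E \<omega> * (norm (\<Sum>i\<in>{1..card R}. Y i \<omega> *\<^sub>R h i))\<^sup>2) \<partial>M)"
    by (rule nn_integral_cong_AE, use aeF in eventually_elim) (auto simp: Ysum indicator_def simp del: One_nat_def)
  also have "\<dots> = ennreal (prob E * (\<Sum>y\<in>R. measure \<mu> (C y) * (norm y)\<^sup>2))"
    using moment unfolding sumR' by (subst nn_integral_eq_integral) auto
  finally show "(\<integral>\<^sup>+\<omega>\<in>E. ennreal ((norm (indicator F \<omega> *\<^sub>R (LINT z:B|N \<omega>. f z) - (LINT z:B|\<mu>. f z)))\<^sup>2) \<partial>M)
      \<le> emeasure M E * (\<integral>\<^sup>+z\<in>B. ennreal ((norm (f z))\<^sup>2) \<partial>\<mu>)"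
    unfolding rhs by simp
qed

text \<open>Simple approximations \<open>s i\<close> dominated by \<open>2 * norm (f z)\<close> have
  converging integrals for each outcome in \<open>F\<close>, because \<open>B\<close> then has
  finite mass; Fatou carries the second moment to the limit. The factor 4 is the square of that 2,
  and later only enlarges the radius of the balls.\<close>

lemma (in prob_space) ppm_bounded_second_moment:
  fixes f :: "'b \<Rightarrow> 'c::euclidean_space"
  assumes ppm: "poisson_point_measure M N \<mu>" and f: "f \<in> borel_measurable \<mu>"
    and bound: "\<And>z. z \<in> B \<Longrightarrow> norm (f z) \<le> b"
    and A: "A \<in> sets \<mu>" "emeasure \<mu> A < \<infinity>" and B: "B \<in> sets \<mu>" "emeasure \<mu> B < \<infinity>"
    and disj: "A \<inter> B = {}"
  defines "E \<equiv> {\<omega>\<in>space M. emeasure (N \<omega>) A = 0}"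
    and "F \<equiv> {\<omega>\<in>space M. emeasure (N \<omega>) B < \<infinity>}"
  shows "(\<lambda>\<omega>. indicator F \<omega> *\<^sub>R (LINT z:B|N \<omega>. f z)) \<in> borel_measurable M"
    and "(\<integral>\<^sup>+\<omega>\<in>E. ennreal ((norm (indicator F \<omega> *\<^sub>R (LINT z:B|N \<omega>. f z) - (LINT z:B|\<mu>. f z)))\<^sup>2) \<partial>M)
      \<le> 4 * emeasure M E * (\<integral>\<^sup>+z\<in>B. ennreal ((norm (f z))\<^sup>2) \<partial>\<mu>)"
proof -
  obtain s where s: "\<And>i. simple_function \<mu> (s i)"
    and lim: "\<And>z. z \<in> space \<mu> \<Longrightarrow> (\<lambda>i. s i z) \<longlonglongrightarrow> f z"
    and sb: "\<And>i z. z \<in> space \<mu> \<Longrightarrow> norm (s i z) \<le> 2 * norm (f z)"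
    using borel_measurable_implies_sequence_metric[OF f, of 0] by simp metis
  have [measurable]: "E \<in> sets M" "F \<in> sets M"
    using ppm_measurable[OF ppm] A B by (auto simp: E_def F_def)
  note simple = ppm_simple_second_moment[OF ppm s A B disj, folded E_def F_def]
  note [measurable] = simple(1) f B(1)
  have conv: "(\<lambda>i. LINT z:B|K. s i z) \<longlonglongrightarrow> (LINT z:B|K. f z)"
    if K: "sets K = sets \<mu>" "emeasure K B < \<infinity>" for K
    unfolding set_lebesgue_integral_def
  proof (rule integral_dominated_convergence[where w = "\<lambda>z. indicator B z * (2 * b)"])
    have sp: "space K = space \<mu>" using K(1) by (rule sets_eq_imp_space_eq)
    have meq: "borel_measurable K = borel_measurable \<mu>"
      by (rule measurable_cong_sets[OF K(1) refl])
    have BK: "B \<in> sets K" using B K by simp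
    show "(\<lambda>z. indicator B z *\<^sub>R f z) \<in> borel_measurable K"
      using f B unfolding meq by (auto intro!: borel_measurable_scaleR borel_measurable_indicator)
    show "(\<lambda>z. indicator B z *\<^sub>R s i z) \<in> borel_measurable K" for i
      using borel_measurable_simple_function[OF s] B unfolding meq
      by (auto intro!: borel_measurable_scaleR borel_measurable_indicator)
    show "integrable K (\<lambda>z. indicator B z * (2 * b))"
      using BK K(2) by (intro integrable_mult_left integrable_real_indicator) auto
    show "AE z in K. (\<lambda>i. indicator B z *\<^sub>R s i z) \<longlonglongrightarrow> indicator B z *\<^sub>R f z"
      using lim by (auto intro!: AE_I2 tendsto_intros simp: sp)
    show "AE z in K. norm (indicator B z *\<^sub>R s i z) \<le> indicator B z * (2 * b)" for i
    proof (rule AE_I2)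
      fix z assume "z \<in> space K"
      then show "norm (indicator B z *\<^sub>R s i z) \<le> indicator B z * (2 * b)"
        using sb[of z i] bound[of z] by (auto simp: sp indicator_def)
    qed
  qed
  have convN: "(\<lambda>i. indicator F \<omega> *\<^sub>R (LINT z:B|N \<omega>. s i z)) \<longlonglongrightarrow> indicator F \<omega> *\<^sub>R (LINT z:B|N \<omega>. f z)"
    if "\<omega> \<in> space M" for \<omega>
    using conv[OF ppm_sets(1)[OF ppm that]] by (cases "\<omega> \<in> F") (auto simp: F_def)
  show [measurable]: "(\<lambda>\<omega>. indicator F \<omega> *\<^sub>R (LINT z:B|N \<omega>. f z)) \<in> borel_measurable M"
    by (rule borel_measurable_LIMSEQ_metric[OF simple(1) convN])
  define G where "G i \<omega> = ennreal ((norm (indicator F \<omega> *\<^sub>R (LINT z:B|N \<omega>. s i z) - (LINT z:B|\<mu>. s i z)))\<^sup>2) * indicator E \<omega>"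
    for i \<omega>
  define G' where "G' \<omega> = ennreal ((norm (indicator F \<omega> *\<^sub>R (LINT z:B|N \<omega>. f z) - (LINT z:B|\<mu>. f z)))\<^sup>2) * indicator E \<omega>"
    for \<omega>
  have [measurable]: "G i \<in> borel_measurable M" for i unfolding G_def by measurable
  have Glim: "(\<lambda>i. G i \<omega>) \<longlonglongrightarrow> G' \<omega>" if "\<omega> \<in> space M" for \<omega>
  proof (cases "\<omega> \<in> E")
    case True
    then show ?thesis
      unfolding G_def G'_def using convN[OF that] conv[OF refl B(2)]
      by (auto intro!: tendsto_intros)
  qed (simp add: G_def G'_def)
  have "(\<integral>\<^sup>+\<omega>. G' \<omega> \<partial>M) = (\<integral>\<^sup>+\<omega>. liminf (\<lambda>i. G i \<omega>) \<partial>M)"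
    by (rule nn_integral_cong) (use Glim lim_imp_Liminf trivial_limit_sequentially in metis)
  also have "\<dots> \<le> liminf (\<lambda>i. \<integral>\<^sup>+\<omega>. G i \<omega> \<partial>M)"
    by (rule nn_integral_liminf) measurable
  also have "\<dots> \<le> 4 * emeasure M E * (\<integral>\<^sup>+z\<in>B. ennreal ((norm (f z))\<^sup>2) \<partial>\<mu>)"
  proof (rule Liminf_le)
    have "(\<integral>\<^sup>+\<omega>. G i \<omega> \<partial>M) \<le> 4 * emeasure M E * (\<integral>\<^sup>+z\<in>B. ennreal ((norm (f z))\<^sup>2) \<partial>\<mu>)" for i
    proof -
      have "(\<integral>\<^sup>+\<omega>. G i \<omega> \<partial>M) \<le> emeasure M E * (\<integral>\<^sup>+z\<in>B. ennreal ((norm (s i z))\<^sup>2) \<partial>\<mu>)"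
        unfolding G_def by (rule simple(2))
      moreover have "(\<integral>\<^sup>+z\<in>B. ennreal ((norm (s i z))\<^sup>2) \<partial>\<mu>) \<le> (\<integral>\<^sup>+z. 4 * (ennreal ((norm (f z))\<^sup>2) * indicator B z) \<partial>\<mu>)"
      proof (rule nn_integral_mono)
        fix z assume "z \<in> space \<mu>"
        then have "(norm (s i z))\<^sup>2 \<le> 4 * (norm (f z))\<^sup>2"
          using power_mono[OF sb[of z i], of 2] by (simp add: power_mult_distrib)
        then have "ennreal ((norm (s i z))\<^sup>2) \<le> 4 * ennreal ((norm (f z))\<^sup>2)"
          by (metis ennreal_leI ennreal_mult' ennreal_numeral zero_le_numeral)
        then show "ennreal ((norm (s i z))\<^sup>2) * indicator B z \<le> 4 * (ennreal ((norm (f z))\<^sup>2) * indicator B z)"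
          by (auto simp: indicator_def)
      qed
      moreover have "(\<integral>\<^sup>+z. 4 * (ennreal ((norm (f z))\<^sup>2) * indicator B z) \<partial>\<mu>) =
          4 * (\<integral>\<^sup>+z\<in>B. ennreal ((norm (f z))\<^sup>2) \<partial>\<mu>)"
        by (rule nn_integral_cmult) measurable
      ultimately have "(\<integral>\<^sup>+\<omega>. G i \<omega> \<partial>M) \<le> emeasure M E * (4 * (\<integral>\<^sup>+z\<in>B. ennreal ((norm (f z))\<^sup>2) \<partial>\<mu>))"
        by (simp add: order_trans[OF _ mult_left_mono])
      then show ?thesis by (simp only: mult.assoc mult.left_commute[of _ 4])
    qed
    then show "\<forall>\<^sub>F i in sequentially. (\<integral>\<^sup>+\<omega>. G i \<omega> \<partial>M) \<le> 4 * emeasure M E * (\<integral>\<^sup>+z\<in>B. ennreal ((norm (f z))\<^sup>2) \<partial>\<mu>)"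
      by simp
  qed simp
  finally show "(\<integral>\<^sup>+\<omega>\<in>E. ennreal ((norm (indicator F \<omega> *\<^sub>R (LINT z:B|N \<omega>. f z) - (LINT z:B|\<mu>. f z)))\<^sup>2) \<partial>M)
      \<le> 4 * emeasure M E * (\<integral>\<^sup>+z\<in>B. ennreal ((norm (f z))\<^sup>2) \<partial>\<mu>)"
    by (simp add: G'_def)
qed

section \<open>The lower order index and the tail of the Levy measure\<close>

lemma levy_measure_tail_finite:
  fixes Lm :: "'a::euclidean_space measure"
  assumes "levy_measure Lm" "0 < \<delta>"
  shows "emeasure Lm {u. \<delta> < norm u} < \<infinity>"
proof -
  have sets: "sets Lm = sets borel" and fin: "(\<integral>\<^sup>+ u. ennreal (min 1 ((norm u)\<^sup>2)) \<partial>Lm) < \<infinity>"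
    using assms by (auto simp: levy_measure_def)
  have m: "{u. \<delta> < norm u} \<in> sets Lm" unfolding sets by measurable
  have "ennreal (min 1 (\<delta>\<^sup>2)) * emeasure Lm {u. \<delta> < norm u} =
      (\<integral>\<^sup>+ u. ennreal (min 1 (\<delta>\<^sup>2)) * indicator {u. \<delta> < norm u} u \<partial>Lm)"
    using m by (simp add: nn_integral_cmult_indicator)
  also have "\<dots> \<le> (\<integral>\<^sup>+ u. ennreal (min 1 ((norm u)\<^sup>2)) \<partial>Lm)"
  proof (rule nn_integral_mono)
    fix u :: 'a
    have "min 1 (\<delta>\<^sup>2) \<le> min 1 ((norm u)\<^sup>2)" if "\<delta> < norm u"
      using assms(2) that by (intro min.mono power_mono) auto
    then show "ennreal (min 1 (\<delta>\<^sup>2)) * indicator {u. \<delta> < norm u} u \<le> ennreal (min 1 ((norm u)\<^sup>2))"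
      by (auto simp: indicator_def intro: ennreal_leI)
  qed
  also note fin
  finally have "ennreal (min 1 (\<delta>\<^sup>2)) * emeasure Lm {u. \<delta> < norm u} < \<infinity>" .
  moreover have "ennreal (min 1 (\<delta>\<^sup>2)) \<noteq> 0"
    using assms(2) by (simp add: ennreal_eq_0_iff min_le_iff_disj)
  ultimately show ?thesis
    unfolding infinity_ennreal_def ennreal_mult_less_top by force
qed

lemma levy_measure_sigma_finite:
  fixes Lm :: "'a::euclidean_space measure"
  assumes "levy_measure Lm"
  shows "sigma_finite_measure Lm"
proof
  have sets: "sets Lm = sets borel" and "emeasure Lm {0} = 0"
    using assms by (auto simp: levy_measure_def)
  \<comment> \<open>The tails exhaust everything but the origin, which a Levy measure does not
    charge.\<close>
  define \<A> where "\<A> = insert {0} (range (\<lambda>n. {u::'a. 1 / Suc n < norm u}))"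
  have "\<exists>n. 1 / Suc n < norm u" if "u \<noteq> 0" for u :: 'a
    using reals_Archimedean[of "norm u"] that by (auto simp: inverse_eq_divide)
  then have "\<Union>\<A> = space Lm" using sets_eq_imp_space_eq[OF sets] by (auto simp: \<A>_def)
  moreover have "countable \<A>" by (simp add: \<A>_def)
  moreover have "\<A> \<subseteq> sets Lm" by (auto simp: \<A>_def sets)
  moreover have "emeasure Lm {u. 1 / Suc n < norm u} \<noteq> \<infinity>" for n
    using levy_measure_tail_finite[OF assms, of "1 / Suc n"] by simp
  then have "\<forall>a\<in>\<A>. emeasure Lm a \<noteq> \<infinity>"
    using \<open>emeasure Lm {0} = 0\<close> by (auto simp: \<A>_def)
  ultimately show "\<exists>A. countable A \<and> A \<subseteq> sets Lm \<and> \<Union> A = space Lm \<and> (\<forall>a\<in>A. emeasure Lm a \<noteq> \<infinity>)"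
    by blast
qed

text \<open>Hyperplanes are negligible, and the unit sphere of directions is compact.\<close>

lemma uniformly_small_slabs:
  assumes "0 < \<eta>"
  obtains c where "0 < c" "c \<le> 1"
    "\<And>e::'a::euclidean_space. norm e = 1 \<Longrightarrow> measure lebesgue {v \<in> cball 0 1. \<bar>e \<bullet> v\<bar> \<le> c} \<le> \<eta>"
proof -
  define S where "S e c = {v \<in> cball 0 1. \<bar>e \<bullet> v\<bar> \<le> c}" for e :: "'a" and c
  have S_eq: "S e c = cball 0 1 \<inter> ((\<lambda>v. \<bar>e \<bullet> v\<bar>) -` {..c})" for e c by (auto simp: S_def)
  have "closed (S e c)" for e c
    unfolding S_eq by (intro closed_Int closed_cball continuous_closed_vimage) (auto intro!: continuous_intros)
  moreover have "bounded (S e c)" for e c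
    by (rule bounded_subset[OF bounded_cball[of 0 1]]) (auto simp: S_def)
  ultimately have meas: "S e c \<in> lmeasurable" for e c
    by (intro lmeasurable_compact) (simp add: compact_eq_bounded_closed)
  \<comment> \<open>Continuity from above: for a fixed direction the slabs decrease to a piece of a
    hyperplane, a null set.\<close>
  have small: "\<exists>n. measure lebesgue (S e (1 / real (Suc n))) < \<eta>" if e: "norm e = 1" for e
  proof -
    have "(\<lambda>n. measure lebesgue (S e (1 / real (Suc n)))) \<longlonglongrightarrow> measure lebesgue (\<Inter>n. S e (1 / real (Suc n)))"
    proof (rule Lim_measure_decseq)
      show "range (\<lambda>n. S e (1 / real (Suc n))) \<subseteq> sets lebesgue"
        using meas by (auto simp: fmeasurable_def)
      show "decseq (\<lambda>n. S e (1 / real (Suc n)))"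
      proof (rule antimonoI)
        fix m n :: nat assume "m \<le> n"
        then have "1 / real (Suc n) \<le> 1 / real (Suc m)" by (simp add: field_simps)
        then show "S e (1 / real (Suc n)) \<le> S e (1 / real (Suc m))"
          unfolding S_def by fastforce
      qed
      show "emeasure lebesgue (S e (1 / real (Suc n))) \<noteq> \<infinity>" for n
        using meas[of e "1 / real (Suc n)"] by (auto simp: fmeasurable_def)
    qed
    moreover have "negligible (\<Inter>n. S e (1 / real (Suc n)))"
    proof (rule negligible_subset)
      show "negligible {v. e \<bullet> v = 0}" using e by (intro negligible_hyperplane) auto
      show "(\<Inter>n. S e (1 / real (Suc n))) \<subseteq> {v. e \<bullet> v = 0}"
      proof
        fix v assume "v \<in> (\<Inter>n. S e (1 / real (Suc n)))"
        then have le: "\<bar>e \<bullet> v\<bar> \<le> 1 / real (Suc n)" for n by (auto simp: S_def)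
        have "e \<bullet> v = 0"
        proof (rule ccontr)
          assume "e \<bullet> v \<noteq> 0"
          then obtain n where "1 / real (Suc n) < \<bar>e \<bullet> v\<bar>"
            using reals_Archimedean[of "\<bar>e \<bullet> v\<bar>"] by (auto simp: inverse_eq_divide)
          then show False using le[of n] by simp
        qed
        then show "v \<in> {v. e \<bullet> v = 0}" by simp
      qed
    qed
    then have "measure lebesgue (\<Inter>n. S e (1 / real (Suc n))) = 0"
      by (rule negligible_imp_measure0)
    ultimately have "\<forall>\<^sub>F n in sequentially. measure lebesgue (S e (1 / real (Suc n))) < \<eta>"
      using \<open>0 < \<eta>\<close> by (simp add: order_tendsto_iff)
    then show ?thesis by (auto simp: eventually_sequentially)
  qed
  \<comment> \<open>If no width served all directions, directions failing for the widths
    \<open>1 / (n+1)\<close> would accumulate at some \<open>e'\<close>, against the pointwise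
    result at \<open>e'\<close>.\<close>
  have "\<exists>n. \<forall>e. norm e = 1 \<longrightarrow> measure lebesgue (S e (1 / real (Suc n))) \<le> \<eta>"
  proof (rule ccontr)
    assume "\<nexists>n. \<forall>e. norm e = 1 \<longrightarrow> measure lebesgue (S e (1 / real (Suc n))) \<le> \<eta>"
    then obtain e where e: "\<And>n. norm (e n) = 1" "\<And>n. \<eta> < measure lebesgue (S (e n) (1 / real (Suc n)))"
      by (metis not_le)
    obtain e' r where r: "e' \<in> sphere 0 1" "strict_mono r" "(e \<circ> r) \<longlonglongrightarrow> e'"
      using compact_sphere[of 0 1] e(1) unfolding compact_def by (metis dist_0_norm mem_sphere)
    then obtain k where k: "measure lebesgue (S e' (1 / real (Suc k))) < \<eta>"
      using small[of e'] by auto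
    have "(\<lambda>n. norm (e (r n) - e') + 1 / real (Suc (r n))) \<longlonglongrightarrow> norm (e' - e') + 0"
      using r(3) LIMSEQ_subseq_LIMSEQ[OF LIMSEQ_inverse_real_of_nat r(2)]
      by (intro tendsto_intros) (auto simp: o_def inverse_eq_divide)
    then have "\<forall>\<^sub>F n in sequentially. norm (e (r n) - e') + 1 / real (Suc (r n)) < 1 / real (Suc k)"
      by (rule order_tendstoD(2)) simp
    then obtain n where n: "norm (e (r n) - e') + 1 / real (Suc (r n)) < 1 / real (Suc k)"
      by (auto simp: eventually_sequentially)
    \<comment> \<open>For \<open>v\<close> in the unit ball, replacing \<open>e (r n)\<close> by
      \<open>e'\<close> changes the inner product by at most their distance; \<open>n\<close> was
      chosen so that this distance plus the half-width stays below the half-width of the fixed slab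
      of \<open>e'\<close>.\<close>
    have "S (e (r n)) (1 / real (Suc (r n))) \<subseteq> S e' (1 / real (Suc k))"
    proof
      fix v assume v: "v \<in> S (e (r n)) (1 / real (Suc (r n)))"
      have "\<bar>(e (r n) - e') \<bullet> v\<bar> \<le> norm (e (r n) - e') * norm v" by (rule Cauchy_Schwarz_ineq2)
      also have "\<dots> \<le> norm (e (r n) - e')" using v by (intro mult_left_le) (auto simp: S_def)
      finally show "v \<in> S e' (1 / real (Suc k))"
        using v n by (auto simp: S_def inner_diff_left)
    qed
    then have "measure lebesgue (S (e (r n)) (1 / real (Suc (r n)))) \<le> measure lebesgue (S e' (1 / real (Suc k)))"
      by (rule measure_mono_fmeasurable) (use meas in \<open>auto intro: fmeasurableD\<close>)
    then show False using e(2)[of "r n"] k by simp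
  qed
  then obtain n where "\<forall>e. norm e = 1 \<longrightarrow> measure lebesgue (S e (1 / real (Suc n))) \<le> \<eta>" ..
  then show ?thesis
    by (intro that[of "1 / real (Suc n)"]) (auto simp: S_def)
qed

text \<open>A direction chosen uniformly in the unit ball is with high probability far from orthogonal to
  a given vector, so averaging the truncated second moments over directions controls the full
  tail of the Levy measure without loss in the constant.\<close>

lemma levy_tail_le_directional:
  fixes Lm :: "'a::euclidean_space measure"
  assumes levy: "levy_measure Lm" and "0 < \<epsilon>" "0 \<le> b" "0 < c" "0 < \<eta>" "\<eta> < 1"
    and slab: "\<And>e::'a. norm e = 1 \<Longrightarrow>
        measure lebesgue {v \<in> cball 0 1. \<bar>e \<bullet> v\<bar> \<le> c} \<le> \<eta> * measure lebesgue (cball 0 1 :: 'a set)"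
    and dir: "\<And>v. norm v = 1 \<Longrightarrow> (\<integral>\<^sup>+ u. ennreal ((min \<bar>u \<bullet> v\<bar> \<epsilon>)\<^sup>2) \<partial>Lm) \<le> ennreal (b * \<epsilon>\<^sup>2)"
  shows "emeasure Lm {u. \<epsilon> / c < norm u} \<le> ennreal (b / (1 - \<eta>))"
    and "c \<le> 1 \<Longrightarrow> (\<integral>\<^sup>+u\<in>{u. norm u \<le> \<epsilon> / c}. ennreal ((norm u)\<^sup>2) \<partial>Lm) \<le>
      ennreal (DIM('a) / c\<^sup>2 * b * \<epsilon>\<^sup>2)"
proof -
  have sets[measurable_cong]: "sets Lm = sets borel"
    using levy by (simp add: levy_measure_def)
  interpret Lm: sigma_finite_measure Lm using levy by (rule levy_measure_sigma_finite)
  interpret P: pair_sigma_finite Lm lborel ..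
  define V where "V = measure lebesgue (cball 0 1 :: 'a set)"
  have "0 < V" unfolding V_def by simp
  have eV: "emeasure lborel (cball 0 1 :: 'a set) = ennreal V"
    unfolding V_def by (simp add: emeasure_cball content_cball)
  \<comment> \<open>Averaging over the solid ball allows Lebesgue measure in place of a surface
    measure. Shrinking \<open>v\<close> only decreases the integrand, so the bound on the sphere
    extends inward.\<close>
  have dir': "(\<integral>\<^sup>+ u. ennreal ((min \<bar>u \<bullet> v\<bar> \<epsilon>)\<^sup>2) \<partial>Lm) \<le> ennreal (b * \<epsilon>\<^sup>2)" if "norm v \<le> 1" for v
  proof (cases "v = 0")
    case True
    then show ?thesis using \<open>0 < \<epsilon>\<close> by simp
  next
    case False
    have "\<bar>u \<bullet> v\<bar> \<le> \<bar>u \<bullet> (v /\<^sub>R norm v)\<bar>" for u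
    proof -
      have "\<bar>u \<bullet> v\<bar> = norm v * \<bar>u \<bullet> (v /\<^sub>R norm v)\<bar>" using False by (simp add: abs_mult)
      also have "\<dots> \<le> 1 * \<bar>u \<bullet> (v /\<^sub>R norm v)\<bar>" using that by (intro mult_right_mono) auto
      finally show ?thesis by simp
    qed
    then have "(\<integral>\<^sup>+ u. ennreal ((min \<bar>u \<bullet> v\<bar> \<epsilon>)\<^sup>2) \<partial>Lm) \<le>
        (\<integral>\<^sup>+ u. ennreal ((min \<bar>u \<bullet> (v /\<^sub>R norm v)\<bar> \<epsilon>)\<^sup>2) \<partial>Lm)"
      using \<open>0 < \<epsilon>\<close> by (intro nn_integral_mono ennreal_leI power_mono min.mono) auto
    also have "\<dots> \<le> ennreal (b * \<epsilon>\<^sup>2)" using False by (intro dir) simp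
    finally show ?thesis .
  qed
  define g where "g u v = ennreal ((min \<bar>u \<bullet> v\<bar> \<epsilon>)\<^sup>2) * indicator (cball 0 1) v" for u v :: "'a"
  have [measurable]: "(\<lambda>(u, v). g u v) \<in> borel_measurable (Lm \<Otimes>\<^sub>M lborel)"
    unfolding g_def indicator_def mem_cball by measurable
  \<comment> \<open>For a large \<open>u\<close>, every \<open>v\<close> in the ball outside the
    slab of its direction makes the truncation active, so the integrand is exactly
    \<open>\<epsilon>\<^sup>2\<close> on a fraction at least \<open>1 - \<eta>\<close> of the
    ball.\<close>
  have slab_u: "ennreal (\<epsilon>\<^sup>2 * ((1 - \<eta>) * V)) \<le> (\<integral>\<^sup>+ v. g u v \<partial>lborel)" if u: "\<epsilon> / c < norm u" for u
  proof -
    define e where "e = u /\<^sub>R norm u"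
    have "u \<noteq> 0" using u assms(2,4) by (auto simp: divide_less_0_iff)
    then have "norm e = 1" by (simp add: e_def)
    define T where "T = {v \<in> cball 0 1. \<bar>e \<bullet> v\<bar> \<le> c}"
    have T: "T \<in> sets borel" unfolding T_def by measurable
    have Tfin: "emeasure lborel T < \<infinity>"
    proof (rule le_less_trans)
      show "emeasure lborel T \<le> emeasure lborel (cball 0 1 :: 'a set)"
        by (rule emeasure_mono) (auto simp: T_def)
    qed (simp add: eV)
    have big: "\<epsilon> \<le> \<bar>u \<bullet> v\<bar>" if "v \<in> cball 0 1 - T" for v
    proof -
      have "c < \<bar>e \<bullet> v\<bar>" using that by (auto simp: T_def)
      then have "c * norm u \<le> \<bar>u \<bullet> v\<bar>"
        using \<open>u \<noteq> 0\<close> by (simp add: e_def abs_mult field_simps)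
      moreover have "\<epsilon> < c * norm u" using u \<open>0 < c\<close> by (simp add: field_simps)
      ultimately show ?thesis by simp
    qed
    have "emeasure lborel (cball 0 1 - T) = emeasure lborel (cball 0 1 :: 'a set) - emeasure lborel T"
      using T Tfin by (intro emeasure_Diff) (auto simp: T_def)
    also have "\<dots> = ennreal (V - measure lborel T)"
      using Tfin by (simp add: eV emeasure_eq_ennreal_measure ennreal_minus)
    finally have diff: "emeasure lborel (cball 0 1 - T) = ennreal (V - measure lborel T)" .
    have "measure lebesgue T = measure lborel T" using T by simp
    then have "measure lborel T \<le> \<eta> * V"
      using slab[OF \<open>norm e = 1\<close>] unfolding T_def[symmetric] V_def[symmetric] by linarith
    then have "ennreal ((1 - \<eta>) * V) \<le> emeasure lborel (cball 0 1 - T)"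
      unfolding diff by (intro ennreal_leI) (simp add: algebra_simps)
    then have "ennreal (\<epsilon>\<^sup>2 * ((1 - \<eta>) * V)) \<le> ennreal (\<epsilon>\<^sup>2) * emeasure lborel (cball 0 1 - T)"
      using \<open>\<eta> < 1\<close> \<open>0 < V\<close> by (simp add: ennreal_mult mult_left_mono)
    also have "\<dots> = (\<integral>\<^sup>+ v. ennreal (\<epsilon>\<^sup>2) * indicator (cball 0 1 - T) v \<partial>lborel)"
      using T by (simp add: nn_integral_cmult_indicator)
    also have "\<dots> \<le> (\<integral>\<^sup>+ v. g u v \<partial>lborel)"
      unfolding g_def using big by (intro nn_integral_mono) (auto simp: indicator_def min_absorb2)
    finally show ?thesis .
  qed
  \<comment> \<open>Double counting: integrating over \<open>v\<close> first gives at least a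
    multiple of the tail, integrating over \<open>u\<close> first gives at most the directional
    bound; the volume of the ball cancels.\<close>
  have "ennreal (\<epsilon>\<^sup>2 * ((1 - \<eta>) * V)) * emeasure Lm {u. \<epsilon> / c < norm u} =
      (\<integral>\<^sup>+ u. ennreal (\<epsilon>\<^sup>2 * ((1 - \<eta>) * V)) * indicator {u. \<epsilon> / c < norm u} u \<partial>Lm)"
    by (subst nn_integral_cmult_indicator) auto
  also have "\<dots> \<le> (\<integral>\<^sup>+ u. \<integral>\<^sup>+ v. g u v \<partial>lborel \<partial>Lm)"
    using slab_u by (intro nn_integral_mono) (auto simp: indicator_def)
  also have "\<dots> = (\<integral>\<^sup>+ v. \<integral>\<^sup>+ u. g u v \<partial>Lm \<partial>lborel)"
    by (rule P.Fubini'[symmetric]) measurable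
  also have "\<dots> \<le> (\<integral>\<^sup>+ v. ennreal (b * \<epsilon>\<^sup>2) * indicator (cball 0 1 :: 'a set) v \<partial>lborel)"
    unfolding g_def using dir' by (intro nn_integral_mono) (auto simp: indicator_def)
  also have "\<dots> = ennreal (b * \<epsilon>\<^sup>2) * ennreal V"
    by (subst nn_integral_cmult_indicator) (auto simp: eV)
  finally have le: "ennreal (\<epsilon>\<^sup>2 * ((1 - \<eta>) * V)) * emeasure Lm {u. \<epsilon> / c < norm u} \<le> ennreal (b * \<epsilon>\<^sup>2 * V)"
    using \<open>0 < V\<close> by (simp add: ennreal_mult'' )
  have pos: "0 < \<epsilon>\<^sup>2 * ((1 - \<eta>) * V)" using assms \<open>0 < V\<close> by simp
  have fin: "emeasure Lm {u. \<epsilon> / c < norm u} < \<infinity>"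
    using assms(2,4) by (intro levy_measure_tail_finite levy) auto
  define q where "q = measure Lm {u. \<epsilon> / c < norm u}"
  have q: "emeasure Lm {u. \<epsilon> / c < norm u} = ennreal q"
    using fin by (simp add: q_def emeasure_eq_ennreal_measure)
  have "\<epsilon>\<^sup>2 * ((1 - \<eta>) * V) * q \<le> b * \<epsilon>\<^sup>2 * V"
    using le pos assms(3) \<open>0 < V\<close> unfolding q
    by (simp add: ennreal_mult'[symmetric] ennreal_le_iff q_def)
  then have "(\<epsilon>\<^sup>2 * V) * ((1 - \<eta>) * q) \<le> (\<epsilon>\<^sup>2 * V) * b" by (simp add: mult_ac)
  then have "(1 - \<eta>) * q \<le> b"
    using \<open>0 < V\<close> \<open>0 < \<epsilon>\<close> by (subst (asm) mult_le_cancel_left_pos) auto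
  then have "q \<le> b / (1 - \<eta>)" using \<open>\<eta> < 1\<close> by (simp add: pos_le_divide_eq mult.commute)
  then show "emeasure Lm {u. \<epsilon> / c < norm u} \<le> ennreal (b / (1 - \<eta>))"
    unfolding q by (rule ennreal_leI)
  assume "c \<le> 1"
  \<comment> \<open>Here coordinate directions suffice. Each coordinate is at most
    \<open>\<epsilon> / c\<close>, so multiplying it by \<open>c \<le> 1\<close> brings it below
    both entries of the minimum. The loss of \<open>DIM('a) / c\<^sup>2\<close> is harmless in a
    variance bound, which affects only the radius.\<close>
  have pt: "(norm u)\<^sup>2 \<le> (\<Sum>i\<in>Basis. (min \<bar>u \<bullet> i\<bar> \<epsilon>)\<^sup>2 / c\<^sup>2)" if "norm u \<le> \<epsilon> / c" for u :: "'a"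
  proof -
    have "(norm u)\<^sup>2 = (\<Sum>i\<in>Basis. (u \<bullet> i)\<^sup>2)"
      unfolding power2_norm_eq_inner by (subst euclidean_inner) (simp add: power2_eq_square)
    also have "\<dots> \<le> (\<Sum>i\<in>Basis. (min \<bar>u \<bullet> i\<bar> \<epsilon>)\<^sup>2 / c\<^sup>2)"
    proof (rule sum_mono)
      fix i :: "'a" assume "i \<in> Basis"
      then have "\<bar>u \<bullet> i\<bar> \<le> \<epsilon> / c" using Basis_le_norm[of i u] that by simp
      then have "c * \<bar>u \<bullet> i\<bar> \<le> min \<bar>u \<bullet> i\<bar> \<epsilon>"
        using \<open>0 < c\<close> \<open>c \<le> 1\<close> by (auto simp: field_simps mult_left_le_one_le)
      then have "(c * \<bar>u \<bullet> i\<bar>)\<^sup>2 \<le> (min \<bar>u \<bullet> i\<bar> \<epsilon>)\<^sup>2"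
        using \<open>0 < c\<close> by (intro power_mono) auto
      then show "(u \<bullet> i)\<^sup>2 \<le> (min \<bar>u \<bullet> i\<bar> \<epsilon>)\<^sup>2 / c\<^sup>2"
        using \<open>0 < c\<close> by (simp add: field_simps power_mult_distrib)
    qed
    finally show ?thesis .
  qed
  have "(\<integral>\<^sup>+u\<in>{u. norm u \<le> \<epsilon> / c}. ennreal ((norm u)\<^sup>2) \<partial>Lm) \<le>
      (\<integral>\<^sup>+u. (\<Sum>i\<in>Basis. ennreal (1 / c\<^sup>2) * ennreal ((min \<bar>u \<bullet> i\<bar> \<epsilon>)\<^sup>2)) \<partial>Lm)"
  proof (rule nn_integral_mono)
    fix u :: "'a"
    have "(\<Sum>i\<in>Basis. ennreal (1 / c\<^sup>2) * ennreal ((min \<bar>u \<bullet> i\<bar> \<epsilon>)\<^sup>2)) =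
        ennreal (\<Sum>i\<in>Basis. (min \<bar>u \<bullet> i\<bar> \<epsilon>)\<^sup>2 / c\<^sup>2)"
      by (simp add: ennreal_mult'[symmetric] sum_nonneg)
    then show "ennreal ((norm u)\<^sup>2) * indicator {u. norm u \<le> \<epsilon> / c} u \<le>
        (\<Sum>i\<in>Basis. ennreal (1 / c\<^sup>2) * ennreal ((min \<bar>u \<bullet> i\<bar> \<epsilon>)\<^sup>2))"
      using pt[of u] by (auto simp: indicator_def ennreal_leI)
  qed
  also have "\<dots> = (\<Sum>i\<in>Basis. ennreal (1 / c\<^sup>2) * (\<integral>\<^sup>+u. ennreal ((min \<bar>u \<bullet> i\<bar> \<epsilon>)\<^sup>2) \<partial>Lm))"
    by (subst nn_integral_sum) (auto intro!: sum.cong nn_integral_cmult)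
  also have "\<dots> \<le> (\<Sum>i\<in>(Basis :: 'a set). ennreal (1 / c\<^sup>2) * ennreal (b * \<epsilon>\<^sup>2))"
    by (intro sum_mono mult_left_mono dir) auto
  also have "\<dots> = ennreal (DIM('a) / c\<^sup>2 * b * \<epsilon>\<^sup>2)"
    using \<open>0 \<le> b\<close> by (simp add: ennreal_mult'[symmetric] ennreal_of_nat_eq_real_of_nat field_simps)
  finally show "(\<integral>\<^sup>+u\<in>{u. norm u \<le> \<epsilon> / c}. ennreal ((norm u)\<^sup>2) \<partial>Lm) \<le>
      ennreal (DIM('a) / c\<^sup>2 * b * \<epsilon>\<^sup>2)" .
qed

text \<open>A lower limit gives smallness only along a sequence, hence the frequently quantifier.
  The constants \<open>\<theta>\<close>, \<open>c\<close> and \<open>K\<close> come from the gap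
  between the index and \<open>\<kappa> / t\<close> and are fixed before
  \<open>\<epsilon>\<close>.\<close>

lemma lower_order_index_tail_bounds:
  fixes Lm :: "'a::euclidean_space measure"
  assumes levy: "levy_measure Lm" and "0 < t"
    and index: "ennreal t * lower_order_index Lm < ennreal \<kappa>"
  obtains \<theta> c K where "0 \<le> \<theta>" "t * \<theta> < \<kappa>" "0 < c" "0 \<le> K"
    "\<exists>\<^sub>F \<epsilon> in at_right 0. emeasure Lm {u. \<epsilon> / c < norm u} \<le> ennreal (\<theta> * ln (1 / \<epsilon>)) \<and>
       (\<integral>\<^sup>+u\<in>{u. norm u \<le> \<epsilon> / c}. ennreal ((norm u)\<^sup>2) \<partial>Lm) \<le> ennreal (K * \<epsilon>\<^sup>2 * ln (1 / \<epsilon>))"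
proof -
  have "lower_order_index Lm \<noteq> \<infinity>"
  proof
    assume "lower_order_index Lm = \<infinity>"
    then show False using index \<open>0 < t\<close> by (simp add: ennreal_mult_top)
  qed
  then obtain l where l: "lower_order_index Lm = ennreal l" "0 \<le> l"
    by (cases "lower_order_index Lm") auto
  then have "t * l < \<kappa>"
    using index \<open>0 < t\<close> by (simp add: ennreal_mult[symmetric] ennreal_less_iff)
  then have "l < \<kappa> / t" using \<open>0 < t\<close> by (simp add: field_simps)
  \<comment> \<open>Two levels are inserted between \<open>l\<close> and
    \<open>\<kappa> / t\<close>: \<open>\<theta>0\<close> bounds the order function, and the gap up
    to \<open>\<theta>\<close> pays for the averaging, \<open>\<eta>\<close> being chosen so that
    \<open>\<theta>0 / (1 - \<eta>) = \<theta>\<close>.\<close>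
  then obtain \<theta>0 where \<theta>0: "l < \<theta>0" "\<theta>0 < \<kappa> / t" using dense by blast
  then obtain \<theta> where \<theta>: "\<theta>0 < \<theta>" "\<theta> < \<kappa> / t" using dense by blast
  define \<eta> where "\<eta> = 1 - \<theta>0 / \<theta>"
  have \<theta>_pos: "0 < \<theta>0" "0 < \<theta>" using \<theta> \<theta>0 l by auto
  have \<eta>: "0 < \<eta>" "\<eta> < 1" "\<theta>0 / (1 - \<eta>) = \<theta>" using \<theta> \<theta>_pos by (auto simp: \<eta>_def field_simps)
  have V: "0 < measure lebesgue (cball 0 1 :: 'a set)" by simp
  then have "0 < \<eta> * measure lebesgue (cball 0 1 :: 'a set)" using \<eta>(1) by simp
  then obtain c where c: "0 < c" "c \<le> 1" and slab: "\<And>e::'a. norm e = 1 \<Longrightarrow>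
      measure lebesgue {v \<in> cball 0 1. \<bar>e \<bullet> v\<bar> \<le> c} \<le> \<eta> * measure lebesgue (cball 0 1 :: 'a set)"
    by (rule uniformly_small_slabs) blast
  define K where "K = DIM('a) / c\<^sup>2 * \<theta>0"
  have "\<exists>\<^sub>F \<epsilon> in at_right 0. order_fun Lm \<epsilon> < ennreal \<theta>0"
  proof (rule ccontr)
    assume "\<not> (\<exists>\<^sub>F \<epsilon> in at_right 0. order_fun Lm \<epsilon> < ennreal \<theta>0)"
    then have "\<forall>\<^sub>F \<epsilon> in at_right 0. ennreal \<theta>0 \<le> order_fun Lm \<epsilon>"
      by (simp add: frequently_def not_less)
    then have "ennreal \<theta>0 \<le> lower_order_index Lm"
      unfolding lower_order_index_def by (rule Liminf_bounded)
    then show False using l \<theta>0(1) by (simp add: ennreal_le_iff2)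
  qed
  moreover have "\<forall>\<^sub>F \<epsilon> in at_right (0::real). \<epsilon> \<in> {0<..<1}"
    by (rule eventually_at_right_real) simp
  then have "\<forall>\<^sub>F \<epsilon> in at_right 0. order_fun Lm \<epsilon> < ennreal \<theta>0 \<longrightarrow>
      emeasure Lm {u. \<epsilon> / c < norm u} \<le> ennreal (\<theta> * ln (1 / \<epsilon>)) \<and>
      (\<integral>\<^sup>+u\<in>{u. norm u \<le> \<epsilon> / c}. ennreal ((norm u)\<^sup>2) \<partial>Lm) \<le> ennreal (K * \<epsilon>\<^sup>2 * ln (1 / \<epsilon>))"
  proof eventually_elim
    fix \<epsilon> :: real assume \<epsilon>: "\<epsilon> \<in> {0<..<1}"
    show "order_fun Lm \<epsilon> < ennreal \<theta>0 \<longrightarrow>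
      emeasure Lm {u. \<epsilon> / c < norm u} \<le> ennreal (\<theta> * ln (1 / \<epsilon>)) \<and>
      (\<integral>\<^sup>+u\<in>{u. norm u \<le> \<epsilon> / c}. ennreal ((norm u)\<^sup>2) \<partial>Lm) \<le> ennreal (K * \<epsilon>\<^sup>2 * ln (1 / \<epsilon>))"
    proof
      assume of: "order_fun Lm \<epsilon> < ennreal \<theta>0"
      define w where "w = \<epsilon>\<^sup>2 * ln (1 / \<epsilon>)"
      have ln: "0 < ln (1 / \<epsilon>)" using \<epsilon> by simp
      then have w: "0 < w" using \<epsilon> by (simp add: w_def)
      have dir: "(\<integral>\<^sup>+ u. ennreal ((min \<bar>u \<bullet> v\<bar> \<epsilon>)\<^sup>2) \<partial>Lm) \<le> ennreal (\<theta>0 * ln (1 / \<epsilon>) * \<epsilon>\<^sup>2)"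
        if "norm v = 1" for v
      proof -
        \<comment> \<open>Multiplying by \<open>w\<close> undoes the normalisation in
          \<open>order_fun\<close>; \<open>w\<close> is positive because
          \<open>\<epsilon> < 1\<close>.\<close>
        define s where "s = (SUP v\<in>sphere 0 1. \<integral>\<^sup>+ u. ennreal ((min \<bar>u \<bullet> v\<bar> \<epsilon>)\<^sup>2) \<partial>Lm)"
        have "(\<integral>\<^sup>+ u. ennreal ((min \<bar>u \<bullet> v\<bar> \<epsilon>)\<^sup>2) \<partial>Lm) \<le> s"
          unfolding s_def using that by (intro SUP_upper) simp
        also have "s = ennreal w * (ennreal (inverse w) * s)"
          using w by (simp add: mult.assoc[symmetric] ennreal_mult'[symmetric])
        also have "\<dots> \<le> ennreal w * ennreal \<theta>0"
          using of by (intro mult_left_mono) (auto simp: order_fun_def w_def s_def)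
        also have "\<dots> = ennreal (\<theta>0 * ln (1 / \<epsilon>) * \<epsilon>\<^sup>2)"
          using w \<theta>_pos by (simp add: ennreal_mult[symmetric] w_def mult_ac)
        finally show ?thesis .
      qed
      have nonneg: "0 \<le> \<theta>0 * ln (1 / \<epsilon>)" using ln \<theta>_pos by simp
      have "\<theta>0 * ln (1 / \<epsilon>) / (1 - \<eta>) = \<theta> * ln (1 / \<epsilon>)"
        using \<eta>(3) by (metis times_divide_eq_left)
      moreover have "DIM('a) / c\<^sup>2 * (\<theta>0 * ln (1 / \<epsilon>)) * \<epsilon>\<^sup>2 = K * \<epsilon>\<^sup>2 * ln (1 / \<epsilon>)"
        by (simp add: K_def mult_ac)
      moreover have "0 < \<epsilon>" using \<epsilon> by simp
      note bounds = levy_tail_le_directional[OF levy this nonneg c(1) \<eta>(1,2)]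
      ultimately show "emeasure Lm {u. \<epsilon> / c < norm u} \<le> ennreal (\<theta> * ln (1 / \<epsilon>)) \<and>
          (\<integral>\<^sup>+u\<in>{u. norm u \<le> \<epsilon> / c}. ennreal ((norm u)\<^sup>2) \<partial>Lm) \<le> ennreal (K * \<epsilon>\<^sup>2 * ln (1 / \<epsilon>))"
        using bounds(1)[OF slab dir] bounds(2)[OF slab dir c(2)] by simp
    qed
  qed
  ultimately have "\<exists>\<^sub>F \<epsilon> in at_right 0. emeasure Lm {u. \<epsilon> / c < norm u} \<le> ennreal (\<theta> * ln (1 / \<epsilon>)) \<and>
       (\<integral>\<^sup>+u\<in>{u. norm u \<le> \<epsilon> / c}. ennreal ((norm u)\<^sup>2) \<partial>Lm) \<le> ennreal (K * \<epsilon>\<^sup>2 * ln (1 / \<epsilon>))"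
    by (rule frequently_rev_mp)
  moreover have "t * \<theta> < \<kappa>" using \<theta>(2) \<open>0 < t\<close> by (simp add: field_simps)
  moreover have "0 \<le> K" using \<theta>_pos c by (simp add: K_def)
  ultimately show ?thesis
    using \<theta>_pos(2) c(1) by (intro that[of \<theta> c K]) (simp_all only: less_imp_le)
qed

section \<open>Paths without large jumps\<close>

lemma sets_levy_intensity:
  fixes Lm :: "'a::euclidean_space measure"
  assumes "levy_measure Lm"
  shows "sets (levy_intensity Lm) = sets (borel \<Otimes>\<^sub>M (borel :: 'a measure))"
  using assms unfolding levy_intensity_def levy_measure_def by (intro sets_pair_measure_cong) auto

lemma nn_integral_levy_intensity:
  fixes Lm :: "'a::euclidean_space measure"
  assumes levy: "levy_measure Lm" and "0 \<le> s" and [measurable]: "S \<in> sets borel" "f \<in> borel_measurable borel"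
  shows "(\<integral>\<^sup>+z\<in>{0<..s} \<times> S. f (snd z) \<partial>levy_intensity Lm) = ennreal s * (\<integral>\<^sup>+u\<in>S. f u \<partial>Lm)"
proof -
  have [measurable_cong]: "sets Lm = sets borel" using levy by (simp add: levy_measure_def)
  interpret Lm: sigma_finite_measure Lm using levy by (rule levy_measure_sigma_finite)
  have [measurable]: "(\<lambda>z. f (snd z) * indicator ({0<..s} \<times> S) z)
      \<in> borel_measurable (density lborel (indicator {0::real..}) \<Otimes>\<^sub>M Lm)"
    by measurable
  have "(\<integral>\<^sup>+z\<in>{0<..s} \<times> S. f (snd z) \<partial>levy_intensity Lm) =
      (\<integral>\<^sup>+r. \<integral>\<^sup>+u. f u * indicator ({0<..s} \<times> S) (r, u) \<partial>Lm \<partial>density lborel (indicator {0..}))"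
    unfolding levy_intensity_def by (subst Lm.nn_integral_fst[symmetric]) simp_all
  also have "\<dots> = (\<integral>\<^sup>+r. (\<integral>\<^sup>+u\<in>S. f u \<partial>Lm) * indicator {0<..s} r \<partial>density lborel (indicator {0..}))"
    by (intro nn_integral_cong) (auto simp: indicator_def)
  also have "\<dots> = (\<integral>\<^sup>+u\<in>S. f u \<partial>Lm) * (\<integral>\<^sup>+r. indicator {0..} r * indicator {0<..s} r \<partial>lborel)"
    by (subst nn_integral_cmult) (auto intro!: arg_cong2[where f = "(*)"] nn_integral_density simp del: nn_integral_indicator)
  also have "(\<integral>\<^sup>+r. indicator {0..} r * indicator {0<..s} r \<partial>lborel) = (\<integral>\<^sup>+r. indicator {0<..s} r \<partial>lborel)"
    by (intro nn_integral_cong) (auto simp: indicator_def)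
  also have "\<dots> = ennreal s" using \<open>0 \<le> s\<close> by simp
  finally show ?thesis by (simp add: mult.commute)
qed

lemma emeasure_levy_intensity:
  fixes Lm :: "'a::euclidean_space measure"
  assumes levy: "levy_measure Lm" and "0 \<le> s" and "S \<in> sets borel"
  shows "emeasure (levy_intensity Lm) ({0<..s} \<times> S) = ennreal s * emeasure Lm S"
proof -
  have "{0<..s} \<times> S \<in> sets (levy_intensity Lm)"
    unfolding sets_levy_intensity[OF levy] using assms(3) by simp
  moreover have "S \<in> sets Lm" using assms by (simp add: levy_measure_def)
  ultimately show ?thesis
    using nn_integral_levy_intensity[OF assms, of "\<lambda>_. 1"] by simp
qed

lemma levy_intensity_slab:
  fixes Lm :: "'a::euclidean_space measure"
  assumes levy: "levy_measure Lm" and "0 \<le> s" "0 < \<delta>" and S: "S \<in> sets borel" "\<And>u. u \<in> S \<Longrightarrow> \<delta> < norm u"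
  shows "{0<..s} \<times> S \<in> sets (levy_intensity Lm)"
    and "emeasure (levy_intensity Lm) ({0<..s} \<times> S) < \<infinity>"
proof -
  show "{0<..s} \<times> S \<in> sets (levy_intensity Lm)"
    unfolding sets_levy_intensity[OF levy] using S(1) by simp
  have "emeasure Lm S \<le> emeasure Lm {u. \<delta> < norm u}"
    using S levy by (intro emeasure_mono) (auto simp: levy_measure_def)
  also have "\<dots> < \<infinity>" by (rule levy_measure_tail_finite[OF levy \<open>0 < \<delta>\<close>])
  finally show "emeasure (levy_intensity Lm) ({0<..s} \<times> S) < \<infinity>"
    by (simp add: emeasure_levy_intensity[OF levy \<open>0 \<le> s\<close> S(1)] ennreal_mult_less_top)
qed

lemma borel_measurable_snd_levy_intensity:
  fixes Lm :: "'a::euclidean_space measure"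
  assumes levy: "levy_measure Lm"
  shows "snd \<in> borel_measurable (levy_intensity Lm)"
  unfolding measurable_cong_sets[OF sets_levy_intensity[OF levy] refl] by measurable

text \<open>The expected sum of the jumps with size in \<open>(\<rho>, 1]\<close> up to time
  \<open>s\<close>. When no such jump occurs it survives, with a minus sign, as a drift, so adding
  it back isolates the fluctuation to be estimated. If the small jumps are not summable it need not
  stay bounded as \<open>\<rho>\<close> tends to 0.\<close>

definition mean_jumps :: "'a::euclidean_space measure \<Rightarrow> real \<Rightarrow> real \<Rightarrow> 'a" where
  "mean_jumps Lm \<rho> s = (LINT z : {0<..s} \<times> {u. \<rho> < norm u \<and> norm u \<le> 1} | levy_intensity Lm. snd z)"

text \<open>Absence of jumps larger than \<open>\<rho>\<close> leaves only the compensated small jumps, which are independent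
  of that event, and the deterministic compensator of the missing jumps.\<close>

lemma second_moment_without_large_jumps:
  fixes Lm :: "'a::euclidean_space measure"
  assumes "prob_space M" and levy: "levy_measure Lm"
    and ppm: "poisson_point_measure M N (levy_intensity Lm)"
    and \<rho>: "0 < \<rho>" "\<rho> \<le> 1" and s: "0 \<le> s" "s \<le> t"
    and J: "is_compensated_small_jumps M Lm N s J"
    and V: "AE \<omega> in M. V \<omega> = large_jumps N s \<omega> + J \<omega>"
  defines "E \<equiv> {\<omega>\<in>space M. emeasure (N \<omega>) ({0<..t} \<times> {u. \<rho> < norm u}) = 0}"
  shows "(\<integral>\<^sup>+\<omega>\<in>E. ennreal ((norm (V \<omega> + mean_jumps Lm \<rho> s))\<^sup>2) \<partial>M) \<le>
    8 * emeasure M E * (ennreal s * (\<integral>\<^sup>+u\<in>{u. norm u \<le> \<rho>}. ennreal ((norm u)\<^sup>2) \<partial>Lm))"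
proof -
  interpret prob_space M by fact
  define \<mu> where "\<mu> = levy_intensity Lm"
  define A where "A = {0<..t} \<times> {u::'a. \<rho> < norm u}"
  define v where "v = (\<integral>\<^sup>+u\<in>{u. norm u \<le> \<rho>}. ennreal ((norm u)\<^sup>2) \<partial>Lm)"
  note ppm = ppm[folded \<mu>_def]
  have A: "A \<in> sets \<mu>" "emeasure \<mu> A < \<infinity>"
    unfolding A_def \<mu>_def by (rule levy_intensity_slab[OF levy _ \<rho>(1)]; use s in simp)+
  have E: "E = {\<omega>\<in>space M. emeasure (N \<omega>) A = 0}" by (simp add: E_def A_def)
  have [measurable]: "E \<in> sets M"
    unfolding E using ppm_measurable[OF ppm A(1)] by measurable
  have snd[measurable]: "snd \<in> borel_measurable \<mu>"
    unfolding \<mu>_def by (rule borel_measurable_snd_levy_intensity[OF levy])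
  have [measurable]: "J \<in> borel_measurable M" using J by (simp add: is_compensated_small_jumps_def)
  define c where "c = mean_jumps Lm \<rho> s"
  define g where "g \<delta> = (\<integral>\<^sup>+ \<omega>. ennreal ((norm (compensated_jumps_above Lm N \<delta> s \<omega> - J \<omega>))\<^sup>2) \<partial>M)" for \<delta>
  have g: "(g \<longlongrightarrow> 0) (at_right 0)"
    using J unfolding is_compensated_small_jumps_def g_def by simp
  \<comment> \<open>\<open>J\<close> is known only as a mean-square limit, so the estimate is made
    at a truncation level \<open>\<delta>\<close> with error \<open>g \<delta>\<close>, which
    disappears in the limit. The 8 is the 4 of the Poisson integral times a 2 from the square of a
    sum.\<close>
  have bound: "(\<integral>\<^sup>+\<omega>\<in>E. ennreal ((norm (V \<omega> + c))\<^sup>2) \<partial>M) \<le> 2 * g \<delta> + 8 * emeasure M E * (ennreal s * v)"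
    if \<delta>: "0 < \<delta>" "\<delta> < \<rho>" for \<delta>
  proof -
    define B where "B = {0<..s} \<times> {u::'a. \<delta> < norm u \<and> norm u \<le> \<rho>}"
    define B1 where "B1 = {0<..s} \<times> {u::'a. \<delta> < norm u \<and> norm u \<le> 1}"
    define B2 where "B2 = {0<..s} \<times> {u::'a. \<rho> < norm u \<and> norm u \<le> 1}"
    have B: "B \<in> sets \<mu>" "emeasure \<mu> B < \<infinity>"
      unfolding B_def \<mu>_def by (rule levy_intensity_slab[OF levy s(1) \<delta>(1)]; simp)+
    have B1: "B1 \<in> sets \<mu>"
      unfolding B1_def \<mu>_def by (rule levy_intensity_slab[OF levy s(1) \<delta>(1)]; simp)+
    have B2: "B2 \<in> sets \<mu>" "emeasure \<mu> B2 < \<infinity>"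
      unfolding B2_def \<mu>_def by (rule levy_intensity_slab[OF levy s(1) \<rho>(1)]; simp)+
    have AB: "A \<inter> B = {}" by (auto simp: A_def B_def)
    have B12: "B1 = B \<union> B2" "B \<inter> B2 = {}" "B2 \<subseteq> A"
      using \<delta> \<rho> s by (auto simp: B1_def B_def B2_def A_def)
    define F where "F = {\<omega>\<in>space M. emeasure (N \<omega>) B < \<infinity>}"
    have [measurable]: "F \<in> sets M"
      unfolding F_def using ppm_measurable[OF ppm B(1)] by measurable
    have aeF: "AE \<omega> in M. \<omega> \<in> F" using ppm_AE_finite[OF ppm B] by (auto simp: F_def)
    define I where "I \<omega> = indicator F \<omega> *\<^sub>R (LINT z:B|N \<omega>. snd z) - (LINT z:B|\<mu>. snd z)" for \<omega>
    have snd_le: "norm (snd z) \<le> \<rho>" if "z \<in> B" for z using that by (auto simp: B_def)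
    note sm = ppm_bounded_second_moment[OF ppm snd snd_le A B AB, folded E F_def, folded I_def]
    have [measurable]: "I \<in> borel_measurable M" unfolding I_def using sm(1) by measurable
    have "(\<integral>\<^sup>+z\<in>B. ennreal ((norm (snd z))\<^sup>2) \<partial>\<mu>) \<le> ennreal s * v"
    proof -
      have "(\<integral>\<^sup>+z\<in>B. ennreal ((norm (snd z))\<^sup>2) \<partial>\<mu>) =
          ennreal s * (\<integral>\<^sup>+u\<in>{u. \<delta> < norm u \<and> norm u \<le> \<rho>}. ennreal ((norm u)\<^sup>2) \<partial>Lm)"
        unfolding B_def \<mu>_def by (rule nn_integral_levy_intensity[OF levy s(1)]) measurable
      also have "\<dots> \<le> ennreal s * v"
        unfolding v_def by (intro mult_left_mono nn_integral_mono) (auto simp: indicator_def)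
      finally show ?thesis .
    qed
    then have I2: "(\<integral>\<^sup>+\<omega>\<in>E. ennreal ((norm (I \<omega>))\<^sup>2) \<partial>M) \<le> 4 * emeasure M E * (ennreal s * v)"
      using sm(2) by (meson mult_left_mono order_trans zero_le)
    \<comment> \<open>Without points in \<open>A\<close> the random integral over \<open>B1\<close>
      loses its part over \<open>B2\<close>, while the compensator keeps it; adding \<open>c\<close>
      removes exactly that part. Since \<open>s \<le> t\<close>, the same \<open>A\<close> serves
      every time \<open>s\<close>.\<close>
    have on_void: "compensated_jumps_above Lm N \<delta> s \<omega> + c = I \<omega>" "large_jumps N s \<omega> = 0"
      if \<omega>: "\<omega> \<in> E" "\<omega> \<in> F" for \<omega>
    proof -
      have \<omega>M: "\<omega> \<in> space M" using \<omega> by (simp add: E)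
      have sets: "sets (N \<omega>) = sets \<mu>" using ppm_sets[OF ppm \<omega>M] by simp
      have sndN: "snd \<in> borel_measurable (N \<omega>)"
        using snd unfolding measurable_cong_sets[OF sets refl] .
      have "A \<in> null_sets (N \<omega>)" using \<omega>(1) A(1) by (auto simp: E null_sets_def sets)
      then have ae: "AE z in N \<omega>. z \<notin> A" by (rule AE_not_in)
      have "(LINT z:B1|N \<omega>. snd z) = (LINT z:B|N \<omega>. snd z)"
      proof (rule set_integral_cong_set)
        show "AE z in N \<omega>. (z \<in> B) = (z \<in> B1)" using ae by eventually_elim (use B12 in auto)
      qed (use sndN B(1) B1 sets in \<open>auto simp: set_borel_measurable_def intro!: borel_measurable_scaleR borel_measurable_indicator\<close>)
      moreover have "(LINT z:B1|\<mu>. snd z) = (LINT z:B|\<mu>. snd z) + (LINT z:B2|\<mu>. snd z)"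
        unfolding B12(1)
      proof (rule set_integral_Un[OF B12(2)])
        show "set_integrable \<mu> B snd" unfolding set_integrable_def
          by (rule integrableI_bounded_set_indicator[OF B(1) snd B(2), of 1]) (use snd_le \<rho> in force)
        show "set_integrable \<mu> B2 snd" unfolding set_integrable_def
          by (rule integrableI_bounded_set_indicator[OF B2(1) snd B2(2), of 1]) (auto simp: B2_def)
      qed
      ultimately show "compensated_jumps_above Lm N \<delta> s \<omega> + c = I \<omega>"
        using \<omega>(2) by (simp add: compensated_jumps_above_def c_def mean_jumps_def I_def B1_def[symmetric]
            B2_def[symmetric] \<mu>_def[symmetric])
      have "large_jumps N s \<omega> = (LINT z|N \<omega>. 0)"
        unfolding large_jumps_def set_lebesgue_integral_def
      proof (rule integral_cong_AE)
        have "{0<..s} \<times> {u::'a. 1 < norm u} \<in> sets (N \<omega>)"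
          unfolding sets \<mu>_def using levy_intensity_slab(1)[OF levy s(1), of 1] by simp
        then show "(\<lambda>z. indicator ({0<..s} \<times> {u. 1 < norm u}) z *\<^sub>R snd z) \<in> borel_measurable (N \<omega>)"
          using sndN by (intro borel_measurable_scaleR borel_measurable_indicator)
        show "AE z in N \<omega>. indicator ({0<..s} \<times> {u. 1 < norm u}) z *\<^sub>R snd z = 0"
          using ae by eventually_elim (use \<rho> s in \<open>auto simp: A_def indicator_def\<close>)
      qed simp
      then show "large_jumps N s \<omega> = 0" by simp
    qed
    have tri: "(norm (a + b))\<^sup>2 \<le> 2 * (norm a)\<^sup>2 + 2 * (norm b)\<^sup>2" for a b :: 'a
    proof -
      have "(norm (a + b))\<^sup>2 \<le> (norm a + norm b)\<^sup>2" by (intro power_mono norm_triangle_ineq) simp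
      also have "\<dots> \<le> 2 * (norm a)\<^sup>2 + 2 * (norm b)\<^sup>2"
        using zero_le_power2[of "norm a - norm b"] by (simp add: power2_eq_square algebra_simps)
      finally show ?thesis .
    qed
    have "(\<integral>\<^sup>+\<omega>\<in>E. ennreal ((norm (V \<omega> + c))\<^sup>2) \<partial>M) \<le>
        (\<integral>\<^sup>+\<omega>. 2 * (ennreal ((norm (I \<omega> - c - J \<omega>))\<^sup>2) * indicator (E \<inter> F) \<omega>) +
          2 * (ennreal ((norm (I \<omega>))\<^sup>2) * indicator E \<omega>) \<partial>M)"
    proof (rule nn_integral_mono_AE, use V aeF in eventually_elim)
      fix \<omega> assume V: "V \<omega> = large_jumps N s \<omega> + J \<omega>" and F: "\<omega> \<in> F"
      show "ennreal ((norm (V \<omega> + c))\<^sup>2) * indicator E \<omega> \<le>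
          2 * (ennreal ((norm (I \<omega> - c - J \<omega>))\<^sup>2) * indicator (E \<inter> F) \<omega>) +
          2 * (ennreal ((norm (I \<omega>))\<^sup>2) * indicator E \<omega>)"
      proof (cases "\<omega> \<in> E")
        case True
        \<comment> \<open>By \<open>on_void\<close>, \<open>I \<omega> - c\<close> is the truncated
          compensated integral, so the bracket is its difference from \<open>J \<omega>\<close>,
          whose second moment is at most \<open>g \<delta>\<close>.\<close>
        have "V \<omega> + c = - (I \<omega> - c - J \<omega>) + I \<omega>"
          using V on_void(2)[OF True F] by simp
        then have "(norm (V \<omega> + c))\<^sup>2 \<le> 2 * (norm (I \<omega> - c - J \<omega>))\<^sup>2 + 2 * (norm (I \<omega>))\<^sup>2"
          using tri[of "- (I \<omega> - c - J \<omega>)" "I \<omega>"] by (simp only: norm_minus_cancel)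
        then have "ennreal ((norm (V \<omega> + c))\<^sup>2) \<le>
            2 * ennreal ((norm (I \<omega> - c - J \<omega>))\<^sup>2) + 2 * ennreal ((norm (I \<omega>))\<^sup>2)"
          by (simp add: ennreal_leI ennreal_plus[symmetric] ennreal_mult'[symmetric] ennreal_numeral[symmetric]
              del: ennreal_plus ennreal_numeral)
        then show ?thesis using True F by simp
      qed simp
    qed
    also have "\<dots> = 2 * (\<integral>\<^sup>+\<omega>. ennreal ((norm (I \<omega> - c - J \<omega>))\<^sup>2) * indicator (E \<inter> F) \<omega> \<partial>M) +
        2 * (\<integral>\<^sup>+\<omega>\<in>E. ennreal ((norm (I \<omega>))\<^sup>2) \<partial>M)"
      by (subst nn_integral_add) (auto simp: nn_integral_cmult)
    also have "\<dots> \<le> 2 * g \<delta> + 2 * (4 * emeasure M E * (ennreal s * v))"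
    proof (intro add_mono mult_left_mono I2)
      show "(\<integral>\<^sup>+\<omega>. ennreal ((norm (I \<omega> - c - J \<omega>))\<^sup>2) * indicator (E \<inter> F) \<omega> \<partial>M) \<le> g \<delta>"
        unfolding g_def
      proof (rule nn_integral_mono)
        fix \<omega>
        show "ennreal ((norm (I \<omega> - c - J \<omega>))\<^sup>2) * indicator (E \<inter> F) \<omega> \<le>
            ennreal ((norm (compensated_jumps_above Lm N \<delta> s \<omega> - J \<omega>))\<^sup>2)"
          by (cases "\<omega> \<in> E \<inter> F") (auto simp: on_void(1)[symmetric])
      qed
    qed auto
    finally show ?thesis by (simp add: mult.assoc[symmetric])
  qed
  have "(\<integral>\<^sup>+\<omega>\<in>E. ennreal ((norm (V \<omega> + c))\<^sup>2) \<partial>M) \<le> 2 * 0 + 8 * emeasure M E * (ennreal s * v)"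
  proof (rule tendsto_lowerbound)
    show "((\<lambda>\<delta>. 2 * g \<delta> + 8 * emeasure M E * (ennreal s * v)) \<longlongrightarrow> 2 * 0 + 8 * emeasure M E * (ennreal s * v)) (at_right 0)"
      by (intro tendsto_add ennreal_tendsto_cmult g tendsto_const) simp
    have "\<forall>\<^sub>F \<delta> in at_right (0::real). \<delta> \<in> {0<..<\<rho>}"
      using \<rho> by (intro eventually_at_right_real)
    then show "\<forall>\<^sub>F \<delta> in at_right 0. (\<integral>\<^sup>+\<omega>\<in>E. ennreal ((norm (V \<omega> + c))\<^sup>2) \<partial>M) \<le>
        2 * g \<delta> + 8 * emeasure M E * (ennreal s * v)"
      by eventually_elim (rule bound, auto)
  qed simp
  then show ?thesis by (simp add: c_def v_def)
qed

text \<open>Right continuity makes a path the limit of its values at grid points to the right, and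
  each approximant is measurable as a countable patchwork of \<open>U\<close> at fixed times. Fubini
  in time and outcome requires this. Paths are cadlag only almost surely, hence the restriction to
  \<open>\<Omega>\<close>.\<close>

lemma cadlag_jointly_measurable:
  fixes U :: "real \<Rightarrow> 'w \<Rightarrow> 'a::euclidean_space"
  assumes U: "\<And>s. 0 \<le> s \<Longrightarrow> U s \<in> borel_measurable M" and [measurable]: "\<Omega> \<in> sets M"
    and cadlag: "\<And>\<omega>. \<omega> \<in> \<Omega> \<Longrightarrow> cadlag (\<lambda>s. U s \<omega>)"
  shows "(\<lambda>(s, \<omega>). indicator ({0..} \<times> \<Omega>) (s, \<omega>) *\<^sub>R U s \<omega>) \<in> borel_measurable (borel \<Otimes>\<^sub>M M)"
proof -
  \<comment> \<open>Measurability of \<open>U s\<close> is known for nonnegative times only, so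
    negative grid points get the value 0.\<close>
  define W where "W s \<omega> = indicator {0..} s *\<^sub>R U s \<omega>" for s \<omega>
  have W: "W s \<in> borel_measurable M" for s
    unfolding W_def using U[of s] by (cases "0 \<le> s") auto
  \<comment> \<open>Floor plus one, so that \<open>k n s\<close> exceeds \<open>s\<close> strictly:
    the filter \<open>at_right s\<close> excludes the point \<open>s\<close> itself.\<close>
  define k where "k n s = (real_of_int \<lfloor>real (Suc n) * s\<rfloor> + 1) / real (Suc n)" for n s
  define f where "f n z = indicator ({0..} \<times> \<Omega>) z *\<^sub>R W (k n (fst z)) (snd z)" for n z
  have kgt: "s < k n s" for n s
  proof -
    have "real (Suc n) * s < real_of_int \<lfloor>real (Suc n) * s\<rfloor> + 1" by linarith
    then show ?thesis unfolding k_def by (simp add: field_simps)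
  qed
  have kle: "k n s \<le> s + 1 / real (Suc n)" for n s
  proof -
    have "real_of_int \<lfloor>real (Suc n) * s\<rfloor> + 1 \<le> real (Suc n) * s + 1" by linarith
    then have "k n s \<le> (real (Suc n) * s + 1) / real (Suc n)"
      unfolding k_def by (intro divide_right_mono) auto
    then show ?thesis by (simp add: add_divide_distrib)
  qed
  have klim: "(\<lambda>n. k n s) \<longlonglongrightarrow> s" for s
  proof (rule tendsto_sandwich[where f = "\<lambda>_. s" and h = "\<lambda>n. s + 1 / real (Suc n)"])
    show "(\<lambda>n. s + 1 / real (Suc n)) \<longlonglongrightarrow> s"
      using tendsto_add[OF tendsto_const LIMSEQ_inverse_real_of_nat, of s] by (simp add: inverse_eq_divide)
    show "\<forall>\<^sub>F n in sequentially. s \<le> k n s" "\<forall>\<^sub>F n in sequentially. k n s \<le> s + 1 / real (Suc n)"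
      using less_imp_le[OF kgt] kle by (simp_all only: eventually_True)
  qed (rule tendsto_const)
  have [measurable]: "f n \<in> borel_measurable (borel \<Otimes>\<^sub>M M)" for n
  proof -
    have "(\<lambda>z::real \<times> 'w. W ((real_of_int \<lfloor>real (Suc n) * fst z\<rfloor> + 1) / real (Suc n)) (snd z))
        \<in> borel_measurable (borel \<Otimes>\<^sub>M M)"
    proof (rule measurable_compose_countable[where f = "\<lambda>i z. W ((real_of_int i + 1) / real (Suc n)) (snd z)"])
      show "(\<lambda>z. W ((real_of_int i + 1) / real (Suc n)) (snd z)) \<in> borel_measurable (borel \<Otimes>\<^sub>M M)" for i
        by (rule measurable_compose[OF measurable_snd W])
    qed measurable
    then show ?thesis unfolding f_def k_def by measurable
  qed
  show ?thesis
  proof (rule borel_measurable_LIMSEQ_metric[of f])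
    fix z :: "real \<times> 'w" assume "z \<in> space (borel \<Otimes>\<^sub>M M)"
    obtain s \<omega> where z: "z = (s, \<omega>)" by (cases z)
    have "(\<lambda>n. U (k n s) \<omega>) \<longlonglongrightarrow> U s \<omega>" if "0 \<le> s" "\<omega> \<in> \<Omega>"
    proof -
      have "((\<lambda>s. U s \<omega>) \<longlongrightarrow> U s \<omega>) (at_right s)"
        using cadlag[OF that(2)] that(1) by (simp add: cadlag_def)
      moreover have "filterlim (\<lambda>n. k n s) (at_right s) sequentially"
        using klim kgt by (intro tendsto_imp_filterlim_at_right) auto
      ultimately show ?thesis by (rule filterlim_compose)
    qed
    moreover have "W (k n s) \<omega> = U (k n s) \<omega>" if "0 \<le> s" for n
      using kgt[of s n] that by (simp add: W_def)
    ultimately show "(\<lambda>n. f n z) \<longlonglongrightarrow> (case z of (s, \<omega>) \<Rightarrow> indicator ({0..} \<times> \<Omega>) (s, \<omega>) *\<^sub>R U s \<omega>)"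
      by (auto simp: z f_def indicator_def)
  qed measurable
qed

lemma sigma_finite_levy_intensity:
  fixes Lm :: "'a::euclidean_space measure"
  assumes "levy_measure Lm"
  shows "sigma_finite_measure (levy_intensity Lm)"
proof -
  have "sigma_finite_measure (density lborel (indicator {0::real..}))"
    by (subst sigma_finite_measure.sigma_finite_iff_density_finite[OF sigma_finite_lborel]) (auto simp: indicator_def)
  then have "pair_sigma_finite (density lborel (indicator {0::real..})) Lm"
    using levy_measure_sigma_finite[OF assms] by (simp add: pair_sigma_finite_def)
  then interpret pair_sigma_finite "density lborel (indicator {0::real..})" Lm .
  show ?thesis unfolding levy_intensity_def by unfold_locales
qed

lemma borel_measurable_mean_jumps:
  fixes Lm :: "'a::euclidean_space measure"
  assumes levy: "levy_measure Lm"
  shows "mean_jumps Lm \<rho> \<in> borel_measurable borel"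
proof -
  interpret sigma_finite_measure "levy_intensity Lm" using levy by (rule sigma_finite_levy_intensity)
  have "(\<lambda>(s::real, z). indicator ({0<..s} \<times> {u. \<rho> < norm u \<and> norm u \<le> 1}) z *\<^sub>R snd z)
      \<in> borel_measurable (borel \<Otimes>\<^sub>M (borel \<Otimes>\<^sub>M (borel :: 'a measure)))"
    unfolding indicator_def mem_Times_iff greaterThanAtMost_iff mem_Collect_eq by measurable
  then have "(\<lambda>(s, z). indicator ({0<..s} \<times> {u. \<rho> < norm u \<and> norm u \<le> 1}) z *\<^sub>R snd z)
      \<in> borel_measurable (borel \<Otimes>\<^sub>M levy_intensity Lm)"
    by (simp only: measurable_cong_sets[OF sets_pair_measure_cong[OF refl sets_levy_intensity[OF levy]] refl])
  then show ?thesis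
    unfolding mean_jumps_def set_lebesgue_integral_def
    by (rule borel_measurable_lebesgue_integral)
qed

text \<open>The bound is uniform in \<open>\<rho>\<close>: this is how summability of the small
  jumps keeps the compensator, and with it the centres of the balls, bounded.\<close>

lemma norm_mean_jumps_le:
  fixes Lm :: "'a::euclidean_space measure"
  assumes levy: "levy_measure Lm" and "0 \<le> s" "0 < \<rho>"
    and fin: "(\<integral>\<^sup>+ u\<in>{u. norm u \<le> 1}. ennreal (norm u) \<partial>Lm) \<le> ennreal I" "0 \<le> I"
  shows "norm (mean_jumps Lm \<rho> s) \<le> s * I"
proof -
  define S where "S = {u::'a. \<rho> < norm u \<and> norm u \<le> 1}"
  have S: "{0<..s} \<times> S \<in> sets (levy_intensity Lm)" "emeasure (levy_intensity Lm) ({0<..s} \<times> S) < \<infinity>"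
    unfolding S_def by (rule levy_intensity_slab[OF levy \<open>0 \<le> s\<close> \<open>0 < \<rho>\<close>]; simp)+
  have int: "integrable (levy_intensity Lm) (\<lambda>z. indicator ({0<..s} \<times> S) z *\<^sub>R snd z)"
    by (rule integrableI_bounded_set_indicator[OF S(1) borel_measurable_snd_levy_intensity[OF levy] S(2), of 1])
       (auto simp: S_def)
  have "ennreal (norm (mean_jumps Lm \<rho> s)) \<le> (\<integral>\<^sup>+z. norm (indicator ({0<..s} \<times> S) z *\<^sub>R snd z) \<partial>levy_intensity Lm)"
    unfolding mean_jumps_def set_lebesgue_integral_def S_def[symmetric]
    by (rule integral_norm_bound_ennreal[OF int])
  also have "\<dots> = (\<integral>\<^sup>+z\<in>{0<..s} \<times> S. ennreal (norm (snd z)) \<partial>levy_intensity Lm)"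
    by (intro nn_integral_cong) (auto simp: indicator_def)
  also have "\<dots> = ennreal s * (\<integral>\<^sup>+u\<in>S. ennreal (norm u) \<partial>Lm)"
    by (rule nn_integral_levy_intensity[OF levy \<open>0 \<le> s\<close>]) (auto simp: S_def)
  also have "(\<integral>\<^sup>+u\<in>S. ennreal (norm u) \<partial>Lm) \<le> ennreal I"
    by (rule order_trans[OF nn_integral_mono fin(1)]) (auto simp: S_def indicator_def)
  finally have "ennreal (norm (mean_jumps Lm \<rho> s)) \<le> ennreal s * ennreal I"
    by (simp add: mult_left_mono)
  then show ?thesis
    using \<open>0 \<le> s\<close> fin(2) by (simp add: ennreal_mult[symmetric])
qed

text \<open>\<open>G\<close> is a part of the event without jumps above \<open>\<rho>\<close> on
  which the recentred noise is small in both senses that the stability estimate needs, at time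
  \<open>t\<close> and on average. The almost sure property \<open>Q\<close> is carried along so
  that later arguments run pointwise on \<open>G\<close>.\<close>

lemma quiet_event:
  fixes Lm :: "'a::euclidean_space measure" and U :: "real \<Rightarrow> 'w \<Rightarrow> 'a"
  assumes "prob_space M" and levy: "levy_process M Lm U"
    and \<rho>: "0 < \<rho>" "\<rho> \<le> 1" and t: "0 < t" and R: "0 < R"
    and small: "(\<integral>\<^sup>+u\<in>{u. norm u \<le> \<rho>}. ennreal ((norm u)\<^sup>2) \<partial>Lm) \<le> ennreal \<beta>"
    and \<beta>: "0 \<le> \<beta>" "16 * (t + t\<^sup>2) * \<beta> \<le> R\<^sup>2"
    and ae: "AE \<omega> in M. Q \<omega>"
  obtains G where "G \<in> sets M" "exp (- t * measure Lm {u. \<rho> < norm u}) / 2 \<le> measure M G"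
    "\<And>\<omega>. \<omega> \<in> G \<Longrightarrow> Q \<omega>"
    "\<And>\<omega>. \<omega> \<in> G \<Longrightarrow> norm (U t \<omega> - U 0 \<omega> + mean_jumps Lm \<rho> t) \<le> R"
    "\<And>\<omega>. \<omega> \<in> G \<Longrightarrow> set_integrable lborel {0..t} (\<lambda>s. U s \<omega> - U 0 \<omega> + mean_jumps Lm \<rho> s)"
    "\<And>\<omega>. \<omega> \<in> G \<Longrightarrow> (LBINT s:{0..t}. norm (U s \<omega> - U 0 \<omega> + mean_jumps Lm \<rho> s)) \<le> (t + 1) * R"
proof -
  interpret prob_space M by fact
  have lm: "levy_measure Lm" and U: "\<And>s. 0 \<le> s \<Longrightarrow> U s \<in> borel_measurable M"
    and cad: "AE \<omega> in M. cadlag (\<lambda>s. U s \<omega>)"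
    using levy by (auto simp: levy_process_def)
  obtain N where ppm: "poisson_point_measure M N (levy_intensity Lm)"
    and ito: "\<And>s. 0 \<le> s \<Longrightarrow> \<exists>J. is_compensated_small_jumps M Lm N s J \<and>
        (AE \<omega> in M. U s \<omega> = U 0 \<omega> + large_jumps N s \<omega> + J \<omega>)"
    using levy by (auto simp: levy_process_def)
  have "AE \<omega> in M. cadlag (\<lambda>s. U s \<omega>) \<and> Q \<omega>" using cad ae by eventually_elim simp
  then obtain Z0 where Z0: "{\<omega>\<in>space M. \<not> (cadlag (\<lambda>s. U s \<omega>) \<and> Q \<omega>)} \<subseteq> Z0" "emeasure M Z0 = 0" "Z0 \<in> sets M"
    by (rule AE_E)
  define \<Omega> where "\<Omega> = space M - Z0"
  have \<Omega>m[measurable]: "\<Omega> \<in> sets M" using Z0 by (simp add: \<Omega>_def)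
  have \<Omega>: "cadlag (\<lambda>s. U s \<omega>)" "Q \<omega>" if "\<omega> \<in> \<Omega>" for \<omega> using that Z0 by (auto simp: \<Omega>_def)
  have ae\<Omega>: "AE \<omega> in M. \<omega> \<in> \<Omega>"
    using AE_not_in[of Z0 M] Z0 by (auto simp: \<Omega>_def null_sets_def)
  define A where "A = {0<..t} \<times> {u::'a. \<rho> < norm u}"
  define E where "E = {\<omega>\<in>space M. emeasure (N \<omega>) A = 0}"
  have A: "A \<in> sets (levy_intensity Lm)" "emeasure (levy_intensity Lm) A < \<infinity>"
    unfolding A_def by (rule levy_intensity_slab[OF lm _ \<rho>(1)]; use t in simp)+
  have Em[measurable]: "E \<in> sets M" unfolding E_def using ppm_measurable[OF ppm A(1)] by measurable
  have PE: "prob E = exp (- t * measure Lm {u. \<rho> < norm u})"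
  proof -
    have "measure (levy_intensity Lm) A = t * measure Lm {u. \<rho> < norm u}"
      unfolding A_def measure_def using t by (subst emeasure_levy_intensity[OF lm]) (auto simp: enn2real_mult)
    then show ?thesis unfolding E_def using ppm_void_probability[OF ppm A] by simp
  qed
  define c where "c = mean_jumps Lm \<rho>"
  define Z where "Z s \<omega> = U s \<omega> - U 0 \<omega> + c s" for s \<omega>
  \<comment> \<open>Multiplying by the indicator of nonnegative times and of a full event of cadlag
    paths makes the process jointly measurable, and leaves it unchanged at nonnegative times on
    \<open>G\<close>.\<close>
  define Y where "Y s \<omega> = indicator ({0..} \<times> \<Omega>) (s, \<omega>) *\<^sub>R Z s \<omega>" for s \<omega>
  have [measurable]: "c \<in> borel_measurable borel" unfolding c_def by (rule borel_measurable_mean_jumps[OF lm])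
  have Ym[measurable]: "(\<lambda>(s, \<omega>). Y s \<omega>) \<in> borel_measurable (borel \<Otimes>\<^sub>M M)"
  proof -
    note [measurable] = cadlag_jointly_measurable[OF U \<Omega>m \<Omega>(1)]
    have [measurable]: "U 0 \<in> borel_measurable M" by (rule U) simp
    have "(\<lambda>(s, \<omega>). Y s \<omega>) = (\<lambda>z. (case z of (s, \<omega>) \<Rightarrow> indicator ({0..} \<times> \<Omega>) (s, \<omega>) *\<^sub>R U s \<omega>)
        + indicator ({0..} \<times> \<Omega>) z *\<^sub>R (c (fst z) - U 0 (snd z)))"
      by (auto simp: fun_eq_iff Y_def Z_def indicator_def)
    also have "\<dots> \<in> borel_measurable (borel \<Otimes>\<^sub>M M)" by measurable
    finally show ?thesis .
  qed
  have moment: "(\<integral>\<^sup>+\<omega>\<in>E. ennreal ((norm (Y s \<omega>))\<^sup>2) \<partial>M) \<le> ennreal (8 * t * \<beta>) * emeasure M E" if s: "s \<in> {0..t}" for s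
  proof -
    have s0: "0 \<le> s" "s \<le> t" using s by auto
    obtain J where J: "is_compensated_small_jumps M Lm N s J"
      "AE \<omega> in M. U s \<omega> = U 0 \<omega> + large_jumps N s \<omega> + J \<omega>" using ito[OF s0(1)] by blast
    have V: "AE \<omega> in M. U s \<omega> - U 0 \<omega> = large_jumps N s \<omega> + J \<omega>"
      using J(2) by eventually_elim simp
    have "(\<integral>\<^sup>+\<omega>\<in>E. ennreal ((norm (Y s \<omega>))\<^sup>2) \<partial>M) \<le> (\<integral>\<^sup>+\<omega>\<in>E. ennreal ((norm (Z s \<omega>))\<^sup>2) \<partial>M)"
      by (intro nn_integral_mono) (auto simp: Y_def indicator_def)
    also have "\<dots> \<le> 8 * emeasure M E * (ennreal s * (\<integral>\<^sup>+u\<in>{u. norm u \<le> \<rho>}. ennreal ((norm u)\<^sup>2) \<partial>Lm))"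
      using second_moment_without_large_jumps[OF \<open>prob_space M\<close> lm ppm \<rho> s0 J(1) V]
      unfolding Z_def c_def E_def A_def .
    also have "\<dots> \<le> 8 * emeasure M E * (ennreal t * ennreal \<beta>)"
      by (intro mult_left_mono mult_mono small ennreal_leI s0) auto
    also have "\<dots> = ennreal (8 * t * \<beta>) * emeasure M E"
      using t \<beta>(1) by (simp add: ennreal_mult mult_ac)
    finally show ?thesis .
  qed
  \<comment> \<open>One random variable for both requirements, so a single use of Markov's
    inequality suffices. Its integral over \<open>E\<close> is at most
    \<open>8 * (t + t\<^sup>2) * \<beta> * prob E\<close>, and the 16 in the hypothesis makes this
    at most half of \<open>R\<^sup>2 * prob E\<close>.\<close>
  define q where "q \<omega> = ennreal ((norm (Y t \<omega>))\<^sup>2) + (\<integral>\<^sup>+s\<in>{0..t}. ennreal ((norm (Y s \<omega>))\<^sup>2) \<partial>lborel)" for \<omega>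
  have Yt[measurable]: "Y s \<in> borel_measurable M" for s
    using measurable_Pair2[OF Ym, of s] by simp
  have inner_m[measurable]: "(\<lambda>\<omega>. \<integral>\<^sup>+s\<in>{0..t}. ennreal ((norm (Y s \<omega>))\<^sup>2) \<partial>lborel) \<in> borel_measurable M"
  proof (rule lborel.borel_measurable_nn_integral)
    have "(\<lambda>(\<omega>, s). Y s \<omega>) \<in> borel_measurable (M \<Otimes>\<^sub>M borel)"
      using measurable_compose[OF measurable_pair_swap' Ym] by (simp add: split_beta')
    then have [measurable]: "(\<lambda>(\<omega>, s). Y s \<omega>) \<in> borel_measurable (M \<Otimes>\<^sub>M lborel)" by simp
    show "(\<lambda>(\<omega>, s). ennreal ((norm (Y s \<omega>))\<^sup>2) * indicator {0..t} s) \<in> borel_measurable (M \<Otimes>\<^sub>M lborel)"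
      by measurable
  qed
  have qm[measurable]: "q \<in> borel_measurable M" unfolding q_def by measurable
  interpret P: pair_sigma_finite lborel M ..
  have "(\<integral>\<^sup>+\<omega>. (\<integral>\<^sup>+s\<in>{0..t}. ennreal ((norm (Y s \<omega>))\<^sup>2) \<partial>lborel) * indicator E \<omega> \<partial>M) =
      (\<integral>\<^sup>+\<omega>. (\<integral>\<^sup>+s. ennreal ((norm (Y s \<omega>))\<^sup>2) * indicator {0..t} s * indicator E \<omega> \<partial>lborel) \<partial>M)"
  proof (rule nn_integral_cong)
    fix \<omega> assume "\<omega> \<in> space M"
    then have [measurable]: "(\<lambda>s. Y s \<omega>) \<in> borel_measurable borel"
      using measurable_Pair1[OF Ym] by simp
    show "(\<integral>\<^sup>+s\<in>{0..t}. ennreal ((norm (Y s \<omega>))\<^sup>2) \<partial>lborel) * indicator E \<omega> =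
        (\<integral>\<^sup>+s. ennreal ((norm (Y s \<omega>))\<^sup>2) * indicator {0..t} s * indicator E \<omega> \<partial>lborel)"
      by (subst nn_integral_multc) auto
  qed
  also have "\<dots> = (\<integral>\<^sup>+s. (\<integral>\<^sup>+\<omega>. ennreal ((norm (Y s \<omega>))\<^sup>2) * indicator {0..t} s * indicator E \<omega> \<partial>M) \<partial>lborel)"
  proof (rule P.Fubini')
    have [measurable]: "(\<lambda>(s, \<omega>). Y s \<omega>) \<in> borel_measurable (lborel \<Otimes>\<^sub>M M)" using Ym by simp
    show "(\<lambda>(s, \<omega>). ennreal ((norm (Y s \<omega>))\<^sup>2) * indicator {0..t} s * indicator E \<omega>) \<in> borel_measurable (lborel \<Otimes>\<^sub>M M)"
      by measurable
  qed
  also have "\<dots> \<le> (\<integral>\<^sup>+s. ennreal (8 * t * \<beta>) * emeasure M E * indicator {0..t} s \<partial>lborel)"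
  proof (rule nn_integral_mono)
    fix s :: real
    show "(\<integral>\<^sup>+\<omega>. ennreal ((norm (Y s \<omega>))\<^sup>2) * indicator {0..t} s * indicator E \<omega> \<partial>M) \<le>
        ennreal (8 * t * \<beta>) * emeasure M E * indicator {0..t} s"
      using moment[of s] by (cases "s \<in> {0..t}") auto
  qed
  also have "\<dots> = ennreal (8 * t * \<beta>) * emeasure M E * ennreal t"
    using t by (subst nn_integral_cmult_indicator) auto
  finally have second: "(\<integral>\<^sup>+\<omega>. (\<integral>\<^sup>+s\<in>{0..t}. ennreal ((norm (Y s \<omega>))\<^sup>2) \<partial>lborel) * indicator E \<omega> \<partial>M)
      \<le> ennreal (8 * t * \<beta>) * emeasure M E * ennreal t" .
  have "(\<integral>\<^sup>+\<omega>. q \<omega> * indicator E \<omega> \<partial>M) =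
      (\<integral>\<^sup>+\<omega>\<in>E. ennreal ((norm (Y t \<omega>))\<^sup>2) \<partial>M) +
      (\<integral>\<^sup>+\<omega>. (\<integral>\<^sup>+s\<in>{0..t}. ennreal ((norm (Y s \<omega>))\<^sup>2) \<partial>lborel) * indicator E \<omega> \<partial>M)"
    unfolding q_def distrib_right by (rule nn_integral_add) measurable
  also have "\<dots> \<le> ennreal (8 * t * \<beta>) * emeasure M E + ennreal (8 * t * \<beta>) * emeasure M E * ennreal t"
    using moment[of t] second t by (intro add_mono) auto
  also have "\<dots> = ennreal (8 * (t + t\<^sup>2) * \<beta> * prob E)"
    using t \<beta>(1) by (simp add: emeasure_eq_measure ennreal_mult[symmetric] ennreal_plus[symmetric]
        power2_eq_square algebra_simps del: ennreal_plus)
  also have "\<dots> \<le> ennreal (R\<^sup>2 * prob E / 2)"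
    using mult_right_mono[OF \<beta>(2), of "prob E"] by (intro ennreal_leI) (simp add: algebra_simps)
  finally have qE: "(\<integral>\<^sup>+\<omega>. q \<omega> * indicator E \<omega> \<partial>M) \<le> ennreal (R\<^sup>2 * prob E / 2)" .
  \<comment> \<open>By Markov's inequality the discarded part has at most half the probability of
    \<open>E\<close>, however small that is; this is why the moments were taken over
    \<open>E\<close> with \<open>prob E\<close> as a factor.\<close>
  define H where "H = {\<omega>\<in>E. ennreal (R\<^sup>2) < q \<omega>}"
  have [measurable]: "H \<in> sets M"
  proof -
    have "H = E \<inter> {\<omega>\<in>space M. ennreal (R\<^sup>2) < q \<omega>}" by (auto simp: H_def E_def)
    then show ?thesis by simp
  qed
  have "ennreal (R\<^sup>2) * emeasure M H = (\<integral>\<^sup>+\<omega>. ennreal (R\<^sup>2) * indicator H \<omega> \<partial>M)"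
    by (simp add: nn_integral_cmult_indicator)
  also have "\<dots> \<le> (\<integral>\<^sup>+\<omega>. q \<omega> * indicator E \<omega> \<partial>M)"
    by (intro nn_integral_mono) (auto simp: H_def indicator_def)
  also note qE
  finally have "R\<^sup>2 * prob H \<le> R\<^sup>2 * (prob E / 2)"
    by (simp add: emeasure_eq_measure ennreal_mult'[symmetric])
  then have PH: "prob H \<le> prob E / 2" using R by (subst (asm) mult_le_cancel_left_pos) auto
  define G where "G = (E - H) \<inter> \<Omega>"
  show ?thesis
  proof (rule that[of G])
    show "G \<in> sets M" unfolding G_def by measurable
    have "prob (E - H) = prob E - prob H"
      by (rule finite_measure_Diff) (auto simp: H_def)
    moreover have "prob G = prob (E - H)"
      by (rule finite_measure_eq_AE) (use ae\<Omega> in \<open>auto simp: G_def\<close>)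
    ultimately show "exp (- t * measure Lm {u. \<rho> < norm u}) / 2 \<le> prob G"
      using PH PE by simp
    fix \<omega> assume \<omega>: "\<omega> \<in> G"
    then have \<omega>\<Omega>: "\<omega> \<in> \<Omega>" "\<omega> \<in> space M" by (auto simp: G_def E_def)
    then show "Q \<omega>" using \<Omega> by simp
    have YZ: "Y s \<omega> = Z s \<omega>" if "0 \<le> s" for s using that \<omega>\<Omega> by (simp add: Y_def)
    have q: "q \<omega> \<le> ennreal (R\<^sup>2)" using \<omega> by (auto simp: G_def H_def)
    have "ennreal ((norm (Y t \<omega>))\<^sup>2) \<le> q \<omega>" unfolding q_def by simp
    also note q
    finally have "(norm (Z t \<omega>))\<^sup>2 \<le> R\<^sup>2"
      using t by (simp add: YZ)
    then show "norm (U t \<omega> - U 0 \<omega> + mean_jumps Lm \<rho> t) \<le> R"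
      using power2_le_imp_le[of "norm (Z t \<omega>)" R] R by (simp add: Z_def c_def)
    have [measurable]: "(\<lambda>s. Y s \<omega>) \<in> borel_measurable borel"
      using measurable_Pair1[OF Ym \<omega>\<Omega>(2)] by simp
    \<comment> \<open>This replaces Cauchy-Schwarz in time: the pointwise bound converts the square
      integral, at most \<open>R\<^sup>2\<close>, into a bound \<open>R * (t + 1) / 2\<close> on the
      time integral of the norm.\<close>
    have amgm: "r \<le> (R + r\<^sup>2 / R) / 2" for r :: real
      using R zero_le_power2[of "R - r"] by (simp add: power2_eq_square field_simps)
    have "(\<integral>\<^sup>+s. ennreal (norm (indicator {0..t} s *\<^sub>R Y s \<omega>)) \<partial>lborel) \<le>
        (\<integral>\<^sup>+s. ennreal (R / 2) * indicator {0..t} s + ennreal (1 / (2 * R)) * (ennreal ((norm (Y s \<omega>))\<^sup>2) * indicator {0..t} s) \<partial>lborel)"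
    proof (rule nn_integral_mono)
      fix s :: real
      have "ennreal (norm (Y s \<omega>)) \<le> ennreal (R / 2 + 1 / (2 * R) * (norm (Y s \<omega>))\<^sup>2)"
        using amgm[of "norm (Y s \<omega>)"] by (intro ennreal_leI) (simp add: field_simps)
      also have "\<dots> = ennreal (R / 2) + ennreal (1 / (2 * R)) * ennreal ((norm (Y s \<omega>))\<^sup>2)"
        using R by (simp add: ennreal_plus ennreal_mult[symmetric])
      finally show "ennreal (norm (indicator {0..t} s *\<^sub>R Y s \<omega>)) \<le>
          ennreal (R / 2) * indicator {0..t} s + ennreal (1 / (2 * R)) * (ennreal ((norm (Y s \<omega>))\<^sup>2) * indicator {0..t} s)"
        by (auto simp: indicator_def)
    qed
    also have "\<dots> = ennreal (R / 2) * ennreal t + ennreal (1 / (2 * R)) * (\<integral>\<^sup>+s\<in>{0..t}. ennreal ((norm (Y s \<omega>))\<^sup>2) \<partial>lborel)"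
      using t by (subst nn_integral_add) (auto simp: nn_integral_cmult nn_integral_cmult_indicator)
    also have "\<dots> \<le> ennreal (R / 2) * ennreal t + ennreal (1 / (2 * R)) * ennreal (R\<^sup>2)"
    proof (intro add_left_mono mult_left_mono)
      have "(\<integral>\<^sup>+s\<in>{0..t}. ennreal ((norm (Y s \<omega>))\<^sup>2) \<partial>lborel) \<le> q \<omega>" unfolding q_def by simp
      then show "(\<integral>\<^sup>+s\<in>{0..t}. ennreal ((norm (Y s \<omega>))\<^sup>2) \<partial>lborel) \<le> ennreal (R\<^sup>2)" using q by order
    qed simp
    also have "\<dots> = ennreal (R / 2 * t + R / 2)"
      using R t by (simp add: ennreal_mult[symmetric] ennreal_plus[symmetric] power2_eq_square del: ennreal_plus)
    also have "\<dots> \<le> ennreal ((t + 1) * R)"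
      using R t by (intro ennreal_leI) (simp add: field_simps)
    finally have le: "(\<integral>\<^sup>+s. ennreal (norm (indicator {0..t} s *\<^sub>R Y s \<omega>)) \<partial>lborel) \<le> ennreal ((t + 1) * R)" .
    have intY: "integrable lborel (\<lambda>s. indicator {0..t} s *\<^sub>R Y s \<omega>)"
      by (rule integrableI_bounded) (use le in \<open>auto intro: le_less_trans\<close>)
    have eq: "indicator {0..t} s *\<^sub>R Y s \<omega> = indicator {0..t} s *\<^sub>R (U s \<omega> - U 0 \<omega> + mean_jumps Lm \<rho> s)" for s
      by (auto simp: indicator_def YZ Z_def c_def)
    show "set_integrable lborel {0..t} (\<lambda>s. U s \<omega> - U 0 \<omega> + mean_jumps Lm \<rho> s)"
      unfolding set_integrable_def eq[symmetric] by (rule intY)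
    have "ennreal (LBINT s. norm (indicator {0..t} s *\<^sub>R Y s \<omega>)) \<le> ennreal ((t + 1) * R)"
      using le by (subst nn_integral_eq_integral[OF integrable_norm[OF intY], symmetric]) auto
    then have "(LBINT s. norm (indicator {0..t} s *\<^sub>R Y s \<omega>)) \<le> (t + 1) * R"
      using R t by simp
    then show "(LBINT s:{0..t}. norm (U s \<omega> - U 0 \<omega> + mean_jumps Lm \<rho> s)) \<le> (t + 1) * R"
      unfolding eq by (simp add: set_lebesgue_integral_def)
  qed
qed

section \<open>Small ball probabilities\<close>

text \<open>\<open>C0\<close> and \<open>C1\<close> are fixed before \<open>\<rho>\<close>,
  \<open>\<beta>\<close> and \<open>R\<close>, although the compensator depends on
  \<open>\<rho>\<close>. For \<open>C0\<close> this works because the compensator cancels between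
  outcomes, for \<open>C1\<close> because summability bounds it uniformly.\<close>

lemma concentration_on_small_balls:
  fixes Lm :: "'a::euclidean_space measure" and U X :: "real \<Rightarrow> 'w \<Rightarrow> 'a"
  assumes "prob_space M" and smooth: "smooth_bounded_derivs a" and levy: "levy_process M Lm U"
    and sol: "solves_equation M a U x X" and t: "0 < t"
  obtains C0 C1 where "0 < C0" "0 \<le> C1"
    "\<And>\<rho> \<beta> R. 0 < \<rho> \<Longrightarrow> \<rho> \<le> 1 \<Longrightarrow> 0 < R \<Longrightarrow>
      (\<integral>\<^sup>+u\<in>{u. norm u \<le> \<rho>}. ennreal ((norm u)\<^sup>2) \<partial>Lm) \<le> ennreal \<beta> \<Longrightarrow> 0 \<le> \<beta> \<Longrightarrow>
      16 * (t + t\<^sup>2) * \<beta> \<le> R\<^sup>2 \<Longrightarrow>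
      \<exists>y. exp (- t * measure Lm {u. \<rho> < norm u}) / 2 \<le> measure M {\<omega>\<in>space M. X t \<omega> \<in> cball y (C0 * R)} \<and>
        ((\<integral>\<^sup>+ u\<in>{u. norm u \<le> 1}. ennreal (norm u) \<partial>Lm) < \<infinity> \<longrightarrow> norm y \<le> C1 * (1 + R))"
proof -
  interpret prob_space M by fact
  have lm: "levy_measure Lm" using levy by (simp add: levy_process_def)
  obtain L where L: "0 \<le> L" and lip: "\<And>x y. norm (a x - a y) \<le> L * norm (x - y)"
    by (rule smooth_bounded_derivs_lipschitz[OF smooth]) blast
  have Xm[measurable]: "X t \<in> borel_measurable M" using sol t by (simp add: solves_equation_def)
  define Q where "Q \<omega> \<longleftrightarrow> (\<forall>s\<ge>0. set_integrable lborel {0..s} (\<lambda>s. a (X s \<omega>)) \<and>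
        X s \<omega> = x + (LBINT s:{0..s}. a (X s \<omega>)) + U s \<omega> - U 0 \<omega>)" for \<omega>
  have Q: "AE \<omega> in M. Q \<omega>" using sol by (simp add: solves_equation_def Q_def)
  \<comment> \<open>\<open>enn2real\<close> makes \<open>I\<close> zero when the integral is
    infinite; its value matters only in the finite case, for the bound on the centre.\<close>
  define I where "I = enn2real (\<integral>\<^sup>+ u\<in>{u. norm u \<le> 1}. ennreal (norm u) \<partial>Lm)"
  have I0: "0 \<le> I" by (simp add: I_def)
  define E where "E = L * exp (L * t)"
  have E0: "0 \<le> E" using L by (simp add: E_def)
  \<comment> \<open>From stability for two outcomes: \<open>2 * R\<close> at time \<open>t\<close>,
    plus \<open>E\<close> times two time integrals of at most \<open>(t + 1) * R\<close>
    each.\<close>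
  define C0 where "C0 = 2 + 2 * E * (t + 1)"
  \<comment> \<open>\<open>h\<close> bounds the compensator plus the drift
    \<open>s *\<^sub>R a x\<close> up to time \<open>t\<close>. \<open>C1\<close> adds the constant
    term and the coefficient of \<open>R\<close> that arise when the solution is compared with the
    constant path at \<open>x\<close>.\<close>
  define h where "h = t * I + t * norm (a x)"
  have h0: "0 \<le> h" using t I0 by (simp add: h_def)
  define C1 where "C1 = norm x + (1 + E * (t + 1)) + (1 + E * t) * h"
  have "0 < C0" "0 \<le> C1" using E0 t h0 by (simp_all add: C0_def C1_def add_pos_nonneg)
  moreover have "\<exists>y. exp (- t * measure Lm {u. \<rho> < norm u}) / 2 \<le> prob {\<omega>\<in>space M. X t \<omega> \<in> cball y (C0 * R)} \<and>
        ((\<integral>\<^sup>+ u\<in>{u. norm u \<le> 1}. ennreal (norm u) \<partial>Lm) < \<infinity> \<longrightarrow> norm y \<le> C1 * (1 + R))"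
    if \<rho>: "0 < \<rho>" "\<rho> \<le> 1" and R: "0 < R"
      and \<beta>: "(\<integral>\<^sup>+u\<in>{u. norm u \<le> \<rho>}. ennreal ((norm u)\<^sup>2) \<partial>Lm) \<le> ennreal \<beta>" "0 \<le> \<beta>"
        "16 * (t + t\<^sup>2) * \<beta> \<le> R\<^sup>2"
    for \<rho> \<beta> R
  proof -
    define Z where "Z s \<omega> = U s \<omega> - U 0 \<omega> + mean_jumps Lm \<rho> s" for s \<omega>
    obtain G where Gm: "G \<in> sets M" and PG: "exp (- t * measure Lm {u. \<rho> < norm u}) / 2 \<le> prob G"
      and GQ: "\<And>\<omega>. \<omega> \<in> G \<Longrightarrow> Q \<omega>"
      and Zt: "\<And>\<omega>. \<omega> \<in> G \<Longrightarrow> norm (Z t \<omega>) \<le> R"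
      and Zint: "\<And>\<omega>. \<omega> \<in> G \<Longrightarrow> set_integrable lborel {0..t} (\<lambda>s. Z s \<omega>)"
      and ZI: "\<And>\<omega>. \<omega> \<in> G \<Longrightarrow> (LBINT s:{0..t}. norm (Z s \<omega>)) \<le> (t + 1) * R"
      unfolding Z_def
      by (rule quiet_event[OF \<open>prob_space M\<close> levy \<rho> t R \<beta> Q]) blast
    \<comment> \<open>Positive probability supplies an outcome \<open>\<omega>0\<close>, and its
      solution at time \<open>t\<close> serves as centre.\<close>
    have "G \<noteq> {}"
    proof
      assume "G = {}"
      then show False using PG exp_gt_zero[of "- t * measure Lm {u. \<rho> < norm u}"] by (simp add: not_le[symmetric])
    qed
    then obtain \<omega>0 where \<omega>0: "\<omega>0 \<in> G" by blast
    have eqn: "set_integrable lborel {0..t} (\<lambda>s. a (X s \<omega>))"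
      "\<And>s. s \<in> {0..t} \<Longrightarrow> X s \<omega> = x + (LBINT s:{0..s}. a (X s \<omega>)) + (U s \<omega> - U 0 \<omega>)" if "\<omega> \<in> G" for \<omega>
      using GQ[OF that] t by (auto simp: Q_def)
    have "norm (X t \<omega> - X t \<omega>0) \<le> C0 * R" if \<omega>: "\<omega> \<in> G" for \<omega>
    proof -
      \<comment> \<open>The term \<open>mean_jumps Lm \<rho> s\<close> is the same for both outcomes
        and cancels, whatever its size.\<close>
      have diff: "U s \<omega> - U 0 \<omega> - (U s \<omega>0 - U 0 \<omega>0) = Z s \<omega> - Z s \<omega>0" for s by (simp add: Z_def)
      have int: "set_integrable lborel {0..t} (\<lambda>s. Z s \<omega> - Z s \<omega>0)"
        by (intro set_integral_diff(1) Zint \<omega> \<omega>0)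
      have "norm (X t \<omega> - X t \<omega>0) \<le> norm (Z t \<omega> - Z t \<omega>0) + E * (LBINT s:{0..t}. norm (Z s \<omega> - Z s \<omega>0))"
        using additive_noise_stability[OF less_imp_le[OF t] L lip eqn(1)[OF \<omega>] eqn(1)[OF \<omega>0]
            eqn(2)[OF \<omega>] eqn(2)[OF \<omega>0]] int
        unfolding diff E_def by simp
      also have "norm (Z t \<omega> - Z t \<omega>0) \<le> R + R"
        using norm_triangle_ineq4[of "Z t \<omega>" "Z t \<omega>0"] Zt[OF \<omega>] Zt[OF \<omega>0] by linarith
      also have "(LBINT s:{0..t}. norm (Z s \<omega> - Z s \<omega>0)) \<le> (LBINT s:{0..t}. norm (Z s \<omega>) + norm (Z s \<omega>0))"
        by (intro set_integral_mono set_integrable_norm int set_integral_add(1) Zint \<omega> \<omega>0 norm_triangle_ineq4)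
      also have "\<dots> = (LBINT s:{0..t}. norm (Z s \<omega>)) + (LBINT s:{0..t}. norm (Z s \<omega>0))"
        by (intro set_integral_add(2) set_integrable_norm Zint \<omega> \<omega>0)
      also have "\<dots> \<le> (t + 1) * R + (t + 1) * R" by (intro add_mono ZI \<omega> \<omega>0)
      finally have "norm (X t \<omega> - X t \<omega>0) \<le> (R + R) + E * ((t + 1) * R + (t + 1) * R)"
        using E0 by (simp add: mult_left_mono)
      then show ?thesis by (simp add: C0_def algebra_simps)
    qed
    then have "G \<subseteq> {\<omega>\<in>space M. X t \<omega> \<in> cball (X t \<omega>0) (C0 * R)}"
      using sets.sets_into_space[OF Gm] by (auto simp: dist_norm norm_minus_commute)
    then have "prob G \<le> prob {\<omega>\<in>space M. X t \<omega> \<in> cball (X t \<omega>0) (C0 * R)}"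
    proof (rule finite_measure_mono)
      have "{\<omega>\<in>space M. X t \<omega> \<in> cball (X t \<omega>0) (C0 * R)} = X t -` cball (X t \<omega>0) (C0 * R) \<inter> space M" by auto
      then show "{\<omega>\<in>space M. X t \<omega> \<in> cball (X t \<omega>0) (C0 * R)} \<in> sets M"
        using measurable_sets[OF Xm, of "cball (X t \<omega>0) (C0 * R)"] by simp
    qed
    moreover have "norm (X t \<omega>0) \<le> C1 * (1 + R)"
      if fin: "(\<integral>\<^sup>+ u\<in>{u. norm u \<le> 1}. ennreal (norm u) \<partial>Lm) < \<infinity>"
    proof -
      have c: "norm (mean_jumps Lm \<rho> s) \<le> t * I" if s: "s \<in> {0..t}" for s
      proof -
        have "norm (mean_jumps Lm \<rho> s) \<le> s * I"
          using fin s by (intro norm_mean_jumps_le[OF lm _ \<rho>(1) _ I0]) (auto simp: I_def)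
        also have "\<dots> \<le> t * I" using s I0 by (intro mult_right_mono) auto
        finally show ?thesis .
      qed
      \<comment> \<open>The constant path at \<open>x\<close> solves the same equation with noise
        \<open>- (s *\<^sub>R a x)\<close>. Stability against this path bounds the centre, the noise
        difference being \<open>Z s \<omega>0 + w s\<close>.\<close>
      define w where "w s = s *\<^sub>R a x - mean_jumps Lm \<rho> s" for s
      have w: "norm (w s) \<le> h" if s: "s \<in> {0..t}" for s
      proof -
        have "norm (w s) \<le> norm (s *\<^sub>R a x) + norm (mean_jumps Lm \<rho> s)"
          unfolding w_def by (rule norm_triangle_ineq4)
        also have "norm (s *\<^sub>R a x) \<le> t * norm (a x)" using s by (simp add: mult_right_mono)
        finally show ?thesis using c[OF s] by (simp add: h_def)
      qed
      have wm: "w \<in> borel_measurable borel"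
        unfolding w_def using borel_measurable_mean_jumps[OF lm] by measurable
      have wint: "set_integrable lborel {0..t} w"
        unfolding set_integrable_def
        by (rule integrableI_bounded_set_indicator[where B = h]) (use wm w in \<open>auto simp: emeasure_lborel_Icc_eq\<close>)
      have diff: "U s \<omega>0 - U 0 \<omega>0 - (- (s *\<^sub>R a x)) = Z s \<omega>0 + w s" for s by (simp add: Z_def w_def)
      have int: "set_integrable lborel {0..t} (\<lambda>s. Z s \<omega>0 + w s)"
        by (intro set_integral_add(1) Zint \<omega>0 wint)
      have const: "x = x + (LBINT r:{0..s}. a x) + - (s *\<^sub>R a x)" if "s \<in> {0..t}" for s
        using that by (simp add: set_lebesgue_integral_def)
      have const_int: "set_integrable lborel {0..t} (\<lambda>r. a x)"
        unfolding set_integrable_def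
        by (rule integrableI_bounded_set_indicator[where B = "norm (a x)"]) (auto simp: emeasure_lborel_Icc_eq)
      have h_int: "set_integrable lborel {0..t} (\<lambda>s. h)"
        unfolding set_integrable_def
        by (rule integrableI_bounded_set_indicator[where B = "\<bar>h\<bar>"]) (auto simp: emeasure_lborel_Icc_eq)
      have "norm (X t \<omega>0 - x) \<le> norm (Z t \<omega>0 + w t) + E * (LBINT s:{0..t}. norm (Z s \<omega>0 + w s))"
        using additive_noise_stability[where ?X2.0 = "\<lambda>_. x" and ?V2.0 = "\<lambda>s. - (s *\<^sub>R a x)",
            OF less_imp_le[OF t] L lip eqn(1)[OF \<omega>0] const_int eqn(2)[OF \<omega>0] const] int
        unfolding diff E_def by simp
      also have "norm (Z t \<omega>0 + w t) \<le> R + h"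
        using norm_triangle_ineq[of "Z t \<omega>0" "w t"] Zt[OF \<omega>0] w[of t] t by simp
      also have "(LBINT s:{0..t}. norm (Z s \<omega>0 + w s)) \<le> (LBINT s:{0..t}. norm (Z s \<omega>0) + h)"
      proof (rule set_integral_mono)
        show "set_integrable lborel {0..t} (\<lambda>s. norm (Z s \<omega>0) + h)"
          by (intro set_integral_add(1) set_integrable_norm Zint \<omega>0 h_int)
        show "norm (Z s \<omega>0 + w s) \<le> norm (Z s \<omega>0) + h" if "s \<in> {0..t}" for s
          using norm_triangle_ineq[of "Z s \<omega>0" "w s"] w[OF that] by linarith
      qed (intro set_integrable_norm int)
      also have "\<dots> = (LBINT s:{0..t}. norm (Z s \<omega>0)) + (LBINT s:{0..t}. h)"
        by (intro set_integral_add(2) set_integrable_norm Zint \<omega>0 h_int)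
      also have "(LBINT s:{0..t}. h) = t * h" using t by (simp add: set_lebesgue_integral_def)
      finally have "norm (X t \<omega>0 - x) \<le> (R + h) + E * ((LBINT s:{0..t}. norm (Z s \<omega>0)) + t * h)"
        using E0 by (simp add: mult_left_mono)
      also have "\<dots> \<le> (R + h) + E * ((t + 1) * R + t * h)"
        using E0 ZI[OF \<omega>0] by (intro add_left_mono mult_left_mono add_right_mono) auto
      finally have "norm (X t \<omega>0) \<le> norm x + ((R + h) + E * ((t + 1) * R + t * h))"
        using norm_triangle_sub[of "X t \<omega>0" x] by linarith
      also have "\<dots> = (norm x + (1 + E * t) * h) + (1 + E * (t + 1)) * R" by (simp add: algebra_simps)
      also have "\<dots> \<le> C1 + C1 * R"
        using R E0 t h0 by (intro add_mono mult_right_mono) (auto simp: C1_def)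
      finally show ?thesis by (simp add: algebra_simps)
    qed
    ultimately show ?thesis using PG by (intro exI[of _ "X t \<omega>0"]) auto
  qed
  ultimately show ?thesis by (rule that)
qed

text \<open>The strict inequality between \<open>\<tau>\<close> and \<open>\<kappa>\<close> leaves a
  positive power of \<open>\<epsilon>\<close>, which beats every power of the logarithm in the
  radius.\<close>

lemma radius_asymptotics:
  fixes C C0 D \<kappa> \<tau> :: real
  assumes "0 < C0" "0 < D" "0 \<le> \<tau>" "\<tau> < \<kappa>"
  shows "((\<lambda>\<epsilon>. C0 * sqrt (D * \<epsilon>\<^sup>2 * ln (1 / \<epsilon>))) \<longlongrightarrow> 0) (at_right 0)"
    and "\<forall>\<^sub>F \<epsilon> in at_right 0. C * (C0 * sqrt (D * \<epsilon>\<^sup>2 * ln (1 / \<epsilon>))) powr \<kappa> < \<epsilon> powr \<tau> / 2"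
proof -
  show "((\<lambda>\<epsilon>. C0 * sqrt (D * \<epsilon>\<^sup>2 * ln (1 / \<epsilon>))) \<longlongrightarrow> 0) (at_right 0)"
    using assms by real_asymp
  define d where "d = \<kappa> - \<tau>"
  have "0 < d" using assms by (simp add: d_def)
  have "((\<lambda>\<epsilon>. C * (C0 * sqrt (D * ln (1 / \<epsilon>))) powr \<kappa> * \<epsilon> powr d) \<longlongrightarrow> 0) (at_right 0)"
    using assms \<open>0 < d\<close> by real_asymp
  then have "\<forall>\<^sub>F \<epsilon> in at_right 0. C * (C0 * sqrt (D * ln (1 / \<epsilon>))) powr \<kappa> * \<epsilon> powr d < 1 / 2"
    by (rule order_tendstoD(2)) simp
  moreover have "\<forall>\<^sub>F \<epsilon> in at_right (0::real). \<epsilon> \<in> {0<..<1}"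
    by (rule eventually_at_right_real) simp
  ultimately show "\<forall>\<^sub>F \<epsilon> in at_right 0. C * (C0 * sqrt (D * \<epsilon>\<^sup>2 * ln (1 / \<epsilon>))) powr \<kappa> < \<epsilon> powr \<tau> / 2"
  proof eventually_elim
    case (elim \<epsilon>)
    then have \<epsilon>: "0 < \<epsilon>" "0 < ln (1 / \<epsilon>)" by auto
    have "C0 * sqrt (D * \<epsilon>\<^sup>2 * ln (1 / \<epsilon>)) = (C0 * sqrt (D * ln (1 / \<epsilon>))) * \<epsilon>"
      using \<epsilon> by (simp add: real_sqrt_mult)
    then have "C * (C0 * sqrt (D * \<epsilon>\<^sup>2 * ln (1 / \<epsilon>))) powr \<kappa> =
        C * ((C0 * sqrt (D * ln (1 / \<epsilon>))) powr \<kappa> * \<epsilon> powr (d + \<tau>))"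
      using \<epsilon> assms by (simp add: powr_mult d_def)
    also have "\<dots> = (C * (C0 * sqrt (D * ln (1 / \<epsilon>))) powr \<kappa> * \<epsilon> powr d) * \<epsilon> powr \<tau>"
      by (simp add: powr_add)
    also have "\<dots> < 1 / 2 * \<epsilon> powr \<tau>"
      using elim(1) \<epsilon> by (intro mult_strict_right_mono) auto
    finally show ?case by simp
  qed
qed

text \<open>\<open>R0\<close> precedes \<open>C\<close>: in the summable case the balls that violate
  larger and larger \<open>C\<close> keep their centres in one bounded region, so that even a local
  bound on the density is contradicted.\<close>

lemma small_ball_lower_bound:
  fixes Lm :: "'a::euclidean_space measure" and U X :: "real \<Rightarrow> 'w \<Rightarrow> 'a"
  assumes "prob_space M" and smooth: "smooth_bounded_derivs a" and levy: "levy_process M Lm U"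
    and sol: "solves_equation M a U x X" and t: "0 < t"
    and index: "ennreal t * lower_order_index Lm < ennreal \<kappa>"
  obtains R0 where "\<And>C. \<exists>y r. 0 < r \<and> r \<le> 1 \<and>
      ((\<integral>\<^sup>+ u\<in>{u. norm u \<le> 1}. ennreal (norm u) \<partial>Lm) < \<infinity> \<longrightarrow> norm y \<le> R0) \<and>
      C * r powr \<kappa> < measure M {\<omega>\<in>space M. X t \<omega> \<in> cball y r}"
proof -
  have lm: "levy_measure Lm" using levy by (simp add: levy_process_def)
  obtain C0 C1 where C01: "0 < C0" "0 \<le> C1" and conc: "\<And>\<rho> \<beta> R. 0 < \<rho> \<Longrightarrow> \<rho> \<le> 1 \<Longrightarrow> 0 < R \<Longrightarrow>
      (\<integral>\<^sup>+u\<in>{u. norm u \<le> \<rho>}. ennreal ((norm u)\<^sup>2) \<partial>Lm) \<le> ennreal \<beta> \<Longrightarrow> 0 \<le> \<beta> \<Longrightarrow>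
      16 * (t + t\<^sup>2) * \<beta> \<le> R\<^sup>2 \<Longrightarrow>
      \<exists>y. exp (- t * measure Lm {u. \<rho> < norm u}) / 2 \<le> measure M {\<omega>\<in>space M. X t \<omega> \<in> cball y (C0 * R)} \<and>
        ((\<integral>\<^sup>+ u\<in>{u. norm u \<le> 1}. ennreal (norm u) \<partial>Lm) < \<infinity> \<longrightarrow> norm y \<le> C1 * (1 + R))"
    by (rule concentration_on_small_balls[OF assms(1) smooth levy sol t]) blast
  obtain \<theta> c K where \<theta>: "0 \<le> \<theta>" "t * \<theta> < \<kappa>" and c: "0 < c" and K: "0 \<le> K"
    and freq: "\<exists>\<^sub>F \<epsilon> in at_right 0. emeasure Lm {u. \<epsilon> / c < norm u} \<le> ennreal (\<theta> * ln (1 / \<epsilon>)) \<and>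
       (\<integral>\<^sup>+u\<in>{u. norm u \<le> \<epsilon> / c}. ennreal ((norm u)\<^sup>2) \<partial>Lm) \<le> ennreal (K * \<epsilon>\<^sup>2 * ln (1 / \<epsilon>))"
    by (rule lower_order_index_tail_bounds[OF lm t index])
  \<comment> \<open>\<open>16 * (t + t\<^sup>2) * K\<close> already meets the moment condition; the
    added 1 keeps the radius positive when \<open>K\<close> is 0.\<close>
  define D where "D = 16 * (t + t\<^sup>2) * (K + 1)"
  have D: "0 < D" using t K by (simp add: D_def add_pos_nonneg)
  define R where "R \<epsilon> = sqrt (D * \<epsilon>\<^sup>2 * ln (1 / \<epsilon>))" for \<epsilon>
  show ?thesis
  proof (rule that[of "C1 * 2"])
    fix C
    have \<tau>: "0 \<le> t * \<theta>" using t \<theta> by simp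
    have "\<forall>\<^sub>F \<epsilon> in at_right (0::real). \<epsilon> \<in> {0<..<1}"
      by (rule eventually_at_right_real) simp
    moreover have "\<forall>\<^sub>F \<epsilon> in at_right (0::real). \<epsilon> \<in> {0<..<c}"
      using c by (rule eventually_at_right_real)
    \<comment> \<open>Only convergence of the radius to 0 is wanted here, so the exponents 0 and 1
      passed to \<open>radius_asymptotics\<close> are placeholders.\<close>
    moreover have "\<forall>\<^sub>F \<epsilon> in at_right 0. C0 * R \<epsilon> < 1"
      using radius_asymptotics(1)[OF C01(1) D order.refl zero_less_one] unfolding R_def
      by (rule order_tendstoD(2)) simp
    moreover have "\<forall>\<^sub>F \<epsilon> in at_right 0. 1 * R \<epsilon> < 1"
      using radius_asymptotics(1)[OF zero_less_one D order.refl zero_less_one] unfolding R_def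
      by (rule order_tendstoD(2)) simp
    moreover have "\<forall>\<^sub>F \<epsilon> in at_right 0. C * (C0 * R \<epsilon>) powr \<kappa> < \<epsilon> powr (t * \<theta>) / 2"
      unfolding R_def by (rule radius_asymptotics(2)[OF C01(1) D \<tau> \<theta>(2)])
    ultimately have "\<forall>\<^sub>F \<epsilon> in at_right 0. \<epsilon> \<in> {0<..<1} \<and> \<epsilon> \<in> {0<..<c} \<and> C0 * R \<epsilon> < 1 \<and> 1 * R \<epsilon> < 1 \<and>
        C * (C0 * R \<epsilon>) powr \<kappa> < \<epsilon> powr (t * \<theta>) / 2"
      by eventually_elim simp
    \<comment> \<open>The tail bounds hold frequently and everything else eventually, so some single
      \<open>\<epsilon>\<close> has all the properties.\<close>
    from frequently_ex[OF frequently_eventually_conj[OF freq this]]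
    obtain \<epsilon> where \<epsilon>: "0 < \<epsilon>" "\<epsilon> < 1" "\<epsilon> < c" and R1: "C0 * R \<epsilon> < 1" "R \<epsilon> < 1"
      and less: "C * (C0 * R \<epsilon>) powr \<kappa> < \<epsilon> powr (t * \<theta>) / 2"
      and tail: "emeasure Lm {u. \<epsilon> / c < norm u} \<le> ennreal (\<theta> * ln (1 / \<epsilon>))"
      and var: "(\<integral>\<^sup>+u\<in>{u. norm u \<le> \<epsilon> / c}. ennreal ((norm u)\<^sup>2) \<partial>Lm) \<le> ennreal (K * \<epsilon>\<^sup>2 * ln (1 / \<epsilon>))"
      by auto
    have ln: "0 < ln (1 / \<epsilon>)" using \<epsilon> by simp
    have R0: "0 < R \<epsilon>" unfolding R_def using D \<epsilon> ln by simp
    have "(R \<epsilon>)\<^sup>2 = D * \<epsilon>\<^sup>2 * ln (1 / \<epsilon>)" unfolding R_def using D \<epsilon> ln by (intro real_sqrt_pow2) simp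
    also have "\<dots> = 16 * (t + t\<^sup>2) * (K * \<epsilon>\<^sup>2 * ln (1 / \<epsilon>)) + 16 * (t + t\<^sup>2) * (\<epsilon>\<^sup>2 * ln (1 / \<epsilon>))"
      by (simp add: D_def algebra_simps)
    finally have "16 * (t + t\<^sup>2) * (K * \<epsilon>\<^sup>2 * ln (1 / \<epsilon>)) \<le> (R \<epsilon>)\<^sup>2"
      using t ln by simp
    then obtain y where y: "exp (- t * measure Lm {u. \<epsilon> / c < norm u}) / 2 \<le>
        measure M {\<omega>\<in>space M. X t \<omega> \<in> cball y (C0 * R \<epsilon>)}"
      "(\<integral>\<^sup>+ u\<in>{u. norm u \<le> 1}. ennreal (norm u) \<partial>Lm) < \<infinity> \<longrightarrow> norm y \<le> C1 * (1 + R \<epsilon>)"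
      using conc[of "\<epsilon> / c" "R \<epsilon>" "K * \<epsilon>\<^sup>2 * ln (1 / \<epsilon>)"] \<epsilon> c R0 var K ln by (auto simp: field_simps)
    have "measure Lm {u. \<epsilon> / c < norm u} \<le> \<theta> * ln (1 / \<epsilon>)"
      using tail \<theta> ln unfolding measure_def by (intro enn2real_leI) auto
    then have "t * measure Lm {u. \<epsilon> / c < norm u} \<le> t * (\<theta> * ln (1 / \<epsilon>))"
      using t by (intro mult_left_mono) auto
    \<comment> \<open>The logarithmic tail bound turns the void probability into a power of
      \<open>\<epsilon>\<close>.\<close>
    moreover have "\<epsilon> powr (t * \<theta>) = exp (- (t * (\<theta> * ln (1 / \<epsilon>))))"
      using \<epsilon> by (simp add: powr_def ln_div)
    ultimately have "\<epsilon> powr (t * \<theta>) \<le> exp (- t * measure Lm {u. \<epsilon> / c < norm u})" by simp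
    then have "C * (C0 * R \<epsilon>) powr \<kappa> < measure M {\<omega>\<in>space M. X t \<omega> \<in> cball y (C0 * R \<epsilon>)}"
      using less y(1) by linarith
    moreover have "C1 * (1 + R \<epsilon>) \<le> C1 * 2" using C01 R1 by (intro mult_left_mono) auto
    ultimately show "\<exists>y r. 0 < r \<and> r \<le> 1 \<and>
      ((\<integral>\<^sup>+ u\<in>{u. norm u \<le> 1}. ennreal (norm u) \<partial>Lm) < \<infinity> \<longrightarrow> norm y \<le> C1 * 2) \<and>
      C * r powr \<kappa> < measure M {\<omega>\<in>space M. X t \<omega> \<in> cball y r}"
      using y(2) C01 R0 R1 by (intro exI[of _ y] exI[of _ "C0 * R \<epsilon>"]) auto
  qed
qed

section \<open>Upper bounds for ball probabilities from a density\<close>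

lemma distributed_ball_le:
  fixes X :: "'w \<Rightarrow> 'a::euclidean_space"
  assumes "prob_space M" and dist: "distributed M lborel X (\<lambda>y. ennreal (p y))"
    and ae: "AE y in lborel. p y = g y" and b: "AE y in lborel. y \<in> B \<longrightarrow> g y \<le> h y"
    and B: "B \<in> sets borel"
  shows "ennreal (measure M {\<omega>\<in>space M. X \<omega> \<in> B}) \<le> (\<integral>\<^sup>+y\<in>B. ennreal (h y) \<partial>lborel)"
proof -
  interpret prob_space M by fact
  have "ennreal (prob {\<omega>\<in>space M. X \<omega> \<in> B}) = emeasure M (X -` B \<inter> space M)"
    by (simp add: emeasure_eq_measure vimage_def Int_def conj_commute)
  also have "\<dots> = (\<integral>\<^sup>+y\<in>B. ennreal (p y) \<partial>lborel)"
    using B by (intro distributed_emeasure[OF dist]) auto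
  also have "\<dots> \<le> (\<integral>\<^sup>+y\<in>B. ennreal (h y) \<partial>lborel)"
    by (rule nn_integral_mono_AE, use ae b in eventually_elim) (auto simp: indicator_def intro: ennreal_leI)
  finally show ?thesis .
qed

lemma ball_probability_of_bounded_density:
  fixes X :: "'w \<Rightarrow> 'a::euclidean_space"
  assumes "prob_space M" "distributed M lborel X (\<lambda>y. ennreal (p y))" "AE y in lborel. p y = g y"
    and b: "AE y in lborel. y \<in> cball z r \<longrightarrow> \<bar>g y\<bar> \<le> C" and "0 \<le> C" "0 < r"
  shows "measure M {\<omega>\<in>space M. X \<omega> \<in> cball z r} \<le> C * unit_ball_vol (real DIM('a)) * r powr real DIM('a)"
proof -
  have "AE y in lborel. y \<in> cball z r \<longrightarrow> g y \<le> C" using b by eventually_elim auto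
  from distributed_ball_le[OF assms(1-3) this]
  have "ennreal (measure M {\<omega>\<in>space M. X \<omega> \<in> cball z r}) \<le> ennreal C * emeasure lborel (cball z r)"
    by (simp add: nn_integral_cmult_indicator)
  also have "\<dots> = ennreal (C * unit_ball_vol (real DIM('a)) * r powr real DIM('a))"
    using \<open>0 \<le> C\<close> \<open>0 < r\<close> by (simp add: emeasure_cball ennreal_mult'[symmetric] powr_realpow mult.assoc)
  finally show ?thesis using assms(5,6) by (simp add: ennreal_le_iff)
qed

text \<open>Splitting at the height \<open>T = |B|\<^sup>-\<^sup>1\<^sup>/\<^sup>q\<close> replaces Hoelder's inequality.\<close>

lemma ball_probability_of_Lr_density:
  fixes X :: "'w \<Rightarrow> 'a::euclidean_space"
  assumes "prob_space M" "distributed M lborel X (\<lambda>y. ennreal (p y))" "AE y in lborel. p y = g y"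
    and [measurable]: "g \<in> borel_measurable borel" and "1 < q" "0 < r" "cball z r \<subseteq> S"
    and int: "set_integrable lborel S (\<lambda>y. \<bar>g y\<bar> powr q)"
  shows "measure M {\<omega>\<in>space M. X \<omega> \<in> cball z r} \<le>
    (1 + (LBINT y:S. \<bar>g y\<bar> powr q)) * unit_ball_vol (real DIM('a)) powr (1 - 1 / q) *
      r powr (real DIM('a) * (1 - 1 / q))"
proof -
  define V where "V = unit_ball_vol (real DIM('a)) * r powr real DIM('a)"
  have V: "0 < V" using \<open>0 < r\<close> by (simp add: V_def)
  define I where "I = (LBINT y:S. \<bar>g y\<bar> powr q)"
  have I0: "0 \<le> I" unfolding I_def set_lebesgue_integral_def by (intro Bochner_Integration.integral_nonneg) auto
  \<comment> \<open>The height that balances the two terms: \<open>T * V\<close> and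
    \<open>T powr (1 - q)\<close> both equal \<open>V powr (1 - 1 / q)\<close>.\<close>
  define T where "T = V powr (- 1 / q)"
  have T: "0 < T" using V by (simp add: T_def)
  \<comment> \<open>Above \<open>T\<close>, the factor \<open>s powr (1 - q)\<close> has a negative
    exponent and is therefore at most \<open>T powr (1 - q)\<close>.\<close>
  have pt: "s \<le> T + T powr (1 - q) * s powr q" if "0 \<le> s" for s
  proof (cases "s \<le> T")
    case True
    then show ?thesis using T by (simp add: add_increasing2)
  next
    case False
    then have "0 < s" using T by simp
    then have "s = s powr (1 - q) * s powr q" by (simp add: powr_add[symmetric])
    also have "\<dots> \<le> T powr (1 - q) * s powr q"
      using False T \<open>1 < q\<close> by (intro mult_right_mono powr_mono2') auto
    finally show ?thesis using T by simp
  qed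
  have "AE y in lborel. y \<in> cball z r \<longrightarrow> g y \<le> T + T powr (1 - q) * \<bar>g y\<bar> powr q"
  proof (intro AE_I2 impI)
    show "g y \<le> T + T powr (1 - q) * \<bar>g y\<bar> powr q" for y
      using pt[of "\<bar>g y\<bar>"] abs_ge_self[of "g y"] by linarith
  qed
  from distributed_ball_le[OF assms(1-3) this]
  have "ennreal (measure M {\<omega>\<in>space M. X \<omega> \<in> cball z r}) \<le>
      (\<integral>\<^sup>+y\<in>cball z r. ennreal (T + T powr (1 - q) * \<bar>g y\<bar> powr q) \<partial>lborel)" by simp
  also have "\<dots> = (\<integral>\<^sup>+y. ennreal T * indicator (cball z r) y +
      ennreal (T powr (1 - q)) * (ennreal (\<bar>g y\<bar> powr q) * indicator (cball z r) y) \<partial>lborel)"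
  proof (rule nn_integral_cong)
    fix y :: 'a
    have "ennreal (T + T powr (1 - q) * \<bar>g y\<bar> powr q) =
        ennreal T + ennreal (T powr (1 - q)) * ennreal (\<bar>g y\<bar> powr q)"
      using T by (subst ennreal_plus) (simp_all add: ennreal_mult)
    then show "ennreal (T + T powr (1 - q) * \<bar>g y\<bar> powr q) * indicator (cball z r) y =
        ennreal T * indicator (cball z r) y +
        ennreal (T powr (1 - q)) * (ennreal (\<bar>g y\<bar> powr q) * indicator (cball z r) y)"
      by (cases "y \<in> cball z r") simp_all
  qed
  also have "\<dots> = ennreal T * emeasure lborel (cball z r) +
      ennreal (T powr (1 - q)) * (\<integral>\<^sup>+y\<in>cball z r. ennreal (\<bar>g y\<bar> powr q) \<partial>lborel)"
  proof -
    have [measurable]: "cball z r \<in> sets borel" by simp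
    have "(\<integral>\<^sup>+y. ennreal T * indicator (cball z r) y \<partial>lborel) = ennreal T * emeasure lborel (cball z r)"
      by (rule nn_integral_cmult_indicator) simp
    moreover have "(\<integral>\<^sup>+y. ennreal (T powr (1 - q)) * (ennreal (\<bar>g y\<bar> powr q) * indicator (cball z r) y) \<partial>lborel) =
        ennreal (T powr (1 - q)) * (\<integral>\<^sup>+y\<in>cball z r. ennreal (\<bar>g y\<bar> powr q) \<partial>lborel)"
      by (rule nn_integral_cmult) measurable
    moreover have "(\<integral>\<^sup>+y. ennreal T * indicator (cball z r) y +
        ennreal (T powr (1 - q)) * (ennreal (\<bar>g y\<bar> powr q) * indicator (cball z r) y) \<partial>lborel) =
        (\<integral>\<^sup>+y. ennreal T * indicator (cball z r) y \<partial>lborel) +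
        (\<integral>\<^sup>+y. ennreal (T powr (1 - q)) * (ennreal (\<bar>g y\<bar> powr q) * indicator (cball z r) y) \<partial>lborel)"
      by (rule nn_integral_add) measurable
    ultimately show ?thesis by simp
  qed
  also have "\<dots> \<le> ennreal T * ennreal V + ennreal (T powr (1 - q)) * ennreal I"
  proof (intro add_mono mult_left_mono)
    show "emeasure lborel (cball z r) \<le> ennreal V"
      using \<open>0 < r\<close> by (simp add: emeasure_cball V_def powr_realpow)
    have "(\<integral>\<^sup>+y\<in>cball z r. ennreal (\<bar>g y\<bar> powr q) \<partial>lborel) \<le> (\<integral>\<^sup>+y. ennreal (indicator S y *\<^sub>R \<bar>g y\<bar> powr q) \<partial>lborel)"
      using assms(7) by (intro nn_integral_mono) (auto simp: indicator_def)
    also have "\<dots> = ennreal I"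
      using int unfolding I_def set_integrable_def set_lebesgue_integral_def
      by (intro nn_integral_eq_integral) auto
    finally show "(\<integral>\<^sup>+y\<in>cball z r. ennreal (\<bar>g y\<bar> powr q) \<partial>lborel) \<le> ennreal I" .
  qed auto
  also have "\<dots> = ennreal (T * V + T powr (1 - q) * I)"
    using T V I0 by (simp add: ennreal_mult[symmetric] ennreal_plus[symmetric] del: ennreal_plus)
  finally have "measure M {\<omega>\<in>space M. X \<omega> \<in> cball z r} \<le> T * V + T powr (1 - q) * I"
    using T V I0 by (subst (asm) ennreal_le_iff) auto
  also have "T * V = V powr (1 - 1 / q)"
  proof -
    have "T * V = V powr (- 1 / q) * V powr 1" using V by (simp add: T_def)
    also have "\<dots> = V powr (1 - 1 / q)" unfolding powr_add[symmetric] by simp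
    finally show ?thesis .
  qed
  also have "T powr (1 - q) = V powr (1 - 1 / q)"
  proof -
    have "- 1 / q * (1 - q) = 1 - 1 / q" using \<open>1 < q\<close> by (simp add: field_simps)
    then show ?thesis by (simp add: T_def powr_powr)
  qed
  also have "V powr (1 - 1 / q) = unit_ball_vol (real DIM('a)) powr (1 - 1 / q) * r powr (real DIM('a) * (1 - 1 / q))"
    unfolding V_def using \<open>0 < r\<close> by (simp add: powr_mult powr_powr)
  finally show ?thesis by (simp add: I_def algebra_simps)
qed

section \<open>The four statements of non-membership\<close>

theorem theorem1p4:
  fixes M :: "'w measure"
    and a :: "real ^ 'm \<Rightarrow> real ^ 'm"
    and Lm :: "(real ^ 'm) measure"
    and U X :: "real \<Rightarrow> 'w \<Rightarrow> real ^ 'm"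
    and x :: "real ^ 'm"
    and t :: real
    and p :: "real ^ 'm \<Rightarrow> real"
  assumes "prob_space M"
    and "smooth_bounded_derivs a"
    and "levy_process M Lm U"
    and "\<forall>q::real. (\<integral>\<^sup>+ u\<in>{u. 1 < norm u}. ennreal (norm u powr q) \<partial>Lm) < \<infinity>"
    and "solves_equation M a U x X"
    and "t > 0"
    and "AE y in lborel. 0 \<le> p y"
    and "distributed M lborel (X t) (\<lambda>y. ennreal (p y))"
  shows
    "((\<integral>\<^sup>+ u\<in>{u. norm u \<le> 1}. ennreal (norm u) \<partial>Lm) < \<infinity> \<longrightarrow>
        (\<forall>r>1. ennreal t * lower_order_index Lm < ennreal (real CARD('m) * (1 - 1 / r)) \<longrightarrow>
           \<not> has_version_in p (Lr_loc_class r)) \<and>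
        (ennreal t * lower_order_index Lm < ennreal (real CARD('m)) \<longrightarrow>
           \<not> has_version_in p C_class)) \<and>
     ((\<integral>\<^sup>+ u\<in>{u. norm u \<le> 1}. ennreal (norm u) \<partial>Lm) = \<infinity> \<longrightarrow>
        (\<forall>r>1. ennreal t * lower_order_index Lm < ennreal (real CARD('m) * (1 - 1 / r)) \<longrightarrow>
           \<not> has_version_in p (Lr_class r)) \<and>
        (ennreal t * lower_order_index Lm < ennreal (real CARD('m)) \<longrightarrow>
           \<not> has_version_in p CB0_class))"
proof -
  note dist = assms(8)
  \<comment> \<open>All four cases contradict the lower bound through an upper bound of this shape.
    The guard restricts the balls only in the summable case: radius at most 1 around a centre of
    norm at most \<open>R0\<close> explains \<open>R0 + 1\<close>, and \<open>C\<close> may depend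
    on \<open>R0\<close>.\<close>
  have not_all_small: False
    if index: "ennreal t * lower_order_index Lm < ennreal \<kappa>"
      and le: "\<And>R0. \<exists>C. \<forall>z r. 0 < r \<and> r \<le> 1 \<and>
        ((\<integral>\<^sup>+ u\<in>{u. norm u \<le> 1}. ennreal (norm u) \<partial>Lm) < \<infinity> \<longrightarrow> cball z r \<subseteq> cball 0 (R0 + 1)) \<longrightarrow>
        measure M {\<omega>\<in>space M. X t \<omega> \<in> cball z r} \<le> C * r powr \<kappa>" for \<kappa>
  proof -
    obtain R0 where R0: "\<And>C. \<exists>y r. 0 < r \<and> r \<le> 1 \<and>
      ((\<integral>\<^sup>+ u\<in>{u. norm u \<le> 1}. ennreal (norm u) \<partial>Lm) < \<infinity> \<longrightarrow> norm y \<le> R0) \<and>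
      C * r powr \<kappa> < measure M {\<omega>\<in>space M. X t \<omega> \<in> cball y r}"
      by (rule small_ball_lower_bound[OF assms(1-3,5,6) index]) blast
    obtain C where C: "\<And>z r. 0 < r \<Longrightarrow> r \<le> 1 \<Longrightarrow>
        ((\<integral>\<^sup>+ u\<in>{u. norm u \<le> 1}. ennreal (norm u) \<partial>Lm) < \<infinity> \<longrightarrow> cball z r \<subseteq> cball 0 (R0 + 1)) \<Longrightarrow>
        measure M {\<omega>\<in>space M. X t \<omega> \<in> cball z r} \<le> C * r powr \<kappa>"
      using le[of R0] by blast
    obtain y r where yr: "0 < r" "r \<le> 1"
      "(\<integral>\<^sup>+ u\<in>{u. norm u \<le> 1}. ennreal (norm u) \<partial>Lm) < \<infinity> \<longrightarrow> norm y \<le> R0"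
      "C * r powr \<kappa> < measure M {\<omega>\<in>space M. X t \<omega> \<in> cball y r}"
      using R0[of C] by blast
    have "cball y r \<subseteq> cball 0 (R0 + 1)" if "norm y \<le> R0"
      using that yr(2) by (simp add: cball_subset_cball_iff dist_norm)
    then have "(\<integral>\<^sup>+ u\<in>{u. norm u \<le> 1}. ennreal (norm u) \<partial>Lm) < \<infinity> \<longrightarrow> cball y r \<subseteq> cball 0 (R0 + 1)"
      using yr(3) by blast
    from C[OF yr(1,2) this] yr(4) show False by linarith
  qed
  have Lr_loc: "\<not> has_version_in p (Lr_loc_class r)"
    if "(\<integral>\<^sup>+ u\<in>{u. norm u \<le> 1}. ennreal (norm u) \<partial>Lm) < \<infinity>" "1 < r"
      and index: "ennreal t * lower_order_index Lm < ennreal (real CARD('m) * (1 - 1 / r))" for r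
  proof
    assume "has_version_in p (Lr_loc_class r)"
    then obtain g where g: "g \<in> borel_measurable borel" "AE y in lborel. p y = g y"
      "\<And>K. compact K \<Longrightarrow> set_integrable lborel K (\<lambda>y. \<bar>g y\<bar> powr r)"
      by (auto simp: has_version_in_def Lr_loc_class_def)
    show False
    proof (rule not_all_small[OF index])
      fix R0
      show "\<exists>C. \<forall>z s. 0 < s \<and> s \<le> 1 \<and>
        ((\<integral>\<^sup>+ u\<in>{u. norm u \<le> 1}. ennreal (norm u) \<partial>Lm) < \<infinity> \<longrightarrow> cball z s \<subseteq> cball 0 (R0 + 1)) \<longrightarrow>
        measure M {\<omega>\<in>space M. X t \<omega> \<in> cball z s} \<le> C * s powr (real CARD('m) * (1 - 1 / r))"
      proof (intro exI allI impI)
        fix z :: "real ^ 'm" and s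
        assume s: "0 < s \<and> s \<le> 1 \<and>
          ((\<integral>\<^sup>+ u\<in>{u. norm u \<le> 1}. ennreal (norm u) \<partial>Lm) < \<infinity> \<longrightarrow> cball z s \<subseteq> cball 0 (R0 + 1))"
        then have "0 < s" "cball z s \<subseteq> cball 0 (R0 + 1)" using that(1) by blast+
        from ball_probability_of_Lr_density[OF assms(1) dist g(2,1) that(2) this g(3)[OF compact_cball]]
        show "measure M {\<omega>\<in>space M. X t \<omega> \<in> cball z s} \<le>
            (1 + set_lebesgue_integral lborel (cball 0 (R0 + 1)) (\<lambda>y. \<bar>g y\<bar> powr r)) *
            unit_ball_vol (real DIM(real ^ 'm)) powr (1 - 1 / r) * s powr (real CARD('m) * (1 - 1 / r))"
          by simp
      qed
    qed
  qed
  have C0: "\<not> has_version_in p C_class"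
    if "(\<integral>\<^sup>+ u\<in>{u. norm u \<le> 1}. ennreal (norm u) \<partial>Lm) < \<infinity>"
      and index: "ennreal t * lower_order_index Lm < ennreal (real CARD('m))"
  proof
    assume "has_version_in p C_class"
    then obtain g where g: "continuous_on UNIV g" "AE y in lborel. p y = g y"
      by (auto simp: has_version_in_def C_class_def)
    show False
    proof (rule not_all_small[OF index])
      fix R0
      \<comment> \<open>Continuity bounds \<open>g\<close> on compact sets only, which is enough
        because the guard confines the balls.\<close>
      have "bounded (g ` cball 0 (R0 + 1))"
        by (intro compact_imp_bounded compact_continuous_image continuous_on_subset[OF g(1)]) auto
      then obtain C where C: "0 < C" "\<And>y. y \<in> cball 0 (R0 + 1) \<Longrightarrow> \<bar>g y\<bar> \<le> C"
        by (auto simp: bounded_pos)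
      show "\<exists>C. \<forall>z s. 0 < s \<and> s \<le> 1 \<and>
        ((\<integral>\<^sup>+ u\<in>{u. norm u \<le> 1}. ennreal (norm u) \<partial>Lm) < \<infinity> \<longrightarrow> cball z s \<subseteq> cball 0 (R0 + 1)) \<longrightarrow>
        measure M {\<omega>\<in>space M. X t \<omega> \<in> cball z s} \<le> C * s powr (real CARD('m))"
      proof (intro exI allI impI)
        fix z :: "real ^ 'm" and s
        assume s: "0 < s \<and> s \<le> 1 \<and>
          ((\<integral>\<^sup>+ u\<in>{u. norm u \<le> 1}. ennreal (norm u) \<partial>Lm) < \<infinity> \<longrightarrow> cball z s \<subseteq> cball 0 (R0 + 1))"
        then have "cball z s \<subseteq> cball 0 (R0 + 1)" using that(1) by blast
        then have "AE y in lborel. y \<in> cball z s \<longrightarrow> \<bar>g y\<bar> \<le> C" using C(2) by (intro AE_I2) blast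
        from ball_probability_of_bounded_density[OF assms(1) dist g(2) this] C(1) s
        show "measure M {\<omega>\<in>space M. X t \<omega> \<in> cball z s} \<le> C * unit_ball_vol (real DIM(real ^ 'm)) * s powr (real CARD('m))"
          by simp
      qed
    qed
  qed
  \<comment> \<open>Integrability over the whole space bounds balls with arbitrary centres, so the
    region \<open>S\<close> is \<open>UNIV\<close>; this covers centres that escape to
    infinity.\<close>
  have Lr: "\<not> has_version_in p (Lr_class r)"
    if "1 < r" and index: "ennreal t * lower_order_index Lm < ennreal (real CARD('m) * (1 - 1 / r))" for r
  proof
    assume "has_version_in p (Lr_class r)"
    then obtain g where g: "g \<in> borel_measurable borel" "AE y in lborel. p y = g y"
      "set_integrable lborel UNIV (\<lambda>y. \<bar>g y\<bar> powr r)"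
      by (auto simp: has_version_in_def Lr_class_def set_integrable_def)
    show False
    proof (rule not_all_small[OF index])
      fix R0
      show "\<exists>C. \<forall>z s. 0 < s \<and> s \<le> 1 \<and>
        ((\<integral>\<^sup>+ u\<in>{u. norm u \<le> 1}. ennreal (norm u) \<partial>Lm) < \<infinity> \<longrightarrow> cball z s \<subseteq> cball 0 (R0 + 1)) \<longrightarrow>
        measure M {\<omega>\<in>space M. X t \<omega> \<in> cball z s} \<le> C * s powr (real CARD('m) * (1 - 1 / r))"
      proof (intro exI allI impI)
        fix z :: "real ^ 'm" and s
        assume "0 < s \<and> s \<le> 1 \<and>
          ((\<integral>\<^sup>+ u\<in>{u. norm u \<le> 1}. ennreal (norm u) \<partial>Lm) < \<infinity> \<longrightarrow> cball z s \<subseteq> cball 0 (R0 + 1))"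
        then have "0 < s" by blast
        from ball_probability_of_Lr_density[OF assms(1) dist g(2,1) that(1) this subset_UNIV g(3)]
        show "measure M {\<omega>\<in>space M. X t \<omega> \<in> cball z s} \<le>
            (1 + set_lebesgue_integral lborel UNIV (\<lambda>y. \<bar>g y\<bar> powr r)) *
            unit_ball_vol (real DIM(real ^ 'm)) powr (1 - 1 / r) * s powr (real CARD('m) * (1 - 1 / r))"
          by simp
      qed
    qed
  qed
  have CB0: "\<not> has_version_in p CB0_class"
    if index: "ennreal t * lower_order_index Lm < ennreal (real CARD('m))"
  proof
    assume "has_version_in p CB0_class"
    then obtain g C where g: "AE y in lborel. p y = g y" and C: "AE y in lborel. \<bar>g y\<bar> \<le> C"
      by (auto simp: has_version_in_def CB0_class_def)
    show False
    proof (rule not_all_small[OF index])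
      fix R0
      show "\<exists>C. \<forall>z s. 0 < s \<and> s \<le> 1 \<and>
        ((\<integral>\<^sup>+ u\<in>{u. norm u \<le> 1}. ennreal (norm u) \<partial>Lm) < \<infinity> \<longrightarrow> cball z s \<subseteq> cball 0 (R0 + 1)) \<longrightarrow>
        measure M {\<omega>\<in>space M. X t \<omega> \<in> cball z s} \<le> C * s powr (real CARD('m))"
      proof (intro exI allI impI)
        fix z :: "real ^ 'm" and s
        assume s: "0 < s \<and> s \<le> 1 \<and>
          ((\<integral>\<^sup>+ u\<in>{u. norm u \<le> 1}. ennreal (norm u) \<partial>Lm) < \<infinity> \<longrightarrow> cball z s \<subseteq> cball 0 (R0 + 1))"
        \<comment> \<open>The maximum supplies the nonnegative constant that the ball estimate asks
          for; the definition of the class does not state a sign for \<open>C\<close>.\<close>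
        have "AE y in lborel. y \<in> cball z s \<longrightarrow> \<bar>g y\<bar> \<le> max 0 C" using C by eventually_elim auto
        from ball_probability_of_bounded_density[OF assms(1) dist g this] s
        show "measure M {\<omega>\<in>space M. X t \<omega> \<in> cball z s} \<le>
            max 0 C * unit_ball_vol (real DIM(real ^ 'm)) * s powr (real CARD('m))"
          by simp
      qed
    qed
  qed
  show ?thesis using Lr_loc C0 Lr CB0 by blast
qed

end
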